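(* Fix $p\ge 1$, $r\in\{1,2\}$, $\sigma>0$ and a distribution function $\Psi$ on $\mathbb{R}$; let $Z$ be a random variable with distribution function $\Psi$. Let $\omega:\mathbb{R}\to[0,\infty)$ be continuous and bounded with $\sup_{x\in\mathbb{R}}|x|^r\omega(x)<\infty$ and $\mathbb{E}[|Z|^r\omega(Z)]>0$. For each $n$, let $\bm X=\bm Y+\sigma\bm Z\in\mathbb{R}^n$, where the coordinates of $\bm Z$ are i.i.d. with distribution function $\Psi$. Let $\bm\psi$ be either the deterministic proxy or the random proxy (defined in the context), and $\bm w=\omega(\bm\psi)$. Let $\kappa:(0,1)\to[1,\infty)$ be measurable with $$\lim_{u\downarrow0}\frac{\min\{\kappa(u),\kappa(1-u)\}}{\sqrt{\log\log(1/u)}}=\infty,$$ and suppose that: (i) $\Psi$ is absolutely continuous, with a continuous density $\Psi'$ which is strictly positive in the interior of the support of $\Psi$; (ii) either $\omega\circ\Psi^{-1}$ is supported on a compact subset of $(0,1)$, or $\eta=1/(\Psi'\circ\Psi^{-1})$ varies regularly at both endpoints $0$ and $1$; (iii) $u\mapsto\omega(\Psi^{-1}(u))[\kappa(u)\eta(u)\sqrt{u(1-u)}]^r$ is bounded on $(0,1)$ by a Lebesgue integrable function which varies regularly at both endpoints $0$ and $1$; (iv) in the case of the random proxy only: the auxiliary sample is independent of $\bm Z$, and there exists $\varpi:(0,1)\to[0,\infty)$ with $\omega\circ\Psi^{-1}\le\varpi$ on $(0,1)$, where $\varpi$ is either supported on a compact subset of $(0,1)$ or varies regularly at both endpoints $0$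 and $1$, and $u\mapsto\varpi(u)[\kappa(u)\eta(u)\sqrt{u(1-u)}]^r$ is bounded on $(0,1)$ by a Lebesgue integrable function which varies regularly at both endpoints $0$ and $1$. Then, as $n\to\infty$, $$|\Sigma_r-\sigma|=O_{\mathbb P}\big(n^{-1/p}\|\bm Y\|_p+n^{-1/2}\big).$$
   Context: $\Psi^{-1}(u)=\inf\{x:\Psi(x)\ge u\}$, and $\eta=(\Psi^{-1})'=1/(\Psi'\circ\Psi^{-1})$ on $(0,1)$ (so $\Psi^{-1}$ is differentiable on $(0,1)$, i.e. the support of $\Psi$ is an interval). $\bm x^{\uparrow}$ is the non-decreasing rearrangement of $\bm x\in\mathbb{R}^n$; functions of vectors are applied coordinatewise. Deterministic proxy: $\psi_k=\Psi^{-1}(k/(n+1))$, $1\le k\le n$. Random proxy: $\bm\psi=\bm\xi^{\uparrow}$, where $\bm\xi$ is an auxiliary i.i.d. sample of size $n$ with distribution function $\Psi$, generated independently of $\bm X$. The estimator $\Sigma_r$ is a minimizer over $s\in\mathbb{R}$ of $\sum_{k=1}^n w_k|X_k^{\uparrow}-s\psi_k|^r$. No assumption is made on the dependence between $\bm Y$ and $\bm Z$. $\zeta_n=O_{\mathbb P}(\beta_n)$ means that $\zeta_n/\beta_n$ is bounded in probability (tight) as $n\to\infty$ ($\beta_n$ may be random). A positive measurable $f$ varies regularly at $0$ with index $\rho$ if $f(\lambda t)/f(t)\to\lambda^\rho$ as $t\downarrow0$ for every $\lambda>0$; $f:(0,1)\to\mathbb{R}$ varies regularly at $1$ if $t\mapsto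 f(1-t)$ varies regularly at $0$. *)

theory Defs
  imports "HOL-Probability.Probability"
begin

text \<open>
  A vector in \<open>\<real>\<^sup>n\<close> is a function \<open>nat \<Rightarrow> real\<close> of which only the coordinates \<open>1, \<dots>, n\<close> matter.
  A triangular array \<open>V\<close> of random vectors is written \<open>V n k x\<close>: sample size \<open>n\<close>, coordinate \<open>k\<close>,
  outcome \<open>x\<close>.
\<close>

definition quantile :: "(real \<Rightarrow> real) \<Rightarrow> real \<Rightarrow> real" where
  "quantile \<Psi> u = Inf {x. u \<le> \<Psi> x}"

definition measure_support :: "real measure \<Rightarrow> real set" where
  "measure_support \<mu> = {x. \<forall>U. open U \<longrightarrow> x \<in> U \<longrightarrow> 0 < emeasure \<mu> U}"

definition rearrange :: "nat \<Rightarrow> (nat \<Rightarrow> real) \<Rightarrow> nat \<Rightarrow> real" where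
  "rearrange n v k = sort (map v [1..<Suc n]) ! (k - 1)"

definition lp_norm :: "real \<Rightarrow> nat \<Rightarrow> (nat \<Rightarrow> real) \<Rightarrow> real" where
  "lp_norm p n v = (\<Sum>k=1..n. \<bar>v k\<bar> powr p) powr (1 / p)"

text \<open>Regular variation of functions on the open unit interval; values outside it are irrelevant.\<close>

definition regvar_at_0 :: "(real \<Rightarrow> real) \<Rightarrow> real \<Rightarrow> bool" where
  "regvar_at_0 f \<rho> \<longleftrightarrow>
     f \<in> borel_measurable (restrict_space borel {0<..<1}) \<and>
     (\<forall>t\<in>{0<..<1}. 0 < f t) \<and>
     (\<forall>c>0. ((\<lambda>t. f (c * t) / f t) \<longlongrightarrow> c powr \<rho>) (at_right 0))"

definition regvar_at_endpoints :: "(real \<Rightarrow> real) \<Rightarrow> bool" where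
  "regvar_at_endpoints f \<longleftrightarrow>
     (\<exists>\<rho>. regvar_at_0 f \<rho>) \<and> (\<exists>\<rho>. regvar_at_0 (\<lambda>t. f (1 - t)) \<rho>)"

definition compactly_supported :: "(real \<Rightarrow> real) \<Rightarrow> bool" where
  "compactly_supported f \<longleftrightarrow>
     (\<exists>K. compact K \<and> K \<subseteq> {0<..<1} \<and> (\<forall>u\<in>{0<..<1}. f u \<noteq> 0 \<longrightarrow> u \<in> K))"

definition regvar_dominated :: "(real \<Rightarrow> real) \<Rightarrow> bool" where
  "regvar_dominated g \<longleftrightarrow>
     (\<exists>h. set_integrable lborel {0<..<1} h \<and> regvar_at_endpoints h \<and> (\<forall>u\<in>{0<..<1}. g u \<le> h u))"

definition random_vec :: "nat \<Rightarrow> (nat \<Rightarrow> 'a \<Rightarrow> real) \<Rightarrow> 'a \<Rightarrow> nat \<Rightarrow> real" where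
  "random_vec n V x = (\<lambda>k\<in>{1..n}. V k x)"

definition iid_sample :: "'a measure \<Rightarrow> real measure \<Rightarrow> nat \<Rightarrow> (nat \<Rightarrow> 'a \<Rightarrow> real) \<Rightarrow> bool" where
  "iid_sample M \<mu> n V \<longleftrightarrow>
     prob_space.indep_vars M (\<lambda>_. borel) V {1..n} \<and> (\<forall>k\<in>{1..n}. distr M borel (V k) = \<mu>)"

definition indep_vecs :: "'a measure \<Rightarrow> nat \<Rightarrow> (nat \<Rightarrow> 'a \<Rightarrow> real) \<Rightarrow> (nat \<Rightarrow> 'a \<Rightarrow> real) \<Rightarrow> bool" where
  "indep_vecs M n V W \<longleftrightarrow>
     prob_space.indep_var M (Pi\<^sub>M {1..n} (\<lambda>_. borel)) (random_vec n V)
                            (Pi\<^sub>M {1..n} (\<lambda>_. borel)) (random_vec n W)"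

definition deterministic_proxy ::
  "(nat \<Rightarrow> 'a measure) \<Rightarrow> (real \<Rightarrow> real) \<Rightarrow> (nat \<Rightarrow> nat \<Rightarrow> 'a \<Rightarrow> real) \<Rightarrow> bool" where
  "deterministic_proxy M \<Psi> \<psi> \<longleftrightarrow>
     (\<forall>n\<ge>1. \<forall>k\<in>{1..n}. \<forall>x\<in>space (M n). \<psi> n k x = quantile \<Psi> (real k / (real n + 1)))"

definition random_proxy ::
  "(nat \<Rightarrow> 'a measure) \<Rightarrow> real measure \<Rightarrow> (nat \<Rightarrow> nat \<Rightarrow> 'a \<Rightarrow> real) \<Rightarrow>
   (nat \<Rightarrow> nat \<Rightarrow> 'a \<Rightarrow> real) \<Rightarrow> (nat \<Rightarrow> nat \<Rightarrow> 'a \<Rightarrow> real) \<Rightarrow> bool" where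
  "random_proxy M \<mu> X \<xi> \<psi> \<longleftrightarrow>
     (\<forall>n\<ge>1. iid_sample (M n) \<mu> n (\<xi> n) \<and> indep_vecs (M n) n (\<xi> n) (X n) \<and>
        (\<forall>k\<in>{1..n}. \<forall>x\<in>space (M n). \<psi> n k x = rearrange n (\<lambda>j. \<xi> n j x) k))"

text \<open>
  \<open>\<zeta>\<^sub>n = O\<^sub>P(\<beta>\<^sub>n)\<close>, for positive \<open>\<beta>\<^sub>n\<close>: the laws of \<open>\<zeta>\<^sub>n / \<beta>\<^sub>n\<close>, \<open>n \<ge> 1\<close>, form a tight sequence. The index
  starts at 1 because \<open>\<beta>\<^sub>0\<close> may vanish. The constant \<open>tight\<close> also requires every \<open>\<zeta>\<^sub>n / \<beta>\<^sub>n\<close> to have a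
  probability law; for random variables, tightness from some index on and tightness of the whole
  sequence are the same.
\<close>

definition bigo_in_prob ::
  "(nat \<Rightarrow> 'a measure) \<Rightarrow> (nat \<Rightarrow> 'a \<Rightarrow> real) \<Rightarrow> (nat \<Rightarrow> 'a \<Rightarrow> real) \<Rightarrow> bool" where
  "bigo_in_prob M \<zeta> \<beta> \<longleftrightarrow>
     tight (\<lambda>n. distr (M (Suc n)) borel (\<lambda>x. \<zeta> (Suc n) x / \<beta> (Suc n) x))"

end

theory Submission
  imports Defs
begin

text \<open>
  Write \<open>u\<^sub>k = k / (n + 1)\<close> and let \<open>T\<^sub>k\<close>, \<open>T'\<^sub>k\<close> be the values of \<open>\<Psi>\<close> at \<open>Z\<^sub>k\<up>\<close> and \<open>\<psi>\<^sub>k\<close>; each is either \<open>u\<^sub>k\<close> or a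
  uniform order statistic. Comparing the minimizer with \<open>\<sigma>\<close> (for \<open>r = 1\<close> by the triangle inequality, for
  \<open>r = 2\<close> by the normal equation) reduces the claim to three estimates: rearrangement contracts the
  \<open>\<ell>\<^sup>1\<close>-distance; \<open>\<Sum>w\<^sub>k \<bar>\<psi>\<^sub>k\<bar>\<^sup>r\<close> is at least a multiple of \<open>n\<close>; and \<open>\<Sum>w\<^sub>k \<bar>Z\<^sub>k\<up> - \<psi>\<^sub>k\<bar>\<^sup>r\<close> is
  \<open>O(n\<^sup>1\<^sup>-\<^sup>r\<^sup>/\<^sup>2)\<close> in probability. For the last one, Chernoff bounds show that with high probability all
  \<open>T\<^sub>k\<close>, \<open>T'\<^sub>k\<close> are within a constant factor of \<open>u\<^sub>k\<close>, simultaneously from both endpoints. On that event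
  the mean value theorem for \<open>\<Psi>\<inverse>\<close> and regular variation bound the sum by a deterministic multiple of
  \<open>\<Sum>h(u\<^sub>k) (u\<^sub>k (1 - u\<^sub>k))\<^sup>-\<^sup>r\<^sup>/\<^sup>2 \<bar>T\<^sub>k - T'\<^sub>k\<bar>\<^sup>r\<close> with \<open>h\<close> integrable and regularly varying, whose expectation
  is controlled because \<open>T\<^sub>k\<close> has mean square error at most \<open>u\<^sub>k (1 - u\<^sub>k) / n\<close>.
\<close>

section \<open>Rearrangements\<close>

text \<open>The difficulty sits at the endpoints, where \<open>\<eta>\<close> may blow up: there a
  mean square bound for a score says nothing about its image under the quantile function, and the
  weighted sum need not even have a finite expectation. Therefore everything that multiplies the
  score differences is first bounded, on a good event, by deterministic numbers, and expectations
  are taken only afterwards. The smallest score is of order \<open>1 / n\<close>, but for no fixed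
  factor does it stay within that factor of \<open>1 / n\<close> with probability tending to 1; so
  the factor \<open>c\<close> has to grow as the tolerated failure probability shrinks. All later
  constants depend on \<open>c\<close>, which boundedness in probability permits. The rate comes
  from a cancellation: the square root of \<open>u * (1 - u)\<close> in the integrability condition
  is \<open>sqrt n\<close> times the standard deviation of a score, so it disappears from the
  expected sum and leaves a grid sum of an integrable function, which is of order \<open>n\<close>.
  The array \<open>Y\<close> enters through a pathwise inequality for the order statistics, so its
  dependence on \<open>Z\<close> is irrelevant.\<close>

lemma sorted_nth_le_iff:
  fixes xs :: "'a :: linorder list"
  assumes "sorted xs" "i < length xs"
  shows "xs ! i \<le> t \<longleftrightarrow> i < length (filter (\<lambda>y. y \<le> t) xs)"
proof -
  have f: "filter (\<lambda>y. y \<le> t) xs = takeWhile (\<lambda>y. y \<le> t) xs"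
    using assms(1)
  proof (induction xs)
    case (Cons a xs)
    then show ?case by (cases "a \<le> t"; cases xs) (auto simp: filter_empty_conv)
  qed simp
  show ?thesis
  proof
    assume le: "xs ! i \<le> t"
    have "\<not> length (takeWhile (\<lambda>y. y \<le> t) xs) \<le> i"
    proof
      assume l: "length (takeWhile (\<lambda>y. y \<le> t) xs) \<le> i"
      then have "\<not> xs ! length (takeWhile (\<lambda>y. y \<le> t) xs) \<le> t"
        using nth_length_takeWhile assms(2) by (metis order_le_less_trans)
      then show False
        using sorted_nth_mono[OF assms(1) l assms(2)] le by simp
    qed
    then show "i < length (filter (\<lambda>y. y \<le> t) xs)" using f by simp
  next
    assume "i < length (filter (\<lambda>y. y \<le> t) xs)"
    then show "xs ! i \<le> t"
      unfolding f by (metis nth_mem set_takeWhileD takeWhile_nth)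
  qed
qed

lemma length_filter_sort: "length (filter P (sort xs)) = length (filter P xs)"
  by (metis mset_filter mset_sort size_mset)

text \<open>Reduces order statistics to counting sample points below a threshold: monotonicity,
  measurability and the binomial tail of uniform order statistics all come from this equivalence,
  which is insensitive to ties.\<close>

lemma rearrange_le_iff:
  assumes "k \<in> {1..n}"
  shows "rearrange n v k \<le> t \<longleftrightarrow> k \<le> card {i\<in>{1..n}. v i \<le> t}"
proof -
  let ?xs = "map v [1..<Suc n]"
  have "card {i\<in>{1..n}. v i \<le> t} = length (filter (\<lambda>y. y \<le> t) ?xs)"
  proof -
    have "length (filter (\<lambda>y. y \<le> t) ?xs) = length (filter (\<lambda>i. v i \<le> t) [1..<Suc n])"
      by (simp add: filter_map o_def del: upt_Suc)
    also have "\<dots> = card (set (filter (\<lambda>i. v i \<le> t) [1..<Suc n]))"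
      by (rule distinct_card[symmetric]) (simp del: upt_Suc)
    also have "set (filter (\<lambda>i. v i \<le> t) [1..<Suc n]) = {i\<in>{1..n}. v i \<le> t}"
      by auto
    finally show ?thesis by simp
  qed
  moreover have "sort ?xs ! (k - 1) \<le> t \<longleftrightarrow> k - 1 < length (filter (\<lambda>y. y \<le> t) (sort ?xs))"
    using assms by (intro sorted_nth_le_iff) auto
  ultimately show ?thesis
    unfolding rearrange_def length_filter_sort using assms by auto
qed

lemma rearrange_mono:
  assumes "k \<in> {1..n}" "\<And>i. i \<in> {1..n} \<Longrightarrow> v i \<le> w i"
  shows "rearrange n v k \<le> rearrange n w k"
proof -
  have "k \<le> card {i\<in>{1..n}. w i \<le> rearrange n w k}"
    using rearrange_le_iff[OF assms(1)] by blast
  also have "\<dots> \<le> card {i\<in>{1..n}. v i \<le> rearrange n w k}"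
    using assms(2) by (intro card_mono) (auto intro: order_trans)
  finally show ?thesis using rearrange_le_iff[OF assms(1)] by blast
qed

lemma sum_rearrange: "(\<Sum>k=1..n. rearrange n v k) = (\<Sum>k=1..n. v k)"
proof -
  have l: "length (sort (map v [1..<Suc n])) = n" by simp
  have "(\<Sum>k=1..n. rearrange n v k) = (\<Sum>i<n. sort (map v [1..<Suc n]) ! i)"
    unfolding rearrange_def by (rule sum.reindex_bij_witness[of _ Suc "\<lambda>k. k - 1"]) auto
  also have "\<dots> = sum_list (sort (map v [1..<Suc n]))"
    using l by (simp add: sum_list_sum_nth atLeast0LessThan del: upt_Suc)
  also have "\<dots> = sum_list (map v [1..<Suc n])"
    by (metis mset_sort sum_mset_sum_list)
  also have "\<dots> = (\<Sum>k=1..n. v k)"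
    by (simp add: interv_sum_list_conv_sum_set_nat atLeastLessThanSuc_atLeastAtMost del: upt_Suc)
  finally show ?thesis .
qed

text \<open>The coordinatewise maximum \<open>?m\<close> dominates both vectors, and so do its order
  statistics. The detour through the maximum makes the bound linear, and sums do not change under
  rearrangement.\<close>

lemma rearrange_L1_contraction:
  "(\<Sum>k=1..n. \<bar>rearrange n v k - rearrange n w k\<bar>) \<le> (\<Sum>k=1..n. \<bar>v k - w k\<bar>)"
proof -
  let ?m = "\<lambda>k. max (v k) (w k)"
  have "(\<Sum>k=1..n. \<bar>rearrange n v k - rearrange n w k\<bar>)
      \<le> (\<Sum>k=1..n. (rearrange n ?m k - rearrange n v k) + (rearrange n ?m k - rearrange n w k))"
  proof (rule sum_mono)
    fix k assume "k \<in> {1..n}"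
    then have "rearrange n v k \<le> rearrange n ?m k" "rearrange n w k \<le> rearrange n ?m k"
      by (auto intro!: rearrange_mono)
    then show "\<bar>rearrange n v k - rearrange n w k\<bar>
        \<le> (rearrange n ?m k - rearrange n v k) + (rearrange n ?m k - rearrange n w k)"
      by linarith
  qed
  also have "\<dots> = (\<Sum>k=1..n. (?m k - v k) + (?m k - w k))"
    by (simp only: sum.distrib sum_subtractf sum_rearrange)
  also have "\<dots> = (\<Sum>k=1..n. \<bar>v k - w k\<bar>)"
    by (intro sum.cong) auto
  finally show ?thesis .
qed

lemma rearrange_mono_comp:
  assumes "mono g" "k \<in> {1..n}"
  shows "rearrange n (\<lambda>i. g (v i)) k = g (rearrange n v k)"
proof -
  have "sort (map (\<lambda>i. g (v i)) [1..<Suc n]) = map g (sort (map v [1..<Suc n]))"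
    by (rule properties_for_sort)
       (auto simp: sorted_map o_def multiset.map_comp intro!: sorted_wrt_mono_rel[OF _ sorted_sort] monoD[OF assms(1)]
         simp del: upt_Suc)
  then show ?thesis
    using assms(2) by (auto simp: rearrange_def simp del: upt_Suc intro!: nth_map)
qed

lemma borel_measurable_rearrange:
  assumes "\<And>i. i \<in> {1..n} \<Longrightarrow> V i \<in> borel_measurable M" "k \<in> {1..n}"
  shows "(\<lambda>x. rearrange n (\<lambda>i. V i x) k) \<in> borel_measurable M"
  unfolding borel_measurable_iff_le
proof
  fix t
  have [measurable]: "V i \<in> borel_measurable M" if "i \<in> {1..n}" for i using assms that by auto
  have c: "real (card {i\<in>{1..n}. V i x \<le> t}) = (\<Sum>i=1..n. indicator {..t} (V i x))" for x
    by (simp add: indicator_def sum.If_cases Int_def)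
  have "{x \<in> space M. rearrange n (\<lambda>i. V i x) k \<le> t}
      = {x \<in> space M. real k \<le> (\<Sum>i=1..n. indicator {..t} (V i x))}"
    unfolding c[symmetric] of_nat_le_iff using assms(2) by (simp add: rearrange_le_iff)
  also have "\<dots> \<in> sets M"
    by measurable
  finally show "{x \<in> space M. rearrange n (\<lambda>i. V i x) k \<le> t} \<in> sets M" .
qed

section \<open>Regular variation\<close>

text \<open>An Egorov-type argument: each \<open>s\<close> in \<open>{0..2 * L}\<close> enters
  \<open>V n\<close> for large \<open>n\<close>, because the limit \<open>a * s\<close> of the
  increments is strictly below the threshold in absolute value. Continuity of the measure from below
  does the rest.\<close>

lemma eventually_large_set:
  fixes g :: "real \<Rightarrow> real" and y :: "nat \<Rightarrow> real"
  assumes [measurable]: "g \<in> borel_measurable borel"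
    and lim: "\<And>s. ((\<lambda>x. g (x + s) - g x) \<longlongrightarrow> a * s) at_top"
    and y: "filterlim y at_top sequentially" and L: "0 < L"
  defines "V \<equiv> \<lambda>n. {s\<in>{0..2 * L}. \<forall>m\<ge>n. \<bar>g (y m + s) - g (y m)\<bar> \<le> 2 * \<bar>a\<bar> * L + 1}"
  shows "V n \<in> sets lborel" "eventually (\<lambda>n. emeasure lborel (V n) > ennreal (3 / 2 * L)) sequentially"
proof -
  show V: "V n \<in> sets lborel" for n unfolding V_def by measurable
  have "incseq V" unfolding incseq_def V_def by auto
  then have "(\<lambda>n. emeasure lborel (V n)) \<longlonglongrightarrow> emeasure lborel (\<Union>n. V n)"
    using V by (intro Lim_emeasure_incseq) auto
  also have "(\<Union>n. V n) = {0..2 * L}"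
  proof (intro equalityI subsetI)
    fix s assume s: "s \<in> {0..2 * L}"
    have "((\<lambda>m. g (y m + s) - g (y m)) \<longlongrightarrow> a * s) sequentially"
      using filterlim_compose[OF lim y] .
    then have "((\<lambda>m. \<bar>g (y m + s) - g (y m)\<bar>) \<longlongrightarrow> \<bar>a * s\<bar>) sequentially"
      by (rule tendsto_rabs)
    moreover have "\<bar>a * s\<bar> < 2 * \<bar>a\<bar> * L + 1"
    proof -
      have "\<bar>a * s\<bar> = \<bar>a\<bar> * s" using s by (simp add: abs_mult)
      also have "\<dots> \<le> \<bar>a\<bar> * (2 * L)" using s by (intro mult_left_mono) auto
      finally show ?thesis by (simp add: algebra_simps)
    qed
    ultimately have "eventually (\<lambda>m. \<bar>g (y m + s) - g (y m)\<bar> < 2 * \<bar>a\<bar> * L + 1) sequentially"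
      by (rule order_tendstoD(2))
    then obtain N where "\<forall>m\<ge>N. \<bar>g (y m + s) - g (y m)\<bar> < 2 * \<bar>a\<bar> * L + 1"
      unfolding eventually_sequentially by blast
    then have "s \<in> V N" using s by (auto simp: V_def intro: less_imp_le)
    then show "s \<in> (\<Union>n. V n)" by blast
  qed (auto simp: V_def)
  also have "emeasure lborel {0..2 * L} = ennreal (2 * L)" using L by simp
  finally show "eventually (\<lambda>n. emeasure lborel (V n) > ennreal (3 / 2 * L)) sequentially"
    by (rule order_tendstoD(1)) (use L in \<open>auto simp: ennreal_less_iff\<close>)
qed

text \<open>
  Along sequences \<open>x\<^sub>n \<rightarrow> \<infinity>\<close> and \<open>x\<^sub>n + s\<^sub>n\<close> violating the bound, the two sets on which the increments are
  controlled eventually fill so much of an interval that the first meets the translate of the second.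
\<close>

lemma increments_locally_uniformly_bounded:
  fixes g :: "real \<Rightarrow> real"
  assumes [measurable]: "g \<in> borel_measurable borel"
    and lim: "\<And>s. ((\<lambda>x. g (x + s) - g x) \<longlongrightarrow> a * s) at_top" and L: "0 < L"
  shows "\<exists>x0 B. \<forall>x\<ge>x0. \<forall>s\<in>{0..L}. \<bar>g (x + s) - g x\<bar> \<le> B"
proof (rule ccontr)
  define B where "B = 2 * \<bar>a\<bar> * L + 1"
  assume "\<nexists>x0 B. \<forall>x\<ge>x0. \<forall>s\<in>{0..L}. \<bar>g (x + s) - g x\<bar> \<le> B"
  then have "\<forall>n::nat. \<exists>x\<ge>real n. \<exists>s\<in>{0..L}. \<bar>g (x + s) - g x\<bar> > 2 * B"
    by (meson not_le)
  then obtain x where x: "\<And>n. x n \<ge> real n" "\<And>n. \<exists>s\<in>{0..L}. \<bar>g (x n + s) - g (x n)\<bar> > 2 * B"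
    by metis
  then obtain s where s: "\<And>n. s n \<in> {0..L}" "\<And>n. \<bar>g (x n + s n) - g (x n)\<bar> > 2 * B"
    by metis
  have fx: "filterlim x at_top sequentially"
    using x(1) by (intro filterlim_at_top_mono[OF filterlim_real_sequentially]) auto
  have fy: "filterlim (\<lambda>n. x n + s n) at_top sequentially"
    using x(1) s(1) by (intro filterlim_at_top_mono[OF filterlim_real_sequentially])
      (auto intro!: always_eventually add_increasing2)
  define V where "V n = {t\<in>{0..2 * L}. \<forall>m\<ge>n. \<bar>g (x m + t) - g (x m)\<bar> \<le> B}" for n
  define W where "W n = {t\<in>{0..2 * L}. \<forall>m\<ge>n. \<bar>g (x m + s m + t) - g (x m + s m)\<bar> \<le> B}" for n
  note lV = eventually_large_set[OF assms(1) lim fx L, folded B_def, folded V_def]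
  note lW = eventually_large_set[OF assms(1) lim fy L, folded B_def, folded W_def]
  obtain n where n: "emeasure lborel (V n) > ennreal (3 / 2 * L)" "emeasure lborel (W n) > ennreal (3 / 2 * L)"
    using eventually_conj[OF lV(2) lW(2)] unfolding eventually_sequentially by blast
  define W' where "W' = (\<lambda>t. t - s n) -` W n"
  have [measurable]: "V n \<in> sets borel" "W n \<in> sets borel" using lV(1) lW(1) by auto
  have W'm: "W' \<in> sets borel"
    unfolding W'_def by (rule measurable_sets_borel[of _ borel]) measurable
  have "emeasure lborel W' = emeasure (distr lborel borel ((+) (s n))) W'"
    by (simp add: lborel_distr_plus)
  also have "\<dots> = emeasure lborel (W n)"
    using W'm by (subst emeasure_distr) (auto simp: W'_def vimage_def)
  finally have eW: "emeasure lborel W' = emeasure lborel (W n)" .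
  have "V n \<inter> W' \<noteq> {}"
  proof
    assume "V n \<inter> W' = {}"
    then have "emeasure lborel (V n) + emeasure lborel W' = emeasure lborel (V n \<union> W')"
      using W'm by (intro plus_emeasure) auto
    \<comment> \<open>\<open>V n\<close> lies in \<open>{0..2 * L}\<close> and its partner is
      shifted by \<open>s n \<le> L\<close>, so both fit into length \<open>3 * L\<close>, half of
      which each of them exceeds.\<close>
    also have "\<dots> \<le> emeasure lborel {0..3 * L}"
      using L s(1)[of n] W'm by (intro emeasure_mono) (auto simp: V_def W_def W'_def)
    also have "\<dots> = ennreal (3 / 2 * L) + ennreal (3 / 2 * L)"
      using L by (simp flip: ennreal_plus)
    finally have "emeasure lborel (V n) + emeasure lborel (W n) \<le> ennreal (3 / 2 * L) + ennreal (3 / 2 * L)"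
      unfolding eW .
    with add_strict_mono[OF n] show False by simp
  qed
  then obtain t where t: "t \<in> V n" "t - s n \<in> W n" by (auto simp: W'_def)
  \<comment> \<open>The point \<open>x n + t\<close> is reached from \<open>x n\<close> and from
    \<open>x n + s n\<close> by controlled increments; this is why the negated bound carries
    \<open>2 * B\<close>.\<close>
  have "\<bar>g (x n + t) - g (x n)\<bar> \<le> B" "\<bar>g (x n + t) - g (x n + s n)\<bar> \<le> B"
    using t by (auto simp: V_def W_def algebra_simps)
  with s(2)[of n] show False by linarith
qed

text \<open>Regular variation is a limit for each factor separately, while random scores run through
  all factors in \<open>[1 / c, c]\<close> at once; this is the boundedness part of the uniform
  convergence theorem. Coordinates \<open>t = exp (- x)\<close> turn ratios of \<open>f\<close> into
  increments of \<open>g\<close>, and the index \<open>\<rho>\<close> into the slope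
  \<open>- \<rho>\<close>.\<close>

lemma regvar_at_0_comparable:
  assumes rv: "regvar_at_0 f \<rho>" and c: "1 < c"
  obtains C \<delta> where "0 < C" "0 < \<delta>" "\<delta> < 1"
    "\<And>s t. 0 < t \<Longrightarrow> t < \<delta> \<Longrightarrow> 1 / c \<le> s \<Longrightarrow> s \<le> c \<Longrightarrow> s * t < 1 \<and> f (s * t) \<le> C * f t"
proof -
  define f' where "f' u = indicator {0<..<1} u *\<^sub>R f u" for u
  have [measurable]: "f' \<in> borel_measurable borel"
    using rv unfolding regvar_at_0_def f'_def by (simp add: borel_measurable_restrict_space_iff)
  define g where "g x = (if 0 < x then ln (f' (exp (- x))) else 0)" for x
  have [measurable]: "g \<in> borel_measurable borel" unfolding g_def by measurable
  have g: "g x = ln (f (exp (- x)))" if "0 < x" for x using that by (simp add: g_def f'_def)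
  have pos: "0 < f (exp (- x))" if "0 < x" for x using rv that by (auto simp: regvar_at_0_def)
  have "((\<lambda>x. g (x + s) - g x) \<longlongrightarrow> - \<rho> * s) at_top" for s
  proof -
    have "((\<lambda>x::real. exp (- x)) \<longlongrightarrow> 0) at_top"
      using filterlim_compose[OF exp_at_bot filterlim_uminus_at_bot_at_top] .
    then have "filterlim (\<lambda>x::real. exp (- x)) (at_right 0) at_top"
      by (simp add: filterlim_at)
    moreover have "((\<lambda>t. f (exp (- s) * t) / f t) \<longlongrightarrow> exp (- s) powr \<rho>) (at_right 0)"
      using rv by (simp add: regvar_at_0_def)
    ultimately have "((\<lambda>x. f (exp (- s) * exp (- x)) / f (exp (- x))) \<longlongrightarrow> exp (- s) powr \<rho>) at_top"
      by (rule filterlim_compose[rotated])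
    then have "((\<lambda>x. ln (f (exp (- s) * exp (- x)) / f (exp (- x)))) \<longlongrightarrow> ln (exp (- s) powr \<rho>)) at_top"
      by (rule tendsto_ln) simp
    also have "ln (exp (- s) powr \<rho>) = - \<rho> * s" by (simp add: powr_def)
    finally show ?thesis
    proof (rule Lim_transform_eventually)
      show "\<forall>\<^sub>F x in at_top. ln (f (exp (- s) * exp (- x)) / f (exp (- x))) = g (x + s) - g x"
        using eventually_gt_at_top[of "max 0 (- s)"]
      proof eventually_elim
        case (elim x)
        then show ?case
          using pos[of x] pos[of "x + s"] by (simp add: g ln_div exp_add[symmetric] add.commute)
      qed
    qed
  qed
  from increments_locally_uniformly_bounded[OF _ this, of "ln c"]
  obtain x0 B where "\<forall>x\<ge>x0. \<forall>s\<in>{0..ln c}. \<bar>g (x + s) - g x\<bar> \<le> B"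
    using c by auto
  then have B: "\<And>x s. x \<ge> x0 \<Longrightarrow> s \<in> {0..ln c} \<Longrightarrow> \<bar>g (x + s) - g x\<bar> \<le> B"
    by blast
  \<comment> \<open>The margin \<open>ln c\<close> keeps the shifted point \<open>x - ln s\<close>
    beyond \<open>x0\<close> and positive for every admissible \<open>s\<close>.\<close>
  define X where "X = max x0 0 + ln c + 1"
  have lc: "ln c > 0" using c by simp
  show thesis
  proof (rule that[of "exp B" "exp (- X)"])
    show "exp (- X) < 1" using lc by (simp add: X_def)
    fix s t assume t: "0 < t" "t < exp (- X)" and s: "1 / c \<le> s" "s \<le> c"
    have s0: "0 < s" using s(1) c by (meson divide_pos_pos less_le_trans zero_less_one less_trans)
    define x where "x = - ln t"
    have xt: "t = exp (- x)" using t by (simp add: x_def)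
    have x: "x > X" using t(2) by (simp add: xt)
    have ls: "ln s \<le> ln c" "- ln c \<le> ln s"
    proof -
      show "ln s \<le> ln c" using s s0 by simp
      have "ln (1 / c) \<le> ln s" using s s0 c by (subst ln_le_cancel_iff) auto
      then show "- ln c \<le> ln s" using c by (simp add: ln_div)
    qed
    have st: "s * t = exp (- (x - ln s))" using s0 by (simp add: xt exp_diff exp_minus field_simps)
    have "\<bar>g (x - ln s) - g x\<bar> \<le> B"
    proof (cases "s \<le> 1")
      case True
      then have "ln s \<le> 0" using s0 by simp
      then show ?thesis using B[of x "- ln s"] ls x lc by (auto simp: X_def)
    next
      case False
      then show ?thesis using B[of "x - ln s" "ln s"] ls x by (auto simp: X_def abs_minus_commute)
    qed
    moreover have "0 < x" "0 < x - ln s" using ls x lc by (auto simp: X_def)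
    moreover have "g (x - ln s) = ln (f (s * t))" "g x = ln (f t)"
      using g[OF \<open>0 < x\<close>] g[OF \<open>0 < x - ln s\<close>] unfolding st by (simp_all add: xt)
    ultimately have "ln (f (s * t)) \<le> B + ln (f t)" by linarith
    then have "exp (ln (f (s * t))) \<le> exp (B + ln (f t))" by simp
    moreover have "0 < f (s * t)" "0 < f t"
      using pos[OF \<open>0 < x\<close>] pos[OF \<open>0 < x - ln s\<close>] unfolding st by (simp_all add: xt)
    ultimately have "f (s * t) \<le> exp B * f t" by (simp add: exp_add)
    moreover have "s * t < 1" using \<open>0 < x - ln s\<close> by (simp add: st)
    ultimately show "s * t < 1 \<and> f (s * t) \<le> exp B * f t" by blast
  qed auto
qed

text \<open>A Riemann sum is compared with the integral without monotonicity: \<open>h (u k)\<close>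
  is at most \<open>D\<close> times \<open>h\<close> on the interval \<open>I k\<close> to the left
  of \<open>u k\<close>. Only half a grid cell is used, so that \<open>u k / v \<le> 2\<close> on it
  even for \<open>k = 1\<close>, where a full cell would reach down to 0.\<close>

lemma sum_regvar_at_0_bounded:
  assumes rv: "regvar_at_0 h \<rho>" and int: "set_integrable lborel {0<..<1} h"
  obtains C \<delta> where "0 < \<delta>" "\<delta> < 1" "0 < C"
    "\<forall>n\<ge>1. (\<Sum>k | k \<in> {1..n} \<and> real k / (real n + 1) < \<delta>. h (real k / (real n + 1))) \<le> C * real n"
proof -
  from regvar_at_0_comparable[OF rv, of 2] obtain D \<delta> where D: "0 < D" "0 < \<delta>" "\<delta> < 1"
    "\<And>s t. 0 < t \<Longrightarrow> t < \<delta> \<Longrightarrow> 1 / 2 \<le> s \<Longrightarrow> s \<le> 2 \<Longrightarrow> s * t < 1 \<and> h (s * t) \<le> D * h t"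
    by auto
  have pos: "0 \<le> h t" if "t \<in> {0<..<1}" for t using rv that by (auto simp: regvar_at_0_def less_imp_le)
  define J where "J = (LINT v:{0<..<1}|lborel. h v)"
  have J0: "J \<ge> 0" unfolding J_def set_lebesgue_integral_def
    by (intro Bochner_Integration.integral_nonneg) (auto simp: indicator_def pos)
  show thesis
  \<comment> \<open>Half cells have length \<open>1 / (2 * (n + 1))\<close>, and
    \<open>2 * (n + 1) \<le> 4 * n\<close>; the summand 1 serves positivity.\<close>
  proof (rule that[of \<delta> "4 * D * J + 1"])
    show "4 * D * J + 1 > 0" using D J0 by (simp add: add_nonneg_pos)
    show "\<forall>n\<ge>1. (\<Sum>k | k \<in> {1..n} \<and> real k / (real n + 1) < \<delta>. h (real k / (real n + 1))) \<le> (4 * D * J + 1) * real n"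
    proof (intro allI impI)
      fix n :: nat assume n: "1 \<le> n"
      define u where "u k = real k / (real n + 1)" for k
      define I where "I k = {(real k - 1 / 2) / (real n + 1)<..u k}" for k
      let ?K = "{k. k \<in> {1..n} \<and> u k < \<delta>}"
      have len: "u k - (real k - 1 / 2) / (real n + 1) = 1 / (2 * (real n + 1))" for k
        unfolding u_def diff_divide_distrib[symmetric] by simp
      have le: "(real k - 1 / 2) / (real n + 1) \<le> u k" for k
        unfolding u_def by (intro divide_right_mono) auto
      have iI [simp]: "integrable lborel (indicator (I k) :: real \<Rightarrow> real)" for k
        using le[of k] by (simp add: I_def)
      have "(\<Sum>k\<in>?K. h (u k)) / (2 * (real n + 1)) = (\<Sum>k\<in>?K. h (u k) * measure lborel (I k))"
        using le len by (simp add: I_def sum_divide_distrib)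
      also have "\<dots> = (\<integral>v. (\<Sum>k\<in>?K. h (u k) * indicator (I k) v) \<partial>lborel)"
        by (subst Bochner_Integration.integral_sum) auto
      also have "\<dots> \<le> (\<integral>v. D * (indicator {0<..<1} v *\<^sub>R h v) \<partial>lborel)"
      proof (rule integral_mono)
        show "integrable lborel (\<lambda>v. \<Sum>k\<in>?K. h (u k) * indicator (I k) v)"
          by (intro Bochner_Integration.integrable_sum integrable_mult_right iI)
        show "integrable lborel (\<lambda>v. D * (indicator {0<..<1} v *\<^sub>R h v))"
          using int by (simp add: set_integrable_def)
        fix v
        show "(\<Sum>k\<in>?K. h (u k) * indicator (I k) v) \<le> D * (indicator {0<..<1} v *\<^sub>R h v)"
        proof (cases "\<exists>k\<in>?K. v \<in> I k")
          case False
          then have "(\<Sum>k\<in>?K. h (u k) * indicator (I k) v) = 0" by (intro sum.neutral) auto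
          moreover have "0 \<le> D * (indicator {0<..<1} v *\<^sub>R h v)"
            using D pos[of v] by (auto simp: indicator_def)
          ultimately show ?thesis by simp
        next
          case True
          then obtain j where j: "j \<in> ?K" "v \<in> I j" by blast
          have un: "k = j" if "v \<in> I k" for k
          proof -
            have "real k - 1 / 2 < v * (real n + 1)" "v * (real n + 1) \<le> real k"
              "real j - 1 / 2 < v * (real n + 1)" "v * (real n + 1) \<le> real j"
              using that j by (auto simp: I_def u_def field_simps)
            then show ?thesis by linarith
          qed
          have "(\<Sum>k\<in>?K. h (u k) * indicator (I k) v) = (\<Sum>k\<in>?K. if k = j then h (u j) else 0)"
          proof (rule sum.cong)
            fix k
            show "h (u k) * indicator (I k) v = (if k = j then h (u j) else 0)"
              using un[of k] j(2) by (cases "v \<in> I k") auto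
          qed simp
          also have "\<dots> = h (u j)" using j by simp
          also have "\<dots> \<le> D * h v"
          proof -
            have v: "0 < v" "v \<le> u j" "u j \<le> 2 * v"
            proof -
              show "v \<le> u j" using j by (simp add: I_def)
              have "v * (real n + 1) > real j - 1 / 2" using j by (auto simp: I_def field_simps)
              moreover have "real j \<ge> 1" using j by auto
              ultimately have "v * (real n + 1) > 0" "2 * v * (real n + 1) \<ge> real j" by auto
              then show "0 < v" "u j \<le> 2 * v"
                using zero_less_mult_pos2[of v "real n + 1"] by (auto simp: u_def field_simps)
            qed
            then have "h (u j / v * v) \<le> D * h v"
              using D(4)[of v "u j / v"] j by (auto simp: field_simps)
            then show ?thesis using v by simp
          qed
          also have "\<dots> = D * (indicator {0<..<1} v *\<^sub>R h v)"
          proof -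
            have "real j - 1 / 2 > 0" using j by auto
            then have "0 < (real j - 1 / 2) / (real n + 1)" by simp
            moreover have "(real j - 1 / 2) / (real n + 1) < v" using j(2) by (simp add: I_def)
            ultimately have "0 < v" by linarith
            moreover have "v < 1" using j D(3) by (auto simp: I_def)
            ultimately show ?thesis by simp
          qed
          finally show ?thesis .
        qed
      qed
      also have "\<dots> = D * J" by (simp add: J_def set_lebesgue_integral_def)
      finally have "(\<Sum>k\<in>?K. h (u k)) \<le> D * J * (2 * (real n + 1))" by (simp add: field_simps)
      also have "\<dots> \<le> D * J * (4 * real n)" using D J0 n by (intro mult_left_mono) auto
      also have "\<dots> \<le> (4 * D * J + 1) * real n" by (simp add: algebra_simps)
      finally show "(\<Sum>k | k \<in> {1..n} \<and> real k / (real n + 1) < \<delta>. h (real k / (real n + 1))) \<le> (4 * D * J + 1) * real n"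
        by (simp add: u_def)
    qed
  qed (use D in auto)
qed

section \<open>Uniform order statistics\<close>

text \<open>The Beta integral with parameters \<open>a + 1\<close> and \<open>b + 1\<close>. The
  induction step is an integration by parts whose boundary term \<open>?F\<close> vanishes at 0 and
  1.\<close>

lemma has_integral_power_mult_power:
  "((\<lambda>t. t ^ a * (1 - t) ^ b) has_integral fact a * fact b / fact (a + b + 1)) {0..1::real}"
proof (induction b arbitrary: a)
  case 0
  have "((\<lambda>t. t ^ a) has_integral (1 ^ Suc a / real (Suc a) - 0 ^ Suc a / real (Suc a))) {0..1}"
  proof (intro fundamental_theorem_of_calculus)
    fix t :: real
    show "((\<lambda>t. t ^ Suc a / real (Suc a)) has_vector_derivative t ^ a) (at t within {0..1})"
      using DERIV_cdivide[OF DERIV_power[OF DERIV_ident, where n = "Suc a"], where c = "real (Suc a)"]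
      by (simp flip: has_real_derivative_iff_has_vector_derivative)
  qed simp
  then show ?case by simp
next
  case (Suc b)
  let ?F = "\<lambda>t::real. t ^ Suc a * (1 - t) ^ Suc b / real (Suc a)"
  have "((\<lambda>t. t ^ a * (1 - t) ^ Suc b - real (Suc b) / real (Suc a) * (t ^ Suc a * (1 - t) ^ b))
      has_integral (?F 1 - ?F 0)) {0..1}"
  proof (rule fundamental_theorem_of_calculus)
    fix t :: real
    have "((\<lambda>t. t ^ Suc a) has_real_derivative real (Suc a) * t ^ a) (at t within {0..1})"
      using DERIV_power[OF DERIV_ident, where n = "Suc a"] by simp
    moreover have "((\<lambda>t. (1 - t) ^ Suc b) has_real_derivative - (real (Suc b) * (1 - t) ^ b)) (at t within {0..1})"
      using DERIV_power[OF DERIV_diff[OF DERIV_const DERIV_ident], where n = "Suc b"] by simp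
    ultimately have "(?F has_real_derivative (real (Suc a) * t ^ a * (1 - t) ^ Suc b
        + - (real (Suc b) * (1 - t) ^ b) * t ^ Suc a) / real (Suc a)) (at t within {0..1})"
      by (intro DERIV_cdivide DERIV_mult)
    also have "(real (Suc a) * t ^ a * (1 - t) ^ Suc b
        + - (real (Suc b) * (1 - t) ^ b) * t ^ Suc a) / real (Suc a)
      = t ^ a * (1 - t) ^ Suc b - real (Suc b) / real (Suc a) * (t ^ Suc a * (1 - t) ^ b)"
      by (simp add: add_divide_distrib diff_divide_distrib mult_ac del: power_Suc of_nat_Suc)
    finally show "(?F has_vector_derivative
        t ^ a * (1 - t) ^ Suc b - real (Suc b) / real (Suc a) * (t ^ Suc a * (1 - t) ^ b)) (at t within {0..1})"
      by (simp only: has_real_derivative_iff_has_vector_derivative)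
  qed simp
  from has_integral_add[OF this has_integral_mult_right[OF Suc.IH[of "Suc a"], of "real (Suc b) / real (Suc a)"]]
  have "((\<lambda>t. t ^ a * (1 - t) ^ Suc b) has_integral
      real (Suc b) / real (Suc a) * (fact (Suc a) * fact b / fact (Suc a + b + 1))) {0..1}"
    by simp
  also have "real (Suc b) / real (Suc a) * (fact (Suc a) * fact b / fact (Suc a + b + 1))
      = fact a * fact (Suc b) / (fact (a + Suc b + 1) :: real)"
  proof -
    have e: "Suc a + b + 1 = a + Suc b + 1" by simp
    show ?thesis unfolding e fact_Suc[of a] fact_Suc[of b] by (simp del: of_nat_Suc fact_Suc)
  qed
  finally show ?case .
qed

text \<open>Layer-cake formula: \<open>T x ^ Suc m\<close> is the integral of the weight
  \<open>w\<close> over \<open>{0..T x}\<close>, and Tonelli's theorem exchanges the integrals.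
  \<open>I\<close> is given as a gauge integral so that Beta integrals can be inserted
  directly.\<close>

lemma (in prob_space) moment_eq_tail_integral:
  assumes T [measurable]: "T \<in> borel_measurable M"
    and T01: "\<And>x. x \<in> space M \<Longrightarrow> T x \<in> {0..1}"
    and tail: "\<And>t. t \<in> {0<..<1} \<Longrightarrow> prob {x\<in>space M. t < T x} = F t"
    and F0: "\<And>t. t \<in> {0..1} \<Longrightarrow> 0 \<le> F t"
    and int: "((\<lambda>t. real (Suc m) * t ^ m * F t) has_integral I) {0..1}"
  shows "expectation (\<lambda>x. T x ^ Suc m) = I"
proof -
  define w :: "real \<Rightarrow> real" where "w t = real (Suc m) * t ^ m" for t
  have wm [measurable]: "w \<in> borel_measurable borel" unfolding w_def by measurable
  have w0: "w t \<ge> 0" if "0 \<le> t" for t using that by (simp add: w_def)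
  interpret P: pair_sigma_finite M lborel ..
  have "(\<integral>\<^sup>+ x. ennreal (T x ^ Suc m) \<partial>M)
      = (\<integral>\<^sup>+ x. (\<integral>\<^sup>+ t. ennreal (w t) * indicator {0..1} t * (if t < T x then 1 else 0) \<partial>lborel) \<partial>M)"
  proof (rule nn_integral_cong)
    fix x assume x: "x \<in> space M"
    have "(\<integral>\<^sup>+ t. ennreal (w t) * indicator {0..1} t * (if t < T x then 1 else 0) \<partial>lborel)
        = (\<integral>\<^sup>+ t. ennreal (w t) * indicator {0..T x} t \<partial>lborel)"
    proof (rule nn_integral_cong_AE)
      show "AE t in lborel. ennreal (w t) * indicator {0..1} t * (if t < T x then 1 else 0)
          = ennreal (w t) * indicator {0..T x} t"
        using AE_lborel_singleton[of "T x"]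
        by eventually_elim (use T01[OF x] in \<open>auto simp: indicator_def\<close>)
    qed
    also have "\<dots> = ennreal (T x ^ Suc m - 0 ^ Suc m)"
    proof (rule nn_integral_FTC_Icc)
      show "((\<lambda>t. t ^ Suc m) has_real_derivative w t) (at t)" for t
        unfolding w_def using DERIV_power[OF DERIV_ident, where n = "Suc m"] by simp
    qed (use T01[OF x] w0 in auto)
    finally show "ennreal (T x ^ Suc m)
        = (\<integral>\<^sup>+ t. ennreal (w t) * indicator {0..1} t * (if t < T x then 1 else 0) \<partial>lborel)" by simp
  qed
  also have "\<dots> = (\<integral>\<^sup>+ t. (\<integral>\<^sup>+ x. ennreal (w t) * indicator {0..1} t * (if t < T x then 1 else 0) \<partial>M) \<partial>lborel)"
    by (rule P.Fubini'[symmetric]) measurable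
  also have "\<dots> = (\<integral>\<^sup>+ t. ennreal (w t * F t) * indicator {0..1} t \<partial>lborel)"
  proof (rule nn_integral_cong_AE)
    show "AE t in lborel. (\<integral>\<^sup>+ x. ennreal (w t) * indicator {0..1} t * (if t < T x then 1 else 0) \<partial>M)
        = ennreal (w t * F t) * indicator {0..1} t"
      using AE_lborel_singleton[of 0] AE_lborel_singleton[of 1]
    proof eventually_elim
      case (elim t)
      have "(\<integral>\<^sup>+ x. ennreal (w t) * indicator {0..1} t * (if t < T x then 1 else 0) \<partial>M)
          = ennreal (w t) * indicator {0..1} t * (\<integral>\<^sup>+ x. indicator {x\<in>space M. t < T x} x \<partial>M)"
        by (subst nn_integral_cmult[symmetric])
           (auto intro!: nn_integral_cong simp: indicator_def)
      also have "(\<integral>\<^sup>+ x. indicator {x\<in>space M. t < T x} x \<partial>M) = ennreal (prob {x\<in>space M. t < T x})"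
        by (subst nn_integral_indicator) (auto simp: emeasure_eq_measure)
      also have "ennreal (w t) * indicator {0..1} t * \<dots> = ennreal (w t * F t) * indicator {0..1} t"
        using elim tail[of t] w0[of t] by (auto simp: indicator_def ennreal_mult')
      finally show ?case .
    qed
  qed
  also have "\<dots> = ennreal I"
    using int F0 w0 by (intro nn_integral_has_integral_lebesgue') (auto simp: w_def)
  finally have "(\<integral>\<^sup>+ x. ennreal (T x ^ Suc m) \<partial>M) = ennreal I" .
  moreover have "I \<ge> 0"
    using int F0 by (intro has_integral_nonneg[OF int]) auto
  ultimately show ?thesis
    by (intro integral_eq_nn_integral[THEN trans]) (auto simp: T01[THEN atLeastAtMost_iff[THEN iffD1]] AE_I2)
qed

text \<open>The intended \<open>U i\<close> is \<open>\<Psi>\<close> of an observation. It is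
  uniform but may take the values 0 and 1 on a null set, hence the open interval for
  \<open>t\<close> and the closed one for the range.\<close>

locale uniform_sample = prob_space M for M +
  fixes n :: nat and U :: "nat \<Rightarrow> 'a \<Rightarrow> real"
  assumes indep: "indep_vars (\<lambda>_. borel) U {1..n}"
    and unif: "\<And>i t. i \<in> {1..n} \<Longrightarrow> t \<in> {0<..<1} \<Longrightarrow> prob {x\<in>space M. U i x \<le> t} = t"
    and range: "\<And>i x. i \<in> {1..n} \<Longrightarrow> x \<in> space M \<Longrightarrow> U i x \<in> {0..1}"
begin

definition count :: "real \<Rightarrow> 'a \<Rightarrow> nat" where
  "count t x = card {i\<in>{1..n}. U i x \<le> t}"

definition ordstat :: "nat \<Rightarrow> 'a \<Rightarrow> real" where
  "ordstat k x = rearrange n (\<lambda>i. U i x) k"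

lemma U_meas: "i \<in> {1..n} \<Longrightarrow> U i \<in> borel_measurable M"
  using indep by (auto simp: indep_vars_def)

lemma ordstat_meas [measurable]: "k \<in> {1..n} \<Longrightarrow> ordstat k \<in> borel_measurable M"
  unfolding ordstat_def by (rule borel_measurable_rearrange) (auto intro: U_meas)

lemma ordstat_le_iff: "k \<in> {1..n} \<Longrightarrow> ordstat k x \<le> t \<longleftrightarrow> k \<le> count t x"
  unfolding ordstat_def count_def by (rule rearrange_le_iff)

lemma count_le: "count t x \<le> n"
  unfolding count_def by (rule order_trans[OF card_mono[of "{1..n}"]]) auto

lemma ordstat_range:
  assumes "k \<in> {1..n}" "x \<in> space M"
  shows "ordstat k x \<in> {0..1}"
proof -
  have "{i\<in>{1..n}. U i x \<le> 1} = {1..n}" using range assms(2) by auto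
  then have "count 1 x = n" by (simp add: count_def)
  then have "ordstat k x \<le> 1" using ordstat_le_iff[OF assms(1)] assms(1) by simp
  moreover have "ordstat k x \<ge> 0"
  proof (rule ccontr)
    assume "\<not> ordstat k x \<ge> 0"
    then have "k \<le> count (ordstat k x) x" "count (ordstat k x) x = 0"
      using ordstat_le_iff[OF assms(1), of x "ordstat k x"] range[OF _ assms(2)]
      unfolding count_def by fastforce+
    then show False using assms(1) by simp
  qed
  ultimately show ?thesis by simp
qed

text \<open>The count is a sum of independent indicators, so its generating function factorises. Its
  coefficients will give the binomial law, its values at chosen \<open>z\<close> the Chernoff
  bounds.\<close>

lemma generating_function:
  assumes t: "t \<in> {0<..<1}"
  shows "integrable M (\<lambda>x. z ^ count t x)"
    and "expectation (\<lambda>x. z ^ count t x) = (1 + (z - 1) * t) ^ n"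
proof -
  let ?g = "\<lambda>u::real. 1 + (z - 1) * indicator {..t} u"
  have eq: "z ^ count t x = (\<Prod>i=1..n. ?g (U i x))" for x
  proof -
    have "(\<Prod>i=1..n. ?g (U i x)) = (\<Prod>i=1..n. if U i x \<le> t then z else 1)"
      by (intro prod.cong) auto
    also have "\<dots> = z ^ card {i\<in>{1..n}. U i x \<le> t}"
      by (simp add: prod.If_cases Int_def)
    finally show ?thesis by (simp add: count_def)
  qed
  have ind: "indep_vars (\<lambda>_. borel) (\<lambda>i x. ?g (U i x)) {1..n}"
    by (rule indep_vars_compose2[OF indep]) measurable
  have int: "integrable M (\<lambda>x. ?g (U i x))" if "i \<in> {1..n}" for i
  proof -
    have [measurable]: "U i \<in> borel_measurable M" using that by (rule U_meas)
    show ?thesis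
      by (rule integrable_const_bound[where B = "1 + \<bar>z - 1\<bar>"]) (auto simp: indicator_def)
  qed
  have ex: "expectation (\<lambda>x. ?g (U i x)) = 1 + (z - 1) * t" if i: "i \<in> {1..n}" for i
  proof -
    have [measurable]: "U i \<in> borel_measurable M" using that by (rule U_meas)
    have "{x\<in>space M. U i x \<le> t} \<in> events" by measurable
    then have iI: "integrable M (indicator {x\<in>space M. U i x \<le> t} :: 'a \<Rightarrow> real)"
      by (simp add: emeasure_eq_measure)
    have "expectation (\<lambda>x. ?g (U i x))
        = expectation (\<lambda>x. 1 + (z - 1) * indicator {x\<in>space M. U i x \<le> t} x)"
      by (intro Bochner_Integration.integral_cong) (auto simp: indicator_def)
    also have "\<dots> = 1 + (z - 1) * prob {x\<in>space M. U i x \<le> t}"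
      using iI by (subst Bochner_Integration.integral_add) (auto simp: prob_space Int_def conj_commute)
    finally show ?thesis using unif[OF i t] by simp
  qed
  show "integrable M (\<lambda>x. z ^ count t x)"
    unfolding eq using indep_vars_integrable[OF _ ind int] by simp
  show "expectation (\<lambda>x. z ^ count t x) = (1 + (z - 1) * t) ^ n"
    unfolding eq by (subst indep_vars_lebesgue_integral[OF _ ind int]) (simp_all add: ex)
qed

lemma count_meas: "{x\<in>space M. P (count t x)} \<in> events"
proof -
  have U: "U i \<in> borel_measurable M" if "i \<in> {1..n}" for i using that by (rule U_meas)
  have "(\<lambda>x. real (count t x)) = (\<lambda>x. \<Sum>i=1..n. indicator {..t} (U i x))"
    by (auto simp: count_def indicator_def sum.If_cases Int_def)
  also have "\<dots> \<in> borel_measurable M"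
    using U by measurable
  finally have "(\<lambda>x. real (count t x)) \<in> borel_measurable M" .
  then have "(\<lambda>x. nat \<lfloor>real (count t x)\<rfloor>) \<in> measurable M (count_space UNIV)"
    by measurable
  then have [measurable]: "count t \<in> measurable M (count_space UNIV)" by simp
  show ?thesis by measurable
qed

lemma count_eq_meas: "{x\<in>space M. count t x = j} \<in> events"
  by (rule count_meas)

text \<open>Polynomials in \<open>z\<close> that agree everywhere have equal coefficients, so the
  binomial law can be read off the generating function.\<close>

lemma count_pmf:
  assumes t: "t \<in> {0<..<1}" and j: "j \<le> n"
  shows "prob {x\<in>space M. count t x = j} = real (n choose j) * t ^ j * (1 - t) ^ (n - j)"
proof -
  let ?p = "\<lambda>j. prob {x\<in>space M. count t x = j}"
  have "(\<Sum>j\<le>n. ?p j * z ^ j) = (\<Sum>j\<le>n. (real (n choose j) * t ^ j * (1 - t) ^ (n - j)) * z ^ j)" for z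
  proof -
    have "expectation (\<lambda>x. z ^ count t x)
        = expectation (\<lambda>x. \<Sum>j\<le>n. z ^ j * indicator {x\<in>space M. count t x = j} x)"
    proof (rule Bochner_Integration.integral_cong)
      fix x assume x: "x \<in> space M"
      have "(\<Sum>j\<le>n. z ^ j * indicator {x\<in>space M. count t x = j} x) = (\<Sum>j\<le>n. if j = count t x then z ^ j else 0)"
        using x by (intro sum.cong) auto
      then show "z ^ count t x = (\<Sum>j\<le>n. z ^ j * indicator {x\<in>space M. count t x = j} x)"
        using count_le[of t x] by simp
    qed simp
    also have "\<dots> = (\<Sum>j\<le>n. ?p j * z ^ j)"
      using count_eq_meas by (subst Bochner_Integration.integral_sum)
        (auto intro!: sum.cong arg_cong[where f = prob] simp: emeasure_eq_measure mult.commute)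
    finally have "(\<Sum>j\<le>n. ?p j * z ^ j) = (z * t + (1 - t)) ^ n"
      using generating_function(2)[OF t, of z] by (simp add: algebra_simps)
    also have "\<dots> = (\<Sum>j\<le>n. (real (n choose j) * t ^ j * (1 - t) ^ (n - j)) * z ^ j)"
      by (simp add: binomial_ring power_mult_distrib mult_ac)
    finally show ?thesis .
  qed
  then have "\<forall>j\<le>n. ?p j = real (n choose j) * t ^ j * (1 - t) ^ (n - j)"
    by (intro polyfun_eq_coeffs[THEN iffD1]) blast
  then show ?thesis using j by blast
qed

lemma ordstat_tail:
  assumes t: "t \<in> {0<..<1}" and k: "k \<in> {1..n}"
  shows "prob {x\<in>space M. t < ordstat k x} = (\<Sum>j<k. real (n choose j) * t ^ j * (1 - t) ^ (n - j))"
proof -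
  have "{x\<in>space M. t < ordstat k x} = (\<Union>j<k. {x\<in>space M. count t x = j})"
    using ordstat_le_iff[OF k, of _ t] by (auto simp: not_le[symmetric])
  also have "prob \<dots> = (\<Sum>j<k. prob {x\<in>space M. count t x = j})"
    by (intro finite_measure_finite_Union) (auto simp: count_eq_meas disjoint_family_on_def)
  also have "\<dots> = (\<Sum>j<k. real (n choose j) * t ^ j * (1 - t) ^ (n - j))"
    using k by (intro sum.cong refl count_pmf[OF t]) auto
  finally show ?thesis .
qed

text \<open>The binomial tail is a polynomial in \<open>t\<close>, so the layer-cake integral is a
  sum of Beta integrals; their denominators do not depend on \<open>j\<close>, since
  \<open>j + (n - j) = n\<close>.\<close>

lemma ordstat_moment:
  assumes k: "k \<in> {1..n}"
  shows "expectation (\<lambda>x. ordstat k x ^ Suc m)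
    = (\<Sum>j<k. real (Suc m) * real (n choose j) * (fact (j + m) * fact (n - j) / fact (n + m + 1)))"
proof (rule moment_eq_tail_integral[OF ordstat_meas[OF k] ordstat_range[OF k] ordstat_tail[OF _ k]])
  let ?F = "\<lambda>t::real. \<Sum>j<k. real (n choose j) * t ^ j * (1 - t) ^ (n - j)"
  show "0 \<le> ?F t" if "t \<in> {0..1}" for t
    using that by (intro sum_nonneg mult_nonneg_nonneg) auto
  have "((\<lambda>t. \<Sum>j<k. real (Suc m) * real (n choose j) * (t ^ (j + m) * (1 - t) ^ (n - j))) has_integral
    (\<Sum>j<k. real (Suc m) * real (n choose j) * (fact (j + m) * fact (n - j) / fact (j + m + (n - j) + 1)))) {0..1}"
    by (intro has_integral_sum has_integral_mult_right has_integral_power_mult_power) auto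
  also have "(\<lambda>t. \<Sum>j<k. real (Suc m) * real (n choose j) * (t ^ (j + m) * (1 - t) ^ (n - j)))
      = (\<lambda>t. real (Suc m) * t ^ m * ?F t)"
    by (simp add: sum_distrib_left power_add mult_ac)
  also have "(\<Sum>j<k. real (Suc m) * real (n choose j) * (fact (j + m) * fact (n - j) / fact (j + m + (n - j) + 1)))
    = (\<Sum>j<k. real (Suc m) * real (n choose j) * (fact (j + m) * fact (n - j) / fact (n + m + 1)))"
  proof (rule sum.cong)
    fix j assume "j \<in> {..<k}"
    then have e: "j + m + (n - j) + 1 = n + m + 1" using k by auto
    show "real (Suc m) * real (n choose j) * (fact (j + m) * fact (n - j) / fact (j + m + (n - j) + 1))
      = real (Suc m) * real (n choose j) * (fact (j + m) * fact (n - j) / fact (n + m + 1))" unfolding e ..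
  qed simp
  finally show "((\<lambda>t. real (Suc m) * t ^ m * ?F t) has_integral
    (\<Sum>j<k. real (Suc m) * real (n choose j) * (fact (j + m) * fact (n - j) / fact (n + m + 1)))) {0..1}" .
qed

text \<open>The law is Beta with parameters \<open>k\<close> and \<open>n + 1 - k\<close>: its mean
  is exactly the grid point \<open>u\<close>, its variance
  \<open>u * (1 - u) / (n + 2)\<close>.\<close>

lemma ordstat_mean_square:
  assumes k: "k \<in> {1..n}"
  defines "u \<equiv> real k / (real n + 1)"
  shows "integrable M (\<lambda>x. (ordstat k x - u)\<^sup>2)"
    and "expectation (\<lambda>x. (ordstat k x - u)\<^sup>2) \<le> u * (1 - u) / real n"
proof -
  have b: "\<bar>ordstat k x\<bar> \<le> 1" if "x \<in> space M" for x using ordstat_range[OF k that] by simp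
  note [measurable] = ordstat_meas[OF k]
  have i1: "integrable M (ordstat k)"
    by (rule integrable_const_bound[where B = 1]) (auto intro: b)
  have i2: "integrable M (\<lambda>x. (ordstat k x)\<^sup>2)"
    by (rule integrable_const_bound[where B = 1]) (auto simp: abs_square_le_1 intro: b)
  have eq: "(\<lambda>x. (ordstat k x - u)\<^sup>2) = (\<lambda>x. (ordstat k x)\<^sup>2 - 2 * u * ordstat k x + u\<^sup>2)"
    by (simp add: power2_eq_square algebra_simps fun_eq_iff)
  show "integrable M (\<lambda>x. (ordstat k x - u)\<^sup>2)"
    unfolding eq using i1 i2 by auto
  \<comment> \<open>This cancellation makes the summands of the first moment equal and those of the
    second linear in \<open>j\<close>.\<close>
  have ch: "real (n choose j) * (fact j * fact (n - j)) = fact n" if "j < k" for j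
    using k that by (subst binomial_fact) auto
  have m1: "expectation (ordstat k) = u"
  proof -
    have "expectation (\<lambda>x. ordstat k x ^ Suc 0) = (\<Sum>j<k. 1 / (real n + 1))"
      unfolding ordstat_moment[OF k]
    proof (rule sum.cong)
      fix j assume "j \<in> {..<k}"
      then have "real (Suc 0) * real (n choose j) * (fact (j + 0) * fact (n - j) / fact (n + 0 + 1))
          = fact n / ((real n + 1) * fact n)"
        using ch[of j] by (simp add: add.commute)
      then show "real (Suc 0) * real (n choose j) * (fact (j + 0) * fact (n - j) / fact (n + 0 + 1))
          = 1 / (real n + 1)" by simp
    qed simp
    then show ?thesis by (simp add: u_def)
  qed
  have m2: "expectation (\<lambda>x. (ordstat k x)\<^sup>2) = real k * (real k + 1) / ((real n + 1) * (real n + 2))"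
  proof -
    have "expectation (\<lambda>x. ordstat k x ^ Suc 1) = (\<Sum>j<k. (real j + 1) * (2 / ((real n + 1) * (real n + 2))))"
      unfolding ordstat_moment[OF k]
    proof (rule sum.cong)
      fix j assume j: "j \<in> {..<k}"
      have "real (Suc 1) * real (n choose j) * (fact (j + 1) * fact (n - j) / fact (n + 1 + 1))
          = 2 * (real j + 1) * (real (n choose j) * (fact j * fact (n - j))) / ((real n + 1) * (real n + 2) * fact n)"
        by (simp add: algebra_simps)
      also have "\<dots> = 2 * (real j + 1) * fact n / ((real n + 1) * (real n + 2) * fact n)"
        using ch[of j] j by simp
      finally show "real (Suc 1) * real (n choose j) * (fact (j + 1) * fact (n - j) / fact (n + 1 + 1))
          = (real j + 1) * (2 / ((real n + 1) * (real n + 2)))" by simp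
    qed simp
    also have "\<dots> = (\<Sum>j<k. real j + 1) * (2 / ((real n + 1) * (real n + 2)))"
      by (simp only: sum_distrib_right)
    also have "(\<Sum>j<k. real j + 1) = real k * (real k + 1) / 2"
      by (induction k) (auto simp: field_simps)
    finally show ?thesis by (simp add: numeral_2_eq_2)
  qed
  have n: "real n > 0" using k by auto
  have "expectation (\<lambda>x. (ordstat k x - u)\<^sup>2)
      = real k * (real k + 1) / ((real n + 1) * (real n + 2)) - 2 * u * u + u\<^sup>2"
    unfolding eq using i1 i2 by (simp add: m1 m2 prob_space)
  also have "\<dots> = u * (1 - u) / (real n + 2)"
  proof -
    have "b * (b + 1) / (a * (a + 1)) - 2 * (b / a) * (b / a) + (b / a)\<^sup>2 = b / a * (1 - b / a) / (a + 1)"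
      if "0 < a" for a b :: real
      using that by (simp add: divide_simps power2_eq_square) (simp add: algebra_simps)
    from this[of "real n + 1" "real k"] show ?thesis by (simp add: u_def add.assoc)
  qed
  also have "\<dots> \<le> u * (1 - u) / real n"
    using n k by (intro divide_left_mono mult_nonneg_nonneg) (auto simp: u_def)
  finally show "expectation (\<lambda>x. (ordstat k x - u)\<^sup>2) \<le> u * (1 - u) / real n" .
qed

end

text \<open>Closeness in ratio, measured from both endpoints at once, because regularly varying
  functions are stable under bounded ratios and not under additive errors. For fixed
  \<open>u\<close> the admissible \<open>v\<close> form an interval, so a point between two
  admissible ones is admissible.\<close>

definition comparable :: "real \<Rightarrow> real \<Rightarrow> real \<Rightarrow> bool" where
  "comparable c u v \<longleftrightarrow> u / c \<le> v \<and> v \<le> c * u \<and> (1 - u) / c \<le> 1 - v \<and> 1 - v \<le> c * (1 - u)"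

lemma one_plus_mult_power_le_exp:
  assumes "0 \<le> 1 + a * t"
  shows "(1 + a * t) ^ n \<le> exp (a * t * real n)"
proof -
  have "(1 + a * t) ^ n \<le> exp (a * t) ^ n" using assms by (intro power_mono exp_ge_add_one_self)
  also have "\<dots> = exp (a * t * real n)" by (simp add: exp_of_nat_mult[symmetric] mult.commute)
  finally show ?thesis .
qed

section \<open>Simultaneous Chernoff bounds for all order statistics\<close>

context uniform_sample
begin

text \<open>Markov's inequality for \<open>z ^ count t x\<close>. With \<open>P\<close> left
  abstract, \<open>z > 1\<close> serves events of too many points and \<open>z < 1\<close> events of
  too few.\<close>

lemma count_markov:
  assumes t: "t \<in> {0<..<1}" and z: "0 < z" and a: "0 < a" "\<And>m. m \<le> n \<Longrightarrow> P m \<Longrightarrow> a \<le> z ^ m"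
  shows "prob {x\<in>space M. P (count t x)} \<le> (1 + (z - 1) * t) ^ n / a"
proof -
  have "a * prob {x\<in>space M. P (count t x)} = expectation (\<lambda>x. a * indicator {x\<in>space M. P (count t x)} x)"
    by (simp add: Int_def conj_commute)
  also have "\<dots> \<le> expectation (\<lambda>x. z ^ count t x)"
  proof (rule integral_mono)
    show "integrable M (\<lambda>x. a * indicator {x\<in>space M. P (count t x)} x)"
      using count_meas[of P t] by (auto intro!: integrable_mult_right simp: emeasure_eq_measure)
    show "integrable M (\<lambda>x. z ^ count t x)" by (rule generating_function[OF t])
    show "a * indicator {x\<in>space M. P (count t x)} x \<le> z ^ count t x" for x
      using a(2)[OF count_le] z by (auto simp: indicator_def)
  qed
  also have "\<dots> = (1 + (z - 1) * t) ^ n" by (rule generating_function[OF t])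
  finally show ?thesis using a by (simp add: field_simps)
qed

lemma count_chernoff:
  assumes t: "t \<in> {0<..<1}" and z: "0 < z" and a: "0 < a" "\<And>m. m \<le> n \<Longrightarrow> P m \<Longrightarrow> a \<le> z ^ m"
  shows "prob {x\<in>space M. P (count t x)} \<le> exp ((z - 1) * t * real n) / a"
proof -
  have "0 \<le> z * t + (1 - t)" using t z by (intro add_nonneg_nonneg) auto
  then have "(1 + (z - 1) * t) ^ n \<le> exp ((z - 1) * t * real n)"
    by (intro one_plus_mult_power_le_exp) (simp add: algebra_simps)
  then have "(1 + (z - 1) * t) ^ n / a \<le> exp ((z - 1) * t * real n) / a"
    using a by (intro divide_right_mono) auto
  moreover have "prob {x\<in>space M. P (count t x)} \<le> (1 + (z - 1) * t) ^ n / a"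
    using assms by (intro count_markov)
  ultimately show ?thesis by linarith
qed

text \<open>Near 1 the exponent must involve \<open>1 - t\<close>, so the points above
  \<open>t\<close> are counted: taking \<open>z = 1 / y\<close> and multiplying by
  \<open>y ^ n\<close> turns the generating function of the count into that of its
  complement.\<close>

lemma count_chernoff_complement:
  assumes t: "t \<in> {0<..<1}" and y: "0 < y" and a: "0 < a" "\<And>m. m \<le> n \<Longrightarrow> P m \<Longrightarrow> a \<le> y ^ (n - m)"
  shows "prob {x\<in>space M. P (count t x)} \<le> exp ((y - 1) * (1 - t) * real n) / a"
proof -
  have "prob {x\<in>space M. P (count t x)} \<le> (1 + (1 / y - 1) * t) ^ n / (a / y ^ n)"
  proof (rule count_markov[OF t])
    fix m assume m: "m \<le> n" "P m"
    then have "y ^ n = y ^ (n - m) * y ^ m" by (simp flip: power_add)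
    then show "a / y ^ n \<le> (1 / y) ^ m"
      using a(2)[OF m] y by (simp add: field_simps)
  qed (use y a in auto)
  also have "\<dots> = (y * (1 + (1 / y - 1) * t)) ^ n / a"
    by (simp add: power_mult_distrib)
  also have "y * (1 + (1 / y - 1) * t) = 1 + (y - 1) * (1 - t)"
    using y by (simp add: field_simps)
  also have "(1 + (y - 1) * (1 - t)) ^ n / a \<le> exp ((y - 1) * (1 - t) * real n) / a"
  proof -
    have "0 \<le> y * (1 - t) + t" using t y by (intro add_nonneg_nonneg) auto
    then show ?thesis using a
      by (intro divide_right_mono one_plus_mult_power_le_exp) (simp_all add: algebra_simps)
  qed
  finally show ?thesis .
qed

text \<open>One Chernoff bound for each of the four inequalities in \<open>comparable\<close>.
  Geometric decay in \<open>k\<close> and in \<open>Suc n - k\<close> is what keeps the sum over all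
  \<open>k\<close> bounded uniformly in \<open>n\<close>.\<close>

lemma ordstat_not_comparable_prob:
  assumes c: "16 \<le> c" and k: "k \<in> {1..n}"
  shows "prob {x\<in>space M. \<not> comparable c (real k / (real n + 1)) (ordstat k x)}
    \<le> 2 * (8 / c) ^ k + 2 * (8 / c) ^ (Suc n - k)"
proof -
  define u where "u = real k / (real n + 1)"
  define k' where "k' = Suc n - k"
  have u: "0 < u" "u < 1" using k by (auto simp: u_def field_simps)
  have u': "1 - u = real k' / (real n + 1)" using k by (auto simp: u_def k'_def field_simps of_nat_diff)
  have n: "1 \<le> n" using k by auto
  \<comment> \<open>Parameter \<open>c\<close>, for counts about \<open>c\<close> times their mean:
    the base of the power is \<open>exp 1 / c\<close>.\<close>
  have up: "exp ((c - 1) * (real j / (real n + 1) / c) * real n) / c ^ j \<le> (8 / c) ^ j" for j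
  proof -
    have "(c - 1) * (real j / (real n + 1) / c) * real n = real j * ((c - 1) / c * (real n / (real n + 1)))"
      by (simp add: mult_ac)
    also have "\<dots> \<le> real j * 1"
      using c by (intro mult_left_mono mult_le_one) (auto simp: field_simps)
    finally have "exp ((c - 1) * (real j / (real n + 1) / c) * real n) \<le> exp 1 ^ j"
      by (simp flip: exp_of_nat_mult)
    also have "\<dots> \<le> 8 ^ j" using exp_le by (intro power_mono) auto
    finally show ?thesis using c by (simp add: power_divide divide_right_mono)
  qed
  \<comment> \<open>Parameter \<open>1 / 2\<close>, for counts about \<open>1 / c\<close> of their
    mean or less: the base is \<open>2 * exp (- (c / 4))\<close>, and
    \<open>c / 4 \<le> exp (c / 4)\<close> brings it below \<open>8 / c\<close>. This fixes the
    constant 8.\<close>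
  have down: "exp ((1 / 2 - 1) * (c * (real j / (real n + 1))) * real n) / (1 / 2) ^ j \<le> (8 / c) ^ j" for j
  proof -
    have "exp ((1 / 2 - 1) * (c * (real j / (real n + 1))) * real n) \<le> exp (- (real j * (c / 4)))"
    proof -
      have "1 / 2 \<le> real n / (real n + 1)" using n by (simp add: field_simps)
      then have "c / 2 * real j * (1 / 2) \<le> c / 2 * real j * (real n / (real n + 1))"
        using c by (intro mult_left_mono) auto
      then show ?thesis by (simp add: mult_ac)
    qed
    also have "\<dots> = (exp (- (c / 4))) ^ j" by (simp flip: exp_of_nat_mult)
    finally have "exp ((1 / 2 - 1) * (c * (real j / (real n + 1))) * real n) / (1 / 2) ^ j
        \<le> (exp (- (c / 4))) ^ j / (1 / 2) ^ j"
      by (intro divide_right_mono) auto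
    also have "\<dots> = (2 * exp (- (c / 4))) ^ j" by (simp add: power_mult_distrib power_one_over)
    also have "\<dots> \<le> (8 / c) ^ j"
    proof (rule power_mono)
      have "c / 4 \<le> exp (c / 4)" using exp_ge_add_one_self[of "c / 4"] by linarith
      then show "2 * exp (- (c / 4)) \<le> 8 / c" using c by (simp add: exp_minus field_simps)
    qed auto
    finally show ?thesis .
  qed
  have ord: "ordstat k x \<le> t \<longleftrightarrow> k \<le> count t x" for x t by (rule ordstat_le_iff[OF k])
  note [measurable] = ordstat_meas[OF k]
  let ?A1 = "{x\<in>space M. ordstat k x \<le> u / c}"
  let ?A2 = "{x\<in>space M. \<not> ordstat k x \<le> c * u}"
  let ?A3 = "{x\<in>space M. \<not> ordstat k x \<le> 1 - (1 - u) / c}"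
  let ?A4 = "{x\<in>space M. ordstat k x < 1 - c * (1 - u)}"
  have "prob {x\<in>space M. \<not> comparable c u (ordstat k x)} \<le> prob (?A1 \<union> ?A2 \<union> (?A3 \<union> ?A4))"
    by (intro finite_measure_mono) (auto simp: comparable_def not_le intro: less_imp_le)
  also have "\<dots> \<le> (prob ?A1 + prob ?A2) + (prob ?A3 + prob ?A4)"
    by (intro order_trans[OF measure_Un_le] add_mono measure_Un_le) auto
  also have "prob ?A1 \<le> (8 / c) ^ k"
  proof -
    have "prob ?A1 \<le> exp ((c - 1) * (u / c) * real n) / c ^ k"
      unfolding ord using c u by (intro count_chernoff) (auto intro: power_increasing simp: field_simps)
    also have "\<dots> \<le> (8 / c) ^ k" unfolding u_def by (rule up)
    finally show ?thesis .
  qed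
  also have "prob ?A2 \<le> (8 / c) ^ k"
  proof (cases "c * u < 1")
    case True
    then have "prob ?A2 \<le> exp ((1 / 2 - 1) * (c * u) * real n) / (1 / 2) ^ k"
      unfolding ord using c u by (intro count_chernoff) (auto intro!: power_decreasing)
    also have "\<dots> \<le> (8 / c) ^ k" unfolding u_def by (rule down)
    finally show ?thesis .
  next
    case False
    then have "?A2 = {}" using ordstat_range[OF k] by force
    then show ?thesis using c by (simp only: measure_empty) simp
  qed
  also have "prob ?A3 \<le> (8 / c) ^ k'"
  proof -
    \<comment> \<open>Fewer than \<open>k\<close> points up to the threshold leave at least
      \<open>Suc n - k\<close> above it, which is exactly \<open>k'\<close>.\<close>
    have "(1 - u) / c < 1" "0 < (1 - u) / c" using c u by (auto simp: field_simps)
    then have "prob ?A3 \<le> exp ((c - 1) * (1 - (1 - (1 - u) / c)) * real n) / c ^ k'"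
      unfolding ord using c k by (intro count_chernoff_complement) (auto intro!: power_increasing simp: k'_def)
    also have "\<dots> \<le> (8 / c) ^ k'" using up[of k'] by (simp add: u')
    finally show ?thesis .
  qed
  also have "prob ?A4 \<le> (8 / c) ^ k'"
  proof (cases "c * (1 - u) < 1")
    case True
    have "prob ?A4 \<le> prob {x\<in>space M. ordstat k x \<le> 1 - c * (1 - u)}"
      by (intro finite_measure_mono) auto
    also have "\<dots> \<le> exp ((1 / 2 - 1) * (1 - (1 - c * (1 - u))) * real n) / (1 / 2) ^ k'"
      unfolding ord using c u k True
      by (intro count_chernoff_complement) (auto intro!: power_decreasing mult_pos_pos simp: k'_def)
    also have "\<dots> \<le> (8 / c) ^ k'" using down[of k'] by (simp add: u')
    finally show ?thesis .
  next
    case False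
    then have "?A4 = {}" using ordstat_range[OF k] by force
    then show ?thesis using c by (simp only: measure_empty) simp
  qed
  finally show ?thesis by (simp add: u_def k'_def)
qed

lemma comparable_meas:
  "{x\<in>space M. \<forall>k\<in>{1..n}. comparable c (real k / (real n + 1)) (ordstat k x)} \<in> events"
proof -
  have [measurable]: "ordstat k \<in> borel_measurable M" if "k \<in> {1..n}" for k
    using that by (rule ordstat_meas)
  show ?thesis unfolding comparable_def by measurable
qed

text \<open>Union bound. For \<open>c \<ge> 16\<close> the ratio \<open>8 / c\<close> is at most
  \<open>1 / 2\<close>, so each of the four geometric sums is at most \<open>16 / c\<close>.\<close>

lemma ordstat_comparable_prob:
  assumes c: "16 \<le> c"
  shows "prob {x\<in>space M. \<forall>k\<in>{1..n}. comparable c (real k / (real n + 1)) (ordstat k x)} \<ge> 1 - 64 / c"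
proof -
  let ?B = "\<lambda>k. {x\<in>space M. \<not> comparable c (real k / (real n + 1)) (ordstat k x)}"
  let ?E = "{x\<in>space M. \<forall>k\<in>{1..n}. comparable c (real k / (real n + 1)) (ordstat k x)}"
  have Bm: "?B k \<in> events" if "k \<in> {1..n}" for k
  proof -
    note [measurable] = ordstat_meas[OF that]
    show ?thesis unfolding comparable_def by measurable
  qed
  have q: "0 \<le> 8 / c" "8 / c \<le> 1 / 2" using c by (auto simp: field_simps)
  have g: "(\<Sum>k=1..n. (8 / c) ^ k) \<le> 16 / c"
  proof -
    have eq: "(\<Sum>k=1..n. (8 / c) ^ k) = 8 / c * (\<Sum>k<n. (8 / c) ^ k)"
      unfolding sum_distrib_left by (rule sum.reindex_bij_witness[of _ Suc "\<lambda>k. k - 1"]) (auto simp flip: power_Suc)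
    have "(\<Sum>k<n. (8 / c) ^ k) \<le> (\<Sum>k. (8 / c) ^ k)"
      using q by (intro sum_le_suminf summable_geometric) auto
    also have "\<dots> = 1 / (1 - 8 / c)" using q by (intro suminf_geometric) auto
    also have "\<dots> \<le> 1 / (1 / 2)" using q by (intro divide_left_mono) auto
    finally have "8 / c * (\<Sum>k<n. (8 / c) ^ k) \<le> 8 / c * 2"
      using q by (intro mult_left_mono) auto
    then show ?thesis unfolding eq by simp
  qed
  have "prob (\<Union>k\<in>{1..n}. ?B k) \<le> (\<Sum>k=1..n. prob (?B k))"
    using Bm by (intro finite_measure_subadditive_finite) auto
  also have "\<dots> \<le> (\<Sum>k=1..n. 2 * (8 / c) ^ k + 2 * (8 / c) ^ (Suc n - k))"
    by (intro sum_mono ordstat_not_comparable_prob[OF c])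
  also have "\<dots> = 2 * (\<Sum>k=1..n. (8 / c) ^ k) + 2 * (\<Sum>k=1..n. (8 / c) ^ (Suc n - k))"
    by (simp add: sum.distrib sum_distrib_left)
  also have "(\<Sum>k=1..n. (8 / c) ^ (Suc n - k)) = (\<Sum>k=1..n. (8 / c) ^ k)"
    by (rule sum.reindex_bij_witness[of _ "\<lambda>k. Suc n - k" "\<lambda>k. Suc n - k"]) auto
  also have "2 * (\<Sum>k=1..n. (8 / c) ^ k) + 2 * (\<Sum>k=1..n. (8 / c) ^ k) \<le> 64 / c" using g by simp
  finally have "prob (\<Union>k\<in>{1..n}. ?B k) \<le> 64 / c" .
  moreover have "(\<Union>k\<in>{1..n}. ?B k) = space M - ?E" by auto
  ultimately show ?thesis using prob_compl[OF comparable_meas[of c]] by simp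
qed

end

section \<open>Laws with a smooth quantile function\<close>

text \<open>Of the two descriptions of \<open>\<eta>\<close>, the derivative carries the mean value
  theorem, and the reciprocal density gives continuity and positivity.\<close>

locale smooth_law = real_distribution \<mu> for \<mu> :: "real measure" +
  fixes f \<eta> :: "real \<Rightarrow> real"
  assumes density_cont: "continuous_on UNIV f"
    and density: "\<mu> = density lborel (\<lambda>x. ennreal (f x))"
    and density_pos: "\<And>x. x \<in> interior (measure_support \<mu>) \<Longrightarrow> 0 < f x"
    and \<eta>: "\<And>u. u \<in> {0<..<1} \<Longrightarrow> \<eta> u = 1 / f (quantile (cdf \<mu>) u)"
    and quantile_deriv: "\<And>u. u \<in> {0<..<1} \<Longrightarrow> (quantile (cdf \<mu>) has_real_derivative \<eta> u) (at u)"
begin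

abbreviation "\<Psi> \<equiv> cdf \<mu>"
abbreviation "q \<equiv> quantile (cdf \<mu>)"

lemma isCont_\<Psi>: "isCont \<Psi> x"
proof -
  have [measurable]: "f \<in> borel_measurable borel"
    using density_cont by (rule borel_measurable_continuous_onI)
  have "emeasure \<mu> {x} = (\<integral>\<^sup>+ y. ennreal (f y) * indicator {x} y \<partial>lborel)"
    unfolding density by (rule emeasure_density) auto
  also have "\<dots> = 0"
    by (subst nn_integral_0_iff_AE) (use AE_lborel_singleton[of x] in \<open>auto elim!: eventually_mono\<close>)
  finally show ?thesis unfolding isCont_cdf by (simp add: measure_def)
qed

lemma \<Psi>_range: "\<Psi> x \<in> {0..1}"
  by (simp add: cdf_nonneg cdf_bounded_prob)

lemma mono_\<Psi>: "mono \<Psi>"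
  by (intro monoI cdf_nondecreasing)

lemma \<Psi>_meas [measurable]: "\<Psi> \<in> borel_measurable borel"
  by (rule borel_measurable_mono[OF mono_\<Psi>])

lemma quantile_set:
  assumes u: "u \<in> {0<..<1}"
  shows "bdd_below {x. u \<le> \<Psi> x}" "\<exists>x. \<Psi> x = u"
proof -
  have "eventually (\<lambda>x. \<Psi> x < u) at_bot"
    using cdf_lim_at_bot u by (intro order_tendstoD(2)) auto
  then obtain a where a: "\<And>x. x \<le> a \<Longrightarrow> \<Psi> x < u" by (auto simp: eventually_at_bot_linorder)
  have "eventually (\<lambda>x. \<Psi> x > u) at_top"
    using cdf_lim_at_top_prob u by (intro order_tendstoD(1)) auto
  then obtain b where b: "\<And>x. x \<ge> b \<Longrightarrow> \<Psi> x > u" by (auto simp: eventually_at_top_linorder)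
  show "bdd_below {x. u \<le> \<Psi> x}"
    using a by (intro bdd_belowI[of _ a]) (force simp: not_less[symmetric])
  have "\<exists>x. a \<le> x \<and> x \<le> max a b \<and> \<Psi> x = u"
    using a[of a] b[of "max a b"] isCont_\<Psi> by (intro IVT) (auto simp: less_imp_le)
  then show "\<exists>x. \<Psi> x = u" by blast
qed

lemma q_le: "\<Psi> x \<in> {0<..<1} \<Longrightarrow> q (\<Psi> x) \<le> x"
  unfolding quantile_def by (intro cInf_lower quantile_set(1)) auto

lemma \<Psi>_q:
  assumes u: "u \<in> {0<..<1}"
  shows "\<Psi> (q u) = u"
proof (rule antisym)
  obtain x where x: "\<Psi> x = u" using quantile_set(2)[OF u] by blast
  then show "\<Psi> (q u) \<le> u" using q_le[of x] u cdf_nondecreasing[of "q u" x] by auto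
  have "continuous_on UNIV \<Psi>" using isCont_\<Psi> by (simp add: continuous_at_imp_continuous_on)
  then have "closed {x. u \<le> \<Psi> x}" by (intro closed_Collect_le continuous_intros)
  then have "Inf {x. u \<le> \<Psi> x} \<in> {x. u \<le> \<Psi> x}"
    using x quantile_set(1)[OF u] by (intro closed_contains_Inf) auto
  then show "u \<le> \<Psi> (q u)" by (simp add: quantile_def)
qed

lemma isCont_q: "u \<in> {0<..<1} \<Longrightarrow> isCont q u"
  using quantile_deriv by (blast intro: DERIV_isCont)

text \<open>A flat stretch of \<open>\<Psi>\<close> would make the quantile function jump, which its
  differentiability excludes: every \<open>v\<close> slightly above \<open>\<Psi> x\<close> has
  \<open>q v > x\<close>, and continuity of \<open>q\<close> passes the inequality to the
  limit.\<close>

lemma q_\<Psi>: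
  assumes x: "\<Psi> x \<in> {0<..<1}"
  shows "q (\<Psi> x) = x"
proof (rule antisym[OF q_le[OF x]])
  let ?u = "\<Psi> x"
  have "((\<lambda>v. q v) \<longlongrightarrow> q ?u) (at_right ?u)"
    using isCont_q[OF x] unfolding isCont_def by (rule filterlim_mono) (auto simp: at_le)
  moreover have "eventually (\<lambda>v. x \<le> q v) (at_right ?u)"
  proof (rule eventually_at_rightI[of ?u 1])
    fix v assume v: "v \<in> {?u<..<1}"
    then have "\<Psi> (q v) = v" using x by (intro \<Psi>_q) auto
    then have "\<not> q v \<le> x" using v cdf_nondecreasing[of "q v" x] by auto
    then show "x \<le> q v" by simp
  qed (use x in auto)
  ultimately show "x \<le> q ?u" by (rule tendsto_lowerbound) auto
qed

text \<open>Positivity of the density is assumed on the interior of the support, so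
  \<open>q u\<close> has to be placed there: the preimage of the unit interval under
  \<open>\<Psi>\<close> is open, and injectivity of \<open>\<Psi>\<close> on it gives positive mass
  to every neighbourhood of its points.\<close>

lemma f_q_pos:
  assumes u: "u \<in> {0<..<1}"
  shows "0 < f (q u)"
proof (rule density_pos)
  let ?J = "\<Psi> -` {0<..<1}"
  have "open ?J"
    using isCont_\<Psi> by (intro open_vimage) (auto simp: continuous_at_imp_continuous_on)
  moreover have "?J \<subseteq> measure_support \<mu>"
    unfolding measure_support_def
  proof (intro subsetI CollectI allI impI)
    fix x U assume x: "x \<in> ?J" and U: "open U" "x \<in> U"
    obtain e where e: "0 < e" "ball x e \<subseteq> U" using U by (auto simp: open_contains_ball)
    let ?y = "x - e / 2"
    have "\<Psi> ?y \<noteq> \<Psi> x"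
    proof
      assume "\<Psi> ?y = \<Psi> x"
      then have "?y = x" using q_\<Psi>[of ?y] q_\<Psi>[of x] x by simp
      then show False using e by simp
    qed
    then have "\<Psi> ?y < \<Psi> x" using cdf_nondecreasing[of ?y x] e by simp
    then have "0 < emeasure \<mu> {?y<..x}"
      using cdf_diff_eq[of ?y x] e by (simp add: emeasure_eq_measure)
    also have "\<dots> \<le> emeasure \<mu> U"
      using e U by (intro emeasure_mono) (auto simp: subset_eq dist_real_def)
    finally show "0 < emeasure \<mu> U" .
  qed
  moreover have "q u \<in> ?J" using \<Psi>_q[OF u] u by simp
  ultimately show "q u \<in> interior (measure_support \<mu>)" by (meson interiorI)
qed

lemma \<eta>_pos: "u \<in> {0<..<1} \<Longrightarrow> 0 < \<eta> u"
  using f_q_pos \<eta> by simp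

lemma continuous_on_\<eta>: "continuous_on {0<..<1} \<eta>"
proof -
  have "continuous_on {0<..<1} q"
    using isCont_q by (simp add: continuous_at_imp_continuous_on)
  then have "continuous_on {0<..<1} (\<lambda>u. 1 / f (q u))"
    using f_q_pos by (intro continuous_intros continuous_on_compose2[OF density_cont]) force+
  then show ?thesis by (rule continuous_on_eq) (simp add: \<eta>)
qed

lemma \<Psi>_uniform:
  assumes t: "t \<in> {0<..<1}"
  shows "measure \<mu> {x. \<Psi> x \<le> t} = t"
proof -
  have "{x. \<Psi> x \<le> t} = {..q t}"
  proof (intro equalityI subsetI)
    fix x assume x: "x \<in> {x. \<Psi> x \<le> t}"
    show "x \<in> {..q t}"
    proof (rule ccontr)
      assume "x \<notin> {..q t}"
      then have "\<Psi> x = t" using x \<Psi>_q[OF t] cdf_nondecreasing[of "q t" x] by auto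
      then show False using q_\<Psi>[of x] t \<open>x \<notin> {..q t}\<close> by auto
    qed
  next
    fix x assume "x \<in> {..q t}"
    then show "x \<in> {x. \<Psi> x \<le> t}" using \<Psi>_q[OF t] cdf_nondecreasing[of x "q t"] by auto
  qed
  then show ?thesis using \<Psi>_q[OF t] by (simp add: cdf_def)
qed

lemma AE_\<Psi>: "AE x in \<mu>. \<Psi> x \<in> {0<..<1}"
proof -
  have "measure \<mu> {x. \<Psi> x \<le> 0} \<le> 0"
  proof (rule field_le_epsilon)
    fix e :: real assume e: "0 < e"
    define t where "t = min e (1 / 2)"
    have t: "t \<in> {0<..<1}" "t \<le> e" using e by (auto simp: t_def)
    have "measure \<mu> {x. \<Psi> x \<le> 0} \<le> measure \<mu> {x. \<Psi> x \<le> t}"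
      using t by (intro finite_measure_mono) auto
    then show "measure \<mu> {x. \<Psi> x \<le> 0} \<le> 0 + e" using \<Psi>_uniform[OF t(1)] t(2) by simp
  qed
  then have "measure \<mu> {x. \<Psi> x \<le> 0} = 0"
    by (simp add: antisym)
  then have "AE x in \<mu>. \<not> \<Psi> x \<le> 0"
    by (intro AE_I[where N = "{x. \<Psi> x \<le> 0}"]) (auto simp: emeasure_eq_measure)
  moreover have "measure \<mu> {x. \<Psi> x < 1} \<ge> 1"
  proof (rule field_le_epsilon)
    fix e :: real assume e: "0 < e"
    define t where "t = max (1 - e) (1 / 2)"
    have t: "t \<in> {0<..<1}" "1 - e \<le> t" using e by (auto simp: t_def)
    have "measure \<mu> {x. \<Psi> x < 1} \<ge> measure \<mu> {x. \<Psi> x \<le> t}"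
      using t by (intro finite_measure_mono) auto
    then show "1 \<le> measure \<mu> {x. \<Psi> x < 1} + e" using \<Psi>_uniform[OF t(1)] t(2) by simp
  qed
  then have "AE x in \<mu>. \<Psi> x < 1"
    using prob_Collect_eq_1[of "\<lambda>x. \<Psi> x < 1"] prob_le_1[of "{x. \<Psi> x < 1}"] by simp
  ultimately show ?thesis by eventually_elim auto
qed

lemma quantile_mean_value:
  assumes "a \<in> {0<..<1}" "b \<in> {0<..<1}"
  shows "\<exists>v. min a b \<le> v \<and> v \<le> max a b \<and> \<bar>q a - q b\<bar> = \<eta> v * \<bar>a - b\<bar>"
proof -
  have *: "\<exists>v. a \<le> v \<and> v \<le> b \<and> \<bar>q a - q b\<bar> = \<eta> v * \<bar>a - b\<bar>"
    if ab: "a \<in> {0<..<1}" "b \<in> {0<..<1}" "a \<le> b" for a b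
  proof (cases "a = b")
    case False
    then have "\<exists>v. a < v \<and> v < b \<and> q b - q a = (b - a) * \<eta> v"
      using ab by (intro MVT2 quantile_deriv) auto
    then obtain v where v: "a < v" "v < b" "q b - q a = (b - a) * \<eta> v" by blast
    then have "\<bar>q b - q a\<bar> = (b - a) * \<eta> v" using \<eta>_pos[of v] ab by (simp add: abs_mult)
    then show ?thesis using v by (intro exI[of _ v]) (auto simp: abs_minus_commute)
  qed auto
  show ?thesis
    using *[OF assms] *[OF assms(2,1)] by (cases "a \<le> b") (auto simp: abs_minus_commute)
qed

lemma uniform_sample_scores:
  assumes M: "prob_space M" and iid: "iid_sample M \<mu> n V"
  shows "uniform_sample M n (\<lambda>i x. \<Psi> (V i x))"
proof -
  interpret M: prob_space M by (rule M)
  have V: "V i \<in> borel_measurable M" "distr M borel (V i) = \<mu>" if "i \<in> {1..n}" for i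
    using iid that by (auto simp: iid_sample_def M.indep_vars_def)
  have ind: "M.indep_vars (\<lambda>_. borel) V {1..n}"
    using iid by (simp add: iid_sample_def)
  show ?thesis
  proof
    show "M.indep_vars (\<lambda>_. borel) (\<lambda>i x. \<Psi> (V i x)) {1..n}"
      by (rule M.indep_vars_compose2[OF ind \<Psi>_meas])
    show "M.prob {x\<in>space M. \<Psi> (V i x) \<le> t} = t" if i: "i \<in> {1..n}" and t: "t \<in> {0<..<1}" for i t
    proof -
      have "measure (distr M borel (V i)) {x. \<Psi> x \<le> t} = M.prob {x\<in>space M. \<Psi> (V i x) \<le> t}"
        using V(1)[OF i] by (subst measure_distr) (auto simp: vimage_def Int_def conj_commute)
      then show ?thesis using \<Psi>_uniform[OF t] V(2)[OF i] by simp
    qed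
  qed (rule \<Psi>_range)
qed

end

section \<open>Envelopes for the weights\<close>

text \<open>For \<open>u\<close> in the unit interval, comparability says that \<open>v / u\<close>
  and \<open>(1 - v) / (1 - u)\<close> lie in \<open>[1 / c, c]\<close>; near each endpoint the
  matching ratio is fed into the one-sided bound.\<close>

lemma regvar_at_endpoints_comparable:
  assumes rv: "regvar_at_endpoints f" and c: "1 < c"
  obtains C \<delta> where "0 < C" "0 < \<delta>"
    "\<And>u v. u \<in> {0<..<1} \<Longrightarrow> u < \<delta> \<or> 1 - \<delta> < u \<Longrightarrow> comparable c u v \<Longrightarrow> f v \<le> C * f u"
proof -
  obtain \<rho>1 \<rho>2 where rv1: "regvar_at_0 f \<rho>1" and rv2: "regvar_at_0 (\<lambda>t. f (1 - t)) \<rho>2"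
    using rv by (auto simp: regvar_at_endpoints_def)
  obtain C1 \<delta>1 where 1: "0 < C1" "0 < \<delta>1"
    "\<And>s t. 0 < t \<Longrightarrow> t < \<delta>1 \<Longrightarrow> 1 / c \<le> s \<Longrightarrow> s \<le> c \<Longrightarrow> s * t < 1 \<and> f (s * t) \<le> C1 * f t"
    using regvar_at_0_comparable[OF rv1 c] by metis
  obtain C2 \<delta>2 where 2: "0 < C2" "0 < \<delta>2"
    "\<And>s t. 0 < t \<Longrightarrow> t < \<delta>2 \<Longrightarrow> 1 / c \<le> s \<Longrightarrow> s \<le> c \<Longrightarrow> s * t < 1 \<and> f (1 - s * t) \<le> C2 * f (1 - t)"
    using regvar_at_0_comparable[OF rv2 c] by metis
  show thesis
  proof (rule that[of "max C1 C2" "min \<delta>1 \<delta>2"])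
    fix u v assume u: "u \<in> {0<..<1}" and e: "u < min \<delta>1 \<delta>2 \<or> 1 - min \<delta>1 \<delta>2 < u"
      and uv: "comparable c u v"
    have fu: "0 < f u" using rv1 u by (auto simp: regvar_at_0_def)
    from e show "f v \<le> max C1 C2 * f u"
    proof
      assume "u < min \<delta>1 \<delta>2"
      then have "f (v / u * u) \<le> C1 * f u"
        using uv u c 1(3)[of u "v / u"] by (auto simp: comparable_def field_simps)
      also have "\<dots> \<le> max C1 C2 * f u" using fu by (intro mult_right_mono) auto
      finally show ?thesis using u by simp
    next
      assume "1 - min \<delta>1 \<delta>2 < u"
      then have "f (1 - (1 - v) / (1 - u) * (1 - u)) \<le> C2 * f (1 - (1 - u))"
        using uv u c by (intro 2(3)[THEN conjunct2]) (auto simp: comparable_def field_simps)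
      also have "\<dots> \<le> max C1 C2 * f u" using fu by (simp add: mult_right_mono)
      finally show ?thesis using u by simp
    qed
  qed (use 1 2 in auto)
qed

lemma sum_regvar_at_endpoints_bounded:
  assumes rv: "regvar_at_endpoints h" and int: "set_integrable lborel {0<..<1} h"
  obtains C \<delta> where "0 < C" "0 < \<delta>"
    "\<forall>n\<ge>1. (\<Sum>k | k \<in> {1..n} \<and> (real k / (real n + 1) < \<delta> \<or> 1 - \<delta> < real k / (real n + 1)).
        h (real k / (real n + 1))) \<le> C * real n"
proof -
  obtain \<rho>1 \<rho>2 where rv1: "regvar_at_0 h \<rho>1" and rv2: "regvar_at_0 (\<lambda>t. h (1 - t)) \<rho>2"
    using rv by (auto simp: regvar_at_endpoints_def)
  have int2: "set_integrable lborel {0<..<1} (\<lambda>t. h (1 - t))"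
  proof -
    have "integrable lborel (\<lambda>x. indicator {0<..<1} (1 + (- 1) * x) *\<^sub>R h (1 + (- 1) * x))"
      using int unfolding set_integrable_def by (rule lborel_integrable_real_affine) simp
    also have "(\<lambda>x. indicator {0<..<1} (1 + (- 1) * x) *\<^sub>R h (1 + (- 1) * x))
        = (\<lambda>x. indicator {0<..<1} x *\<^sub>R h (1 - x))"
      by (auto simp: indicator_def)
    finally show ?thesis unfolding set_integrable_def .
  qed
  obtain C1 \<delta>1 where 1: "0 < \<delta>1" "\<delta>1 < 1" "0 < C1" "\<forall>n\<ge>1.
      (\<Sum>k | k \<in> {1..n} \<and> real k / (real n + 1) < \<delta>1. h (real k / (real n + 1))) \<le> C1 * real n"
    by (rule sum_regvar_at_0_bounded[OF rv1 int]) (rule that)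
  obtain C2 \<delta>2 where 2: "0 < \<delta>2" "\<delta>2 < 1" "0 < C2" "\<forall>n\<ge>1.
      (\<Sum>k | k \<in> {1..n} \<and> real k / (real n + 1) < \<delta>2. h (1 - real k / (real n + 1))) \<le> C2 * real n"
    by (rule sum_regvar_at_0_bounded[OF rv2 int2]) (rule that)
  show thesis
  proof (rule that[of "C1 + C2" "min \<delta>1 \<delta>2"])
    show "\<forall>n\<ge>1. (\<Sum>k | k \<in> {1..n} \<and> (real k / (real n + 1) < min \<delta>1 \<delta>2 \<or>
        1 - min \<delta>1 \<delta>2 < real k / (real n + 1)). h (real k / (real n + 1))) \<le> (C1 + C2) * real n"
    proof (intro allI impI)
      fix n :: nat assume n: "1 \<le> n"
      let ?u = "\<lambda>k. real k / (real n + 1)"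
      have h: "0 \<le> h (?u k)" if "k \<in> {1..n}" for k
        using rv1 that by (auto simp: regvar_at_0_def field_simps intro!: less_imp_le)
      have "(\<Sum>k | k \<in> {1..n} \<and> (?u k < min \<delta>1 \<delta>2 \<or> 1 - min \<delta>1 \<delta>2 < ?u k). h (?u k))
          \<le> (\<Sum>k\<in>{k. k \<in> {1..n} \<and> ?u k < \<delta>1} \<union> {k. k \<in> {1..n} \<and> 1 - \<delta>2 < ?u k}. h (?u k))"
        using h by (intro sum_mono2) auto
      also have "\<dots> \<le> (\<Sum>k | k \<in> {1..n} \<and> ?u k < \<delta>1. h (?u k)) + (\<Sum>k | k \<in> {1..n} \<and> 1 - \<delta>2 < ?u k. h (?u k))"
        using h by (subst sum.union_inter[symmetric]) (auto intro!: sum_nonneg)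
      \<comment> \<open>The reflection of \<open>k\<close> into \<open>Suc n - k\<close> sends
        \<open>?u k\<close> to \<open>1 - ?u k\<close>, so the grid is symmetric.\<close>
      also have "(\<Sum>k | k \<in> {1..n} \<and> 1 - \<delta>2 < ?u k. h (?u k)) = (\<Sum>k | k \<in> {1..n} \<and> ?u k < \<delta>2. h (1 - ?u k))"
      proof -
        have r: "?u (Suc n - k) = 1 - ?u k" if "k \<in> {1..n}" for k
          using that by (auto simp: field_simps of_nat_diff)
        show ?thesis
          by (rule sum.reindex_bij_witness[of _ "\<lambda>k. Suc n - k" "\<lambda>k. Suc n - k"]) (use r in \<open>auto simp: r\<close>)
      qed
      finally show "(\<Sum>k | k \<in> {1..n} \<and> (?u k < min \<delta>1 \<delta>2 \<or> 1 - min \<delta>1 \<delta>2 < ?u k). h (?u k)) \<le> (C1 + C2) * real n"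
        using 1(4)[rule_format, OF n] 2(4)[rule_format, OF n] by (simp add: distrib_right)
    qed
  qed (use 1 2 in auto)
qed

lemma comparable_interval:
  assumes "comparable c u v" "1 < c" "0 < a" "a \<le> u" "u \<le> 1 - a"
  shows "v \<in> {a / c..1 - a / c}"
proof -
  have "a / c \<le> u / c" "a / c \<le> (1 - u) / c" using assms by (auto intro!: divide_right_mono)
  then show ?thesis using assms by (auto simp: comparable_def)
qed

lemma comparable_sym: "1 < c \<Longrightarrow> comparable c u v \<Longrightarrow> comparable c v u"
  by (auto simp: comparable_def field_simps)

lemma comparable_refl:
  assumes "1 < c" "u \<in> {0<..<1}"
  shows "comparable c u u"
proof -
  have "1 * u \<le> c * u" "1 * (1 - u) \<le> c * (1 - u)" using assms by (auto intro!: mult_right_mono)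
  then show ?thesis using assms by (simp add: comparable_def pos_divide_le_eq mult.commute)
qed

lemma comparable_range:
  assumes "comparable c u v" "1 < c" "u \<in> {0<..<1}"
  shows "v \<in> {0<..<1}"
proof -
  have "0 < u / c" "0 < (1 - u) / c" using assms by auto
  then show ?thesis using assms(1) by (auto simp: comparable_def simp del: zero_less_divide_iff)
qed

context smooth_law
begin

lemma \<eta>_bounded:
  assumes "0 < a"
  obtains D where "0 < D" "\<And>v. v \<in> {a..1 - a} \<Longrightarrow> \<eta> v \<le> D"
proof -
  have "continuous_on {a..1 - a} \<eta>"
    by (rule continuous_on_subset[OF continuous_on_\<eta>]) (use assms in auto)
  then have "compact (\<eta> ` {a..1 - a})" by (intro compact_continuous_image) auto
  from compact_imp_bounded[OF this] obtain D where D: "\<forall>y\<in>\<eta> ` {a..1 - a}. norm y \<le> D"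
    unfolding bounded_iff by blast
  show thesis
  proof (rule that[of "max D 1"])
    fix v assume "v \<in> {a..1 - a}"
    then have "norm (\<eta> v) \<le> D" using D by blast
    then show "\<eta> v \<le> max D 1" by simp
  qed simp
qed

text \<open>Here \<open>v\<close> stands for the proxy score and \<open>v'\<close> for a mean value
  point; they are linked through \<open>u\<close>. If the weight at \<open>v\<close> is nonzero,
  then \<open>v\<close>, hence \<open>u\<close>, hence \<open>v'\<close> keep away from the
  endpoints, and \<open>\<eta>\<close> is bounded on such a range.\<close>

lemma weight_envelope_compact:
  assumes \<omega>: "\<And>x. 0 \<le> \<omega> x" "\<And>x. \<omega> x \<le> B" and c: "1 < c"
    and cs: "compactly_supported (\<lambda>u. \<omega> (q u))"
  obtains C where "0 < C" "\<And>u v v'. u \<in> {0<..<1} \<Longrightarrow> comparable c u v \<Longrightarrow> comparable c u v' \<Longrightarrow>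
    \<omega> (q v) * (\<eta> v' * sqrt (u * (1 - u))) ^ r \<le> C"
proof -
  obtain K where K: "compact K" "K \<subseteq> {0<..<1}" "\<And>u. u \<in> {0<..<1} \<Longrightarrow> \<omega> (q u) \<noteq> 0 \<Longrightarrow> u \<in> K"
    using cs by (auto simp: compactly_supported_def)
  obtain a where a: "0 < a" "K \<subseteq> {a..1 - a}"
  proof (cases "K = {}")
    case True
    then show thesis using that[of 1] by simp
  next
    case False
    obtain x where x: "x \<in> K" "\<And>y. y \<in> K \<Longrightarrow> x \<le> y" using compact_attains_inf[OF K(1) False] by blast
    obtain z where z: "z \<in> K" "\<And>y. y \<in> K \<Longrightarrow> y \<le> z" using compact_attains_sup[OF K(1) False] by blast
    show thesis
    proof (rule that[of "min x (1 - z)"])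
      show "0 < min x (1 - z)" using x(1) z(1) K(2) by auto
      show "K \<subseteq> {min x (1 - z)..1 - min x (1 - z)}"
      proof
        fix y assume "y \<in> K"
        then show "y \<in> {min x (1 - z)..1 - min x (1 - z)}" using x(2)[of y] z(2)[of y] by auto
      qed
    qed
  qed
  \<comment> \<open>One division by \<open>c\<close> for the step from \<open>v\<close> to
    \<open>u\<close>, another for the step from \<open>u\<close> to \<open>v'\<close>.\<close>
  have a': "0 < a / c / c" using a c by simp
  obtain D where D: "0 < D" "\<And>v. v \<in> {a / c / c..1 - a / c / c} \<Longrightarrow> \<eta> v \<le> D"
    using \<eta>_bounded[OF a'] by blast
  have B: "0 \<le> B" using \<omega> order_trans by blast
  show thesis
  proof (rule that[of "B * D ^ r + 1"])
    show "0 < B * D ^ r + 1" using B D by (simp add: add_nonneg_pos)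
    fix u v v' assume u: "u \<in> {0<..<1}" and v: "comparable c u v" and v': "comparable c u v'"
    have v01: "v \<in> {0<..<1}" "v' \<in> {0<..<1}" using comparable_range c u v v' by blast+
    have "\<omega> (q v) * (\<eta> v' * sqrt (u * (1 - u))) ^ r \<le> B * D ^ r"
    proof (cases "\<omega> (q v) = 0")
      case True
      then show ?thesis using B D by simp
    next
      case False
      then have "v \<in> {a..1 - a}" using K(3)[OF v01(1)] a(2) by auto
      then have "u \<in> {a / c..1 - a / c}"
        using comparable_interval[OF comparable_sym[OF c v] c a(1)] by auto
      then have "\<eta> v' \<le> D"
        using comparable_interval[OF v' c, of "a / c"] a c by (intro D) auto
      moreover have "sqrt (u * (1 - u)) \<le> 1"
        using u mult_le_one[of u "1 - u"] by simp
      ultimately have "\<eta> v' * sqrt (u * (1 - u)) \<le> D * 1"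
        using D(1) u by (intro mult_mono) auto
      then have "(\<eta> v' * sqrt (u * (1 - u))) ^ r \<le> D ^ r"
        using \<eta>_pos[OF v01(2)] u by (intro power_mono) auto
      then show ?thesis using \<omega> B \<eta>_pos[OF v01(2)] u by (intro mult_mono) auto
    qed
    then show "\<omega> (q v) * (\<eta> v' * sqrt (u * (1 - u))) ^ r \<le> B * D ^ r + 1" by simp
  qed
qed

text \<open>\<open>R u v\<close> relates a proxy score \<open>v\<close> to its grid point
  \<open>u\<close>: equality for the deterministic proxy, comparability for the random one. Near the
  endpoints the weight at \<open>v\<close> is majorised through \<open>\<pi> u\<close>, and
  \<open>G\<close> is a multiple of the integrable \<open>h\<close>; elsewhere \<open>G\<close> is
  constant. Hence its grid sums are of order \<open>n\<close>.\<close>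

lemma weight_envelope_regvar:
  assumes \<omega>: "\<And>x. 0 \<le> \<omega> x" "\<And>x. \<omega> x \<le> B" and c: "1 < c"
    and \<kappa>: "\<And>u. u \<in> {0<..<1} \<Longrightarrow> 1 \<le> \<kappa> u"
    and rv: "regvar_at_endpoints \<eta>"
    and \<pi>: "\<And>u. u \<in> {0<..<1} \<Longrightarrow> 0 \<le> \<pi> u"
    and dom: "regvar_dominated (\<lambda>u. \<pi> u * (\<kappa> u * \<eta> u * sqrt (u * (1 - u))) ^ r)"
    and R: "\<And>u v. R u v \<Longrightarrow> comparable c u v"
    and \<delta>R: "0 < \<delta>R" "0 < CR"
      "\<And>u v. u \<in> {0<..<1} \<Longrightarrow> u < \<delta>R \<or> 1 - \<delta>R < u \<Longrightarrow> R u v \<Longrightarrow> \<omega> (q v) \<le> CR * \<pi> u"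
  obtains G C where "0 < C" "\<And>u. u \<in> {0<..<1} \<Longrightarrow> 0 \<le> G u"
    "\<And>n. 1 \<le> n \<Longrightarrow> (\<Sum>k=1..n. G (real k / (real n + 1))) \<le> C * real n"
    "\<And>u v v'. u \<in> {0<..<1} \<Longrightarrow> R u v \<Longrightarrow> comparable c u v' \<Longrightarrow>
      \<omega> (q v) * (\<eta> v' * sqrt (u * (1 - u))) ^ r \<le> G u"
proof -
  obtain h where h: "set_integrable lborel {0<..<1} h" "regvar_at_endpoints h"
    "\<And>u. u \<in> {0<..<1} \<Longrightarrow> \<pi> u * (\<kappa> u * \<eta> u * sqrt (u * (1 - u))) ^ r \<le> h u"
    using dom by (auto simp: regvar_dominated_def)
  have h0: "0 \<le> h u" if "u \<in> {0<..<1}" for u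
    using h(2) that by (auto simp: regvar_at_endpoints_def regvar_at_0_def intro: less_imp_le)
  obtain Ch \<delta>h where Ch: "0 < Ch" "0 < \<delta>h"
    "\<forall>n\<ge>1. (\<Sum>k | k \<in> {1..n} \<and> (real k / (real n + 1) < \<delta>h \<or> 1 - \<delta>h < real k / (real n + 1)).
        h (real k / (real n + 1))) \<le> Ch * real n"
    by (rule sum_regvar_at_endpoints_bounded[OF h(2,1)]) (rule that)
  obtain C\<eta> \<delta>\<eta> where C\<eta>: "0 < C\<eta>" "0 < \<delta>\<eta>"
    "\<And>u v. u \<in> {0<..<1} \<Longrightarrow> u < \<delta>\<eta> \<or> 1 - \<delta>\<eta> < u \<Longrightarrow> comparable c u v \<Longrightarrow> \<eta> v \<le> C\<eta> * \<eta> u"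
    using regvar_at_endpoints_comparable[OF rv c] by metis
  define \<delta> where "\<delta> = Min {\<delta>R, \<delta>h, \<delta>\<eta>}"
  have \<delta>: "0 < \<delta>" "\<delta> \<le> \<delta>R" "\<delta> \<le> \<delta>h" "\<delta> \<le> \<delta>\<eta>" using \<delta>R Ch C\<eta> by (auto simp: \<delta>_def)
  have \<delta>c: "0 < \<delta> / c" using \<delta> c by simp
  obtain D where D: "0 < D" "\<And>v. v \<in> {\<delta> / c..1 - \<delta> / c} \<Longrightarrow> \<eta> v \<le> D"
    using \<eta>_bounded[OF \<delta>c] by blast
  have B: "0 \<le> B" using \<omega> order_trans by blast
  define E where "E u \<longleftrightarrow> u < \<delta> \<or> 1 - \<delta> < u" for u
  define G where "G u = (if E u then CR * C\<eta> ^ r * h u else B * D ^ r)" for u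
  show thesis
  proof (rule that[of "CR * C\<eta> ^ r * Ch + B * D ^ r" G])
    show "0 < CR * C\<eta> ^ r * Ch + B * D ^ r" using B D \<delta>R Ch C\<eta> by (intro add_pos_nonneg) auto
    show "0 \<le> G u" if "u \<in> {0<..<1}" for u
      using h0[OF that] B D \<delta>R C\<eta> by (auto simp: G_def)
  next
    fix n :: nat assume n: "1 \<le> n"
    let ?u = "\<lambda>k. real k / (real n + 1)"
    have u01: "?u k \<in> {0<..<1}" if "k \<in> {1..n}" for k using that by (auto simp: field_simps)
    have "(\<Sum>k=1..n. G (?u k)) = (\<Sum>k=1..n. (if E (?u k) then CR * C\<eta> ^ r * h (?u k) else 0)
        + (if E (?u k) then 0 else B * D ^ r))"
      unfolding G_def by (intro sum.cong) auto
    also have "\<dots> = CR * C\<eta> ^ r * (\<Sum>k | k \<in> {1..n} \<and> E (?u k). h (?u k))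
        + (\<Sum>k=1..n. if E (?u k) then 0 else B * D ^ r)"
      by (simp add: sum.distrib sum.If_cases sum_distrib_left Int_def)
    also have "\<dots> \<le> CR * C\<eta> ^ r * (Ch * real n) + (\<Sum>k=1..n. B * D ^ r)"
    proof (intro add_mono mult_left_mono sum_mono)
      have "(\<Sum>k | k \<in> {1..n} \<and> E (?u k). h (?u k)) \<le> (\<Sum>k | k \<in> {1..n} \<and> (?u k < \<delta>h \<or> 1 - \<delta>h < ?u k). h (?u k))"
        using h0 u01 \<delta>(3) by (intro sum_mono2) (auto simp: E_def)
      then show "(\<Sum>k | k \<in> {1..n} \<and> E (?u k). h (?u k)) \<le> Ch * real n" using Ch(3)[rule_format, OF n] by linarith
    qed (use B D \<delta>R C\<eta> in auto)
    also have "\<dots> = (CR * C\<eta> ^ r * Ch + B * D ^ r) * real n" by (simp add: algebra_simps)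
    finally show "(\<Sum>k=1..n. G (?u k)) \<le> (CR * C\<eta> ^ r * Ch + B * D ^ r) * real n" .
  next
    fix u v v' assume u: "u \<in> {0<..<1}" and v: "R u v" and v': "comparable c u v'"
    have v'01: "v' \<in> {0<..<1}" using comparable_range[OF v' c u] .
    have s: "0 \<le> sqrt (u * (1 - u))" "sqrt (u * (1 - u)) \<le> 1"
      using u mult_le_one[of u "1 - u"] by auto
    show "\<omega> (q v) * (\<eta> v' * sqrt (u * (1 - u))) ^ r \<le> G u"
    proof (cases "E u")
      case True
      have "\<eta> v' * sqrt (u * (1 - u)) \<le> (C\<eta> * \<eta> u) * sqrt (u * (1 - u))"
        using True \<delta> u v' s by (intro mult_right_mono C\<eta>(3)) (auto simp: E_def)
      \<comment> \<open>Since \<open>\<kappa> u \<ge> 1\<close>, the factor can be inserted; this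
        produces the expression dominated by \<open>h\<close>.\<close>
      also have "\<dots> \<le> C\<eta> * (\<kappa> u * \<eta> u * sqrt (u * (1 - u)))"
        using mult_right_mono[OF \<kappa>[OF u], of "\<eta> u * sqrt (u * (1 - u))"] \<eta>_pos[OF u] C\<eta>(1) s
        by (simp add: mult.assoc mult_left_mono)
      finally have "(\<eta> v' * sqrt (u * (1 - u))) ^ r \<le> (C\<eta> * (\<kappa> u * \<eta> u * sqrt (u * (1 - u)))) ^ r"
        using \<eta>_pos[OF v'01] s by (intro power_mono) auto
      moreover have "\<omega> (q v) \<le> CR * \<pi> u" using True \<delta> u v by (intro \<delta>R) (auto simp: E_def)
      ultimately have "\<omega> (q v) * (\<eta> v' * sqrt (u * (1 - u))) ^ r
          \<le> (CR * \<pi> u) * (C\<eta> * (\<kappa> u * \<eta> u * sqrt (u * (1 - u)))) ^ r"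
        using \<omega> \<pi>[OF u] \<delta>R(2) \<eta>_pos[OF v'01] s by (intro mult_mono) auto
      also have "\<dots> = CR * C\<eta> ^ r * (\<pi> u * (\<kappa> u * \<eta> u * sqrt (u * (1 - u))) ^ r)"
        by (simp add: power_mult_distrib)
      also have "\<dots> \<le> CR * C\<eta> ^ r * h u"
        using \<delta>R C\<eta> h(3)[OF u] by (intro mult_left_mono) auto
      finally show ?thesis using True by (simp add: G_def)
    next
      case False
      then have "\<eta> v' \<le> D"
        using comparable_interval[OF v' c \<delta>(1)] by (intro D) (auto simp: E_def)
      then have "\<eta> v' * sqrt (u * (1 - u)) \<le> D * 1"
        using D(1) s by (intro mult_mono) auto
      then have "(\<eta> v' * sqrt (u * (1 - u))) ^ r \<le> D ^ r"
        using \<eta>_pos[OF v'01] s by (intro power_mono) auto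
      then show ?thesis using \<omega> B \<eta>_pos[OF v'01] s False by (auto simp: G_def intro!: mult_mono)
    qed
  qed
qed

end

section \<open>Boundedness in probability\<close>

text \<open>Bernoulli's inequality for real exponents, from convexity.\<close>

lemma powr_above_tangent_at_1:
  fixes x p :: real
  assumes "0 \<le> x" "1 \<le> p"
  shows "1 + p * (x - 1) \<le> x powr p"
proof (cases "x = 0")
  case False
  have "x powr p - 1 powr p \<ge> p * (x - 1)"
    using assms False
    by (intro convex_on_imp_above_tangent[OF powr_convex[OF assms(2)]])
       (auto intro!: derivative_eq_intros simp: is_interval_connected interior_open)
  then show ?thesis by simp
qed (use assms in auto)

text \<open>The power mean inequality: after division by the mean \<open>a\<close>, the tangent at 1
  bounds each \<open>p\<close>-th power from below, and the linear terms cancel in the sum.\<close>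

lemma mean_le_lp_norm:
  assumes p: "1 \<le> p" and n: "1 \<le> n"
  shows "(\<Sum>k=1..n. \<bar>v k\<bar>) / real n \<le> real n powr (- (1 / p)) * lp_norm p n v"
proof -
  define a where "a = (\<Sum>k=1..n. \<bar>v k\<bar>) / real n"
  have a0: "0 \<le> a" by (auto simp: a_def intro!: divide_nonneg_nonneg sum_nonneg)
  show ?thesis
  proof (cases "a = 0")
    case False
    with a0 have a: "0 < a" by simp
    have sa: "(\<Sum>k=1..n. \<bar>v k\<bar>) = a * real n" using n by (simp add: a_def)
    have s1: "(\<Sum>k=1..n. \<bar>v k\<bar> / a) = real n"
      unfolding sum_divide_distrib[symmetric] sa using a by simp
    have "(\<Sum>k=1..n. 1 + p * (\<bar>v k\<bar> / a - 1)) = real n + p * ((\<Sum>k=1..n. \<bar>v k\<bar> / a) - real n)"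
      by (simp add: sum.distrib sum_distrib_left[symmetric] sum_subtractf)
    then have "real n = (\<Sum>k=1..n. 1 + p * (\<bar>v k\<bar> / a - 1))" unfolding s1 by simp
    also have "\<dots> \<le> (\<Sum>k=1..n. (\<bar>v k\<bar> / a) powr p)"
      using a p by (intro sum_mono powr_above_tangent_at_1) auto
    also have "\<dots> = (\<Sum>k=1..n. \<bar>v k\<bar> powr p) / a powr p"
      using a by (simp add: powr_divide sum_divide_distrib)
    finally have "real n * a powr p \<le> (\<Sum>k=1..n. \<bar>v k\<bar> powr p)" using a by (simp add: pos_le_divide_eq)
    then have "(real n * a powr p) powr (1 / p) \<le> lp_norm p n v"
      unfolding lp_norm_def using p by (intro powr_mono2) auto
    also have "(real n * a powr p) powr (1 / p) = real n powr (1 / p) * a"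
      using a p by (simp add: powr_mult powr_powr)
    finally have "real n powr (- (1 / p)) * (real n powr (1 / p) * a) \<le> real n powr (- (1 / p)) * lp_norm p n v"
      by (intro mult_left_mono) auto
    also have "real n powr (- (1 / p)) * (real n powr (1 / p) * a) = a"
      using n by (simp add: mult.assoc[symmetric] powr_add[symmetric])
    finally show ?thesis by (simp add: a_def)
  next
    case True
    then show ?thesis unfolding a_def[symmetric] by (simp add: lp_norm_def)
  qed
qed

lemma (in real_distribution) eventually_measure_interval:
  assumes e: "0 < e"
  shows "eventually (\<lambda>C. 1 - e < measure M {-C<..C}) at_top"
proof -
  have "eventually (\<lambda>C. 1 - e / 2 < cdf M C) at_top"
    using cdf_lim_at_top_prob e by (intro order_tendstoD(1)) auto
  moreover have "eventually (\<lambda>C. cdf M (- C) < e / 2) at_top"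
    using filterlim_compose[OF cdf_lim_at_bot filterlim_uminus_at_bot_at_top] e
    by (intro order_tendstoD(2)) auto
  ultimately show ?thesis
    using eventually_gt_at_top[of 0]
  proof eventually_elim
    case (elim C)
    then show ?case using cdf_diff_eq[of "- C" C] by simp
  qed
qed

text \<open>A single law is tight, so \<open>K\<close> can be enlarged to cope with the finitely
  many laws below \<open>N\<close>. The bound is requested at \<open>\<epsilon> / 2\<close> to gain
  the strict inequality in \<open>tight\<close>.\<close>

lemma bigo_in_probI:
  assumes prob: "\<And>n. 1 \<le> n \<Longrightarrow> prob_space (M n)"
    and meas: "\<And>n. 1 \<le> n \<Longrightarrow> (\<lambda>x. \<zeta> n x / \<beta> n x) \<in> borel_measurable (M n)"
    and bound: "\<And>\<epsilon>::real. 0 < \<epsilon> \<Longrightarrow> \<exists>C N. \<forall>n\<ge>N. 1 \<le> n \<longrightarrow>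
      (\<exists>A\<in>sets (M n). 1 - \<epsilon> \<le> measure (M n) A \<and> (\<forall>x\<in>A. \<bar>\<zeta> n x / \<beta> n x\<bar> \<le> C))"
  shows "bigo_in_prob M \<zeta> \<beta>"
proof -
  let ?D = "\<lambda>n. distr (M (Suc n)) borel (\<lambda>x. \<zeta> (Suc n) x / \<beta> (Suc n) x)"
  have rd: "real_distribution (?D n)" for n
    using prob meas by (intro prob_space.real_distribution_distr) auto
  show ?thesis
    unfolding bigo_in_prob_def tight_def
  proof (intro conjI allI impI rd)
    fix \<epsilon> :: real assume e: "0 < \<epsilon>"
    obtain C N where CN: "\<forall>n\<ge>N. 1 \<le> n \<longrightarrow>
      (\<exists>A\<in>sets (M n). 1 - \<epsilon> / 2 \<le> measure (M n) A \<and> (\<forall>x\<in>A. \<bar>\<zeta> n x / \<beta> n x\<bar> \<le> C))"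
      using bound[of "\<epsilon> / 2"] e by auto
    have "eventually (\<lambda>K. \<forall>n\<in>{..<N}. 1 - \<epsilon> < measure (?D n) {-K<..K}) at_top"
      using real_distribution.eventually_measure_interval[OF rd e]
      by (intro eventually_ball_finite) auto
    then have "eventually (\<lambda>K. (\<forall>n\<in>{..<N}. 1 - \<epsilon> < measure (?D n) {-K<..K}) \<and> max 0 C < K) at_top"
      by (intro eventually_conj eventually_gt_at_top)
    then obtain K where K: "\<forall>n\<in>{..<N}. 1 - \<epsilon> < measure (?D n) {-K<..K}" "max 0 C < K"
      by (auto simp: eventually_at_top_linorder)
    have "1 - \<epsilon> < measure (?D n) {-K<..K}" for n
    proof (cases "n < N")
      case False
      then obtain A where A: "A \<in> sets (M (Suc n))" "1 - \<epsilon> / 2 \<le> measure (M (Suc n)) A"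
        "\<forall>x\<in>A. \<bar>\<zeta> (Suc n) x / \<beta> (Suc n) x\<bar> \<le> C"
        using CN[rule_format, of "Suc n"] by auto
      interpret prob_space "M (Suc n)" by (rule prob) simp
      have m: "(\<lambda>x. \<zeta> (Suc n) x / \<beta> (Suc n) x) \<in> borel_measurable (M (Suc n))" by (rule meas) simp
      have "measure (M (Suc n)) A \<le> measure (M (Suc n))
          ((\<lambda>x. \<zeta> (Suc n) x / \<beta> (Suc n) x) -` {-K<..K} \<inter> space (M (Suc n)))"
      proof (intro finite_measure_mono subsetI)
        show "(\<lambda>x. \<zeta> (Suc n) x / \<beta> (Suc n) x) -` {-K<..K} \<inter> space (M (Suc n)) \<in> events"
          using m by (rule measurable_sets) simp
        fix x assume x: "x \<in> A"
        then have "\<bar>\<zeta> (Suc n) x / \<beta> (Suc n) x\<bar> < K" using A(3) K(2) by force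
        then have "- K < \<zeta> (Suc n) x / \<beta> (Suc n) x \<and> \<zeta> (Suc n) x / \<beta> (Suc n) x < K" by linarith
        then show "x \<in> (\<lambda>x. \<zeta> (Suc n) x / \<beta> (Suc n) x) -` {-K<..K} \<inter> space (M (Suc n))"
          using x sets.sets_into_space[OF A(1)] by auto
      qed
      also have "\<dots> = measure (?D n) {-K<..K}" using m by (subst measure_distr) auto
      finally show ?thesis using A(2) e by linarith
    qed (use K in auto)
    then show "\<exists>a b. a < b \<and> (\<forall>n. 1 - \<epsilon> < measure (?D n) {a<..b})"
      using K(2) by (intro exI[of _ "- K"] exI[of _ K]) auto
  qed
qed

lemma (in prob_space) markov_complement:
  assumes W: "integrable M W" "\<And>x. x \<in> space M \<Longrightarrow> 0 \<le> W x" and b: "expectation W \<le> b" and a: "0 < a"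
  shows "{x\<in>space M. W x \<le> a} \<in> events" "1 - b / a \<le> prob {x\<in>space M. W x \<le> a}"
proof -
  have [measurable]: "W \<in> borel_measurable M" using W(1) by auto
  show ev: "{x\<in>space M. W x \<le> a} \<in> events" by measurable
  have "prob {x\<in>space M. \<not> W x \<le> a} \<le> prob {x\<in>space M. a \<le> W x}"
    by (intro finite_measure_mono) auto
  also have "\<dots> \<le> expectation W / a"
    by (rule integral_Markov_inequality_measure[OF W(1), of "{}"]) (use W(2) a in auto)
  also have "\<dots> \<le> b / a" using a b by (simp add: divide_right_mono)
  finally show "1 - b / a \<le> prob {x\<in>space M. W x \<le> a}"
    using prob_neg[of "\<lambda>x. W x \<le> a"] ev by simp
qed

section \<open>Concentrated scores\<close>

text \<open>
  Common properties of the uniform scores of an ordered sample and of the deterministic grid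
  \<open>k / (n + 1)\<close>; the two proxies are treated alike through them.
\<close>

definition concentrated_scores :: "'a measure \<Rightarrow> nat \<Rightarrow> (nat \<Rightarrow> 'a \<Rightarrow> real) \<Rightarrow> bool" where
  "concentrated_scores M n T \<longleftrightarrow>
     (\<forall>k\<in>{1..n}. T k \<in> borel_measurable M \<and>
        integrable M (\<lambda>x. (T k x - real k / (real n + 1))\<^sup>2) \<and>
        (\<integral>x. (T k x - real k / (real n + 1))\<^sup>2 \<partial>M)
          \<le> real k / (real n + 1) * (1 - real k / (real n + 1)) / real n) \<and>
     (\<forall>c\<ge>16. 1 - 64 / c \<le>
        measure M {x\<in>space M. \<forall>k\<in>{1..n}. comparable c (real k / (real n + 1)) (T k x)})"

lemma concentrated_scores_cong:
  assumes T: "concentrated_scores M n T"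
    and eq: "\<And>k x. k \<in> {1..n} \<Longrightarrow> x \<in> space M \<Longrightarrow> T k x = T' k x"
  shows "concentrated_scores M n T'"
  unfolding concentrated_scores_def
proof (intro conjI ballI allI impI)
  fix k assume k: "k \<in> {1..n}"
  let ?u = "real k / (real n + 1)"
  have "T k \<in> borel_measurable M \<longleftrightarrow> T' k \<in> borel_measurable M"
    by (intro measurable_cong eq k)
  then show "T' k \<in> borel_measurable M" using T k by (auto simp: concentrated_scores_def)
  have "integrable M (\<lambda>x. (T k x - ?u)\<^sup>2) \<longleftrightarrow> integrable M (\<lambda>x. (T' k x - ?u)\<^sup>2)"
    by (intro Bochner_Integration.integrable_cong) (simp_all add: eq[OF k])
  then show "integrable M (\<lambda>x. (T' k x - ?u)\<^sup>2)" using T k by (auto simp: concentrated_scores_def)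
  have "(\<integral>x. (T k x - ?u)\<^sup>2 \<partial>M) = (\<integral>x. (T' k x - ?u)\<^sup>2 \<partial>M)"
    by (intro Bochner_Integration.integral_cong) (simp_all add: eq[OF k])
  moreover have "(\<integral>x. (T k x - ?u)\<^sup>2 \<partial>M) \<le> ?u * (1 - ?u) / real n"
    using T k unfolding concentrated_scores_def by blast
  ultimately show "(\<integral>x. (T' k x - ?u)\<^sup>2 \<partial>M) \<le> ?u * (1 - ?u) / real n" by (simp only:)
next
  fix c :: real assume "16 \<le> c"
  moreover have "{x\<in>space M. \<forall>k\<in>{1..n}. comparable c (real k / (real n + 1)) (T' k x)}
      = {x\<in>space M. \<forall>k\<in>{1..n}. comparable c (real k / (real n + 1)) (T k x)}"
    using eq by auto
  ultimately show "1 - 64 / c \<le> measure M {x\<in>space M. \<forall>k\<in>{1..n}. comparable c (real k / (real n + 1)) (T' k x)}"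
    using T by (simp add: concentrated_scores_def)
qed

lemma concentrated_scores_comparable_sets:
  assumes "concentrated_scores M n T"
  shows "{x\<in>space M. \<forall>k\<in>{1..n}. comparable c (real k / (real n + 1)) (T k x)} \<in> sets M"
proof -
  have [measurable]: "T k \<in> borel_measurable M" if "k \<in> {1..n}" for k
    using assms that by (auto simp: concentrated_scores_def)
  show ?thesis unfolding comparable_def by measurable
qed

lemma (in uniform_sample) concentrated_scores_ordstat: "concentrated_scores M n ordstat"
  unfolding concentrated_scores_def
  using ordstat_meas ordstat_mean_square ordstat_comparable_prob by auto

lemma (in prob_space) concentrated_scores_grid: "concentrated_scores M n (\<lambda>k x. real k / (real n + 1))"
proof -
  have "comparable c (real k / (real n + 1)) (real k / (real n + 1))" if "k \<in> {1..n}" "16 \<le> c" for k c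
    using that by (intro comparable_refl) (auto simp: field_simps)
  then have "{x\<in>space M. \<forall>k\<in>{1..n}. comparable c (real k / (real n + 1)) (real k / (real n + 1))} = space M"
    if "16 \<le> c" for c
    using that by auto
  then show ?thesis by (auto simp: concentrated_scores_def prob_space)
qed

text \<open>A window of length \<open>2 * \<delta>\<close> over spacing \<open>1 / (n + 1)\<close>
  holds \<open>2 * \<delta> * (n + 1)\<close> points up to rounding; half of them pay for the
  rounding once \<open>\<delta> * n \<ge> 1\<close>.\<close>

lemma card_grid_window:
  assumes \<delta>: "0 < \<delta>" "\<delta> < u0" "u0 + \<delta> < 1" and n: "1 / \<delta> \<le> real n"
  shows "\<delta> * real n \<le> real (card {k\<in>{1..n}. \<bar>real k / (real n + 1) - u0\<bar> \<le> \<delta>})"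
proof -
  define k0 where "k0 = nat \<lfloor>(real n + 1) * (u0 - \<delta>)\<rfloor>"
  define m where "m = nat \<lfloor>2 * \<delta> * (real n + 1)\<rfloor>"
  have k0: "real k0 \<le> (real n + 1) * (u0 - \<delta>)" "(real n + 1) * (u0 - \<delta>) < real k0 + 1"
    using \<delta> by (auto simp: k0_def)
  have m: "real m \<le> 2 * \<delta> * (real n + 1)" "2 * \<delta> * (real n + 1) < real m + 1"
    using \<delta> by (auto simp: m_def)
  have "{k0 + 1..k0 + m} \<subseteq> {k\<in>{1..n}. \<bar>real k / (real n + 1) - u0\<bar> \<le> \<delta>}"
  proof
    fix k assume k: "k \<in> {k0 + 1..k0 + m}"
    then have "real k0 + 1 \<le> real k" "real k \<le> real k0 + real m" by auto
    then have b: "(real n + 1) * (u0 - \<delta>) \<le> real k" "real k \<le> (real n + 1) * (u0 + \<delta>)"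
      using k0 m by (auto simp: algebra_simps)
    have "(real n + 1) * (u0 + \<delta>) < (real n + 1) * 1" using \<delta> by (intro mult_strict_left_mono) auto
    then have "(real n + 1) * (u0 + \<delta>) < real n + 1" by (simp only: mult_1_right)
    with b(2) have "real k < real n + 1" by (rule order_le_less_trans)
    moreover have "u0 - \<delta> \<le> real k / (real n + 1)" "real k / (real n + 1) \<le> u0 + \<delta>"
      using b by (auto simp: pos_le_divide_eq pos_divide_le_eq mult.commute)
    ultimately show "k \<in> {k\<in>{1..n}. \<bar>real k / (real n + 1) - u0\<bar> \<le> \<delta>}" using k by auto
  qed
  then have "card {k0 + 1..k0 + m} \<le> card {k\<in>{1..n}. \<bar>real k / (real n + 1) - u0\<bar> \<le> \<delta>}"
    by (intro card_mono) auto
  moreover have "\<delta> * real n \<le> real m"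
    using m(2) n \<delta>(1) by (auto simp: field_simps)
  ultimately show ?thesis by simp
qed

text \<open>A law of large numbers by counting. The total square error of the scores has expectation
  at most \<open>1 / 4\<close> for every \<open>n\<close>, so with probability
  \<open>1 - \<epsilon>\<close> at most \<open>1 / (4 * \<epsilon> * \<delta>\<^sup>2)\<close>
  scores stray by more than \<open>\<delta>\<close>. For
  \<open>n \<ge> 1 / (2 * \<epsilon> * \<delta> ^ 3)\<close> this is at most half of the
  \<open>\<delta> * n\<close> grid points guaranteed in the window.\<close>

lemma (in prob_space) concentrated_scores_sum_lower_bound:
  assumes T: "concentrated_scores M n T" and \<delta>: "0 < \<delta>" "\<delta> < u0" "u0 + \<delta> < 1" and \<epsilon>: "0 < \<epsilon>"
    and n: "1 / \<delta> \<le> real n" "1 / (2 * \<epsilon> * \<delta> ^ 3) \<le> real n"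
    and d: "0 \<le> d" and G: "\<And>k x. k \<in> {1..n} \<Longrightarrow> x \<in> space M \<Longrightarrow> 0 \<le> G k x"
    "\<And>k x. k \<in> {1..n} \<Longrightarrow> x \<in> space M \<Longrightarrow> \<bar>T k x - u0\<bar> \<le> 2 * \<delta> \<Longrightarrow> d \<le> G k x"
  obtains A where "A \<in> events" "1 - \<epsilon> \<le> prob A" "\<forall>x\<in>A. d * \<delta> / 2 * real n \<le> (\<Sum>k=1..n. G k x)"
proof -
  let ?u = "\<lambda>k. real k / (real n + 1)"
  let ?W = "\<lambda>x. \<Sum>k=1..n. (T k x - ?u k)\<^sup>2"
  have int: "integrable M ?W"
    using T by (intro Bochner_Integration.integrable_sum) (auto simp: concentrated_scores_def)
  have np: "0 < real n" using \<delta> n(1) by (meson divide_pos_pos less_le_trans zero_less_one)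
  have "expectation ?W = (\<Sum>k=1..n. expectation (\<lambda>x. (T k x - ?u k)\<^sup>2))"
    using T by (intro Bochner_Integration.integral_sum) (auto simp: concentrated_scores_def)
  also have "\<dots> \<le> (\<Sum>k=1..n. (1 / 4) / real n)"
  proof (rule sum_mono)
    fix k assume "k \<in> {1..n}"
    then have "expectation (\<lambda>x. (T k x - ?u k)\<^sup>2) \<le> ?u k * (1 - ?u k) / real n"
      using T by (auto simp: concentrated_scores_def)
    also have "?u k * (1 - ?u k) \<le> 1 / 4"
    proof -
      have "v * (1 - v) \<le> 1 / 4" for v :: real
        using zero_le_power2[of "v - 1 / 2"] by (simp add: power2_eq_square algebra_simps)
      then show ?thesis .
    qed
    finally show "expectation (\<lambda>x. (T k x - ?u k)\<^sup>2) \<le> (1 / 4) / real n"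
      using np by (simp add: divide_right_mono)
  qed
  also have "\<dots> = 1 / 4" using np by simp
  finally have E: "expectation ?W \<le> 1 / 4" .
  let ?A = "{x\<in>space M. ?W x \<le> 1 / (4 * \<epsilon>)}"
  have "0 < 1 / (4 * \<epsilon>)" using \<epsilon> by simp
  note mk = markov_complement[OF int _ E this]
  show thesis
  proof (rule that[of ?A])
    show "?A \<in> events" by (rule mk) (auto intro: sum_nonneg)
    have "1 - 1 / 4 / (1 / (4 * \<epsilon>)) \<le> prob ?A" by (rule mk) (auto intro: sum_nonneg)
    then show "1 - \<epsilon> \<le> prob ?A" using \<epsilon> by simp
    show "\<forall>x\<in>?A. d * \<delta> / 2 * real n \<le> (\<Sum>k=1..n. G k x)"
    proof
      fix x assume x: "x \<in> ?A"
      let ?I = "{k\<in>{1..n}. \<bar>?u k - u0\<bar> \<le> \<delta>}"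
      have "d * (\<delta> * real n - (1 / (4 * \<epsilon>)) / \<delta>\<^sup>2) \<le> d * (real (card ?I) - ?W x / \<delta>\<^sup>2)"
        using x d card_grid_window[OF \<delta> n(1)] by (intro mult_left_mono diff_mono divide_right_mono) auto
      \<comment> \<open>The indicator of a stray score is replaced by its Chebyshev majorant
        \<open>(T k x - ?u k)\<^sup>2 / \<delta>\<^sup>2\<close>, so that the claim can be checked
        term by term.\<close>
      also have "\<dots> = (\<Sum>k=1..n. d * ((if \<bar>?u k - u0\<bar> \<le> \<delta> then 1 else 0) - (T k x - ?u k)\<^sup>2 / \<delta>\<^sup>2))"
        by (simp add: sum_distrib_left[symmetric] sum_subtractf sum_divide_distrib[symmetric] sum.If_cases Int_def)
      also have "\<dots> \<le> (\<Sum>k=1..n. G k x)"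
      proof (rule sum_mono)
        fix k assume k: "k \<in> {1..n}"
        let ?t = "(T k x - ?u k)\<^sup>2 / \<delta>\<^sup>2"
        have t0: "0 \<le> ?t" by simp
        have g0: "0 \<le> G k x" using G(1) k x by auto
        show "d * ((if \<bar>?u k - u0\<bar> \<le> \<delta> then 1 else 0) - ?t) \<le> G k x"
        proof (cases "\<bar>?u k - u0\<bar> \<le> \<delta> \<and> \<bar>T k x - ?u k\<bar> \<le> \<delta>")
          case True
          then have "d \<le> G k x" using k x by (intro G(2)) auto
          moreover have "d * (1 - ?t) \<le> d * 1" using d t0 by (intro mult_left_mono) auto
          ultimately show ?thesis using True by simp
        next
          case False
          have "1 \<le> ?t" if "\<not> \<bar>T k x - ?u k\<bar> \<le> \<delta>"
          proof -
            have "\<delta>\<^sup>2 \<le> \<bar>T k x - ?u k\<bar>\<^sup>2" using that \<delta> by (intro power_mono) auto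
            then show ?thesis using \<delta> by simp
          qed
          then have "(if \<bar>?u k - u0\<bar> \<le> \<delta> then 1 else 0) - ?t \<le> 0" using False t0 by auto
          then have "d * ((if \<bar>?u k - u0\<bar> \<le> \<delta> then 1 else 0) - ?t) \<le> 0" using d by (intro mult_nonneg_nonpos)
          then show ?thesis using g0 by linarith
        qed
      qed
      finally have "d * (\<delta> * real n - (1 / (4 * \<epsilon>)) / \<delta>\<^sup>2) \<le> (\<Sum>k=1..n. G k x)" .
      moreover have "(1 / (4 * \<epsilon>)) / \<delta>\<^sup>2 \<le> \<delta> / 2 * real n"
        using mult_left_mono[OF n(2), of "\<delta> / 2"] \<delta> \<epsilon> by (simp add: field_simps power2_eq_square power3_eq_cube)
      then have "d * (\<delta> / 2 * real n) \<le> d * (\<delta> * real n - (1 / (4 * \<epsilon>)) / \<delta>\<^sup>2)"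
        using d by (intro mult_left_mono) auto
      ultimately show "d * \<delta> / 2 * real n \<le> (\<Sum>k=1..n. G k x)" by simp
    qed
  qed
qed

text \<open>For \<open>r = 1\<close> the absolute value is bounded by the mean of
  \<open>y\<^sup>2 / b\<close> and \<open>b\<close>. Equality holds at
  \<open>\<bar>y\<bar> = b\<close>, so with \<open>b\<close> the bound on the root mean square error
  nothing is lost against Cauchy-Schwarz.\<close>

lemma (in prob_space) concentrated_scores_moment:
  assumes T: "concentrated_scores M n T" and k: "k \<in> {1..n}" and r: "r \<in> {1, 2}"
  defines "u \<equiv> real k / (real n + 1)"
  shows "integrable M (\<lambda>x. \<bar>T k x - u\<bar> ^ r)"
    and "expectation (\<lambda>x. \<bar>T k x - u\<bar> ^ r) \<le> (sqrt (u * (1 - u)) / sqrt (real n)) ^ r"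
proof -
  have u: "0 < u" "u < 1" using k by (auto simp: u_def field_simps)
  have n: "0 < real n" using k by auto
  define b where "b = sqrt (u * (1 - u)) / sqrt (real n)"
  have b: "0 < b" using u n by (simp add: b_def)
  have b2: "b\<^sup>2 = u * (1 - u) / real n" using u n by (simp add: b_def power_divide)
  have [measurable]: "T k \<in> borel_measurable M" using T k by (auto simp: concentrated_scores_def)
  have i2: "integrable M (\<lambda>x. (T k x - u)\<^sup>2)" and e2: "expectation (\<lambda>x. (T k x - u)\<^sup>2) \<le> b\<^sup>2"
    using T k by (auto simp: concentrated_scores_def u_def b2)
  have le: "\<bar>y\<bar> \<le> (y\<^sup>2 / b + b) / 2" for y
  proof -
    have "0 \<le> (\<bar>y\<bar> - b)\<^sup>2 / b" using b by simp
    also have "(\<bar>y\<bar> - b)\<^sup>2 / b = y\<^sup>2 / b + b - 2 * \<bar>y\<bar>"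
      using b by (simp add: power2_diff field_simps power2_eq_square)
    finally show ?thesis by simp
  qed
  have i: "integrable M (\<lambda>x. ((T k x - u)\<^sup>2 / b + b) / 2)" using i2 by auto
  have i1: "integrable M (\<lambda>x. \<bar>T k x - u\<bar>)"
    by (rule Bochner_Integration.integrable_bound[OF i]) (use le b in \<open>auto intro!: AE_I2 simp: abs_of_nonneg\<close>)
  have "expectation (\<lambda>x. \<bar>T k x - u\<bar>) \<le> expectation (\<lambda>x. ((T k x - u)\<^sup>2 / b + b) / 2)"
    using i1 i le by (intro integral_mono) auto
  also have "\<dots> = (expectation (\<lambda>x. (T k x - u)\<^sup>2) / b + b) / 2"
    using i2 by (simp add: prob_space)
  also have "\<dots> \<le> (b\<^sup>2 / b + b) / 2" using e2 b by (intro divide_right_mono add_right_mono) auto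
  also have "\<dots> = b" using b by (simp add: power2_eq_square)
  finally have e1: "expectation (\<lambda>x. \<bar>T k x - u\<bar>) \<le> b" .
  show "integrable M (\<lambda>x. \<bar>T k x - u\<bar> ^ r)" using r i1 i2 by auto
  show "expectation (\<lambda>x. \<bar>T k x - u\<bar> ^ r) \<le> (sqrt (u * (1 - u)) / sqrt (real n)) ^ r"
    using r e1 e2 unfolding b_def[symmetric] by auto
qed

text \<open>Both families are compared with their common centre \<open>?u k\<close>, so only their
  separate moments enter. The inequality for \<open>\<bar>a - b\<bar> ^ r\<close> costs a factor 2
  per family, 4 in total.\<close>

lemma (in prob_space) concentrated_scores_weighted_difference:
  assumes T: "concentrated_scores M n T" "concentrated_scores M n T'" and r: "r \<in> {1, 2}"
    and g: "\<And>k. k \<in> {1..n} \<Longrightarrow> 0 \<le> g k"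
  shows "integrable M (\<lambda>x. \<Sum>k=1..n. g k * \<bar>T k x - T' k x\<bar> ^ r)"
    and "expectation (\<lambda>x. \<Sum>k=1..n. g k * \<bar>T k x - T' k x\<bar> ^ r)
      \<le> 4 * (\<Sum>k=1..n. g k * (sqrt (real k / (real n + 1) * (1 - real k / (real n + 1))) / sqrt (real n)) ^ r)"
proof -
  let ?u = "\<lambda>k. real k / (real n + 1)"
  let ?b = "\<lambda>k. (sqrt (?u k * (1 - ?u k)) / sqrt (real n)) ^ r"
  note mo = concentrated_scores_moment[OF T(1) _ r] concentrated_scores_moment[OF T(2) _ r]
  have le: "\<bar>T k x - T' k x\<bar> ^ r \<le> 2 * \<bar>T k x - ?u k\<bar> ^ r + 2 * \<bar>T' k x - ?u k\<bar> ^ r" for k x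
  proof -
    have "\<bar>a - b\<bar> ^ r \<le> 2 * \<bar>a\<bar> ^ r + 2 * \<bar>b\<bar> ^ r" for a b :: real
      using r zero_le_power2[of "a + b"] by (auto simp: power2_eq_square algebra_simps)
    from this[of "T k x - ?u k" "T' k x - ?u k"] show ?thesis by simp
  qed
  have tm: "T k \<in> borel_measurable M" "T' k \<in> borel_measurable M" if "k \<in> {1..n}" for k
    using T that by (auto simp: concentrated_scores_def)
  have i: "integrable M (\<lambda>x. \<bar>T k x - T' k x\<bar> ^ r)" if k: "k \<in> {1..n}" for k
  proof (rule Bochner_Integration.integrable_bound)
    show "integrable M (\<lambda>x. 2 * \<bar>T k x - ?u k\<bar> ^ r + 2 * \<bar>T' k x - ?u k\<bar> ^ r)"
      using mo(1,3)[OF k] by auto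
    show "(\<lambda>x. \<bar>T k x - T' k x\<bar> ^ r) \<in> borel_measurable M" using tm[OF k] by measurable
  qed (use le in \<open>auto intro!: AE_I2\<close>)
  show "integrable M (\<lambda>x. \<Sum>k=1..n. g k * \<bar>T k x - T' k x\<bar> ^ r)"
    using i by (intro Bochner_Integration.integrable_sum integrable_mult_right) auto
  have "expectation (\<lambda>x. \<Sum>k=1..n. g k * \<bar>T k x - T' k x\<bar> ^ r)
      = (\<Sum>k=1..n. g k * expectation (\<lambda>x. \<bar>T k x - T' k x\<bar> ^ r))"
    using i by (subst Bochner_Integration.integral_sum) auto
  also have "\<dots> \<le> (\<Sum>k=1..n. g k * (4 * ?b k))"
  proof (intro sum_mono mult_left_mono g)
    fix k assume k: "k \<in> {1..n}"
    have "expectation (\<lambda>x. \<bar>T k x - T' k x\<bar> ^ r)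
        \<le> expectation (\<lambda>x. 2 * \<bar>T k x - ?u k\<bar> ^ r + 2 * \<bar>T' k x - ?u k\<bar> ^ r)"
      using mo(1,3)[OF k] i[OF k] le by (intro integral_mono) auto
    also have "\<dots> = 2 * expectation (\<lambda>x. \<bar>T k x - ?u k\<bar> ^ r) + 2 * expectation (\<lambda>x. \<bar>T' k x - ?u k\<bar> ^ r)"
      using mo(1,3)[OF k] by simp
    also have "\<dots> \<le> 4 * ?b k" using mo(2,4)[OF k] by simp
    finally show "expectation (\<lambda>x. \<bar>T k x - T' k x\<bar> ^ r) \<le> 4 * ?b k" .
  qed
  also have "\<dots> = 4 * (\<Sum>k=1..n. g k * ?b k)" by (simp add: sum_distrib_left mult_ac)
  finally show "expectation (\<lambda>x. \<Sum>k=1..n. g k * \<bar>T k x - T' k x\<bar> ^ r) \<le> 4 * (\<Sum>k=1..n. g k * ?b k)" .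
qed

section \<open>The error of the minimizer\<close>

text \<open>Purely deterministic, with \<open>a\<close> the ordered observations and
  \<open>b\<close> the ordered noise. For \<open>r = 1\<close> the error is at most
  \<open>2 * L * E + 2 * \<sigma> * K * sqrt n\<close> over \<open>d * n\<close>, for
  \<open>r = 2\<close> at most \<open>L * E + \<sigma> * sqrt (D * K)\<close> over \<open>D\<close>;
  the constant adds what the two cases require.\<close>

lemma minimizer_error_bound:
  fixes w \<psi> a b :: "nat \<Rightarrow> real"
  assumes r: "r \<in> {1, 2}" and n: "1 \<le> n" and \<sigma>: "0 < \<sigma>" and d: "0 < d" and K: "0 \<le> K"
    and w: "\<And>k. k \<in> {1..n} \<Longrightarrow> 0 \<le> w k" "\<And>k. k \<in> {1..n} \<Longrightarrow> w k \<le> L"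
      "\<And>k. k \<in> {1..n} \<Longrightarrow> w k * \<bar>\<psi> k\<bar> \<le> L"
    and den: "d * real n \<le> (\<Sum>k=1..n. w k * \<bar>\<psi> k\<bar> ^ r)"
    and num: "(\<Sum>k=1..n. w k * \<bar>b k - \<psi> k\<bar> ^ r) \<le> K * (real n / sqrt (real n) ^ r)"
    and min: "\<And>t. (\<Sum>k=1..n. w k * \<bar>a k - s * \<psi> k\<bar> ^ r) \<le> (\<Sum>k=1..n. w k * \<bar>a k - t * \<psi> k\<bar> ^ r)"
  shows "\<bar>s - \<sigma>\<bar> \<le> (2 * L / d + 2 * \<sigma> * K / d + \<sigma> * sqrt (K / d)) *
    ((\<Sum>k=1..n. \<bar>a k - \<sigma> * b k\<bar>) / real n + real n powr (- (1 / 2)))"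
proof -
  have n0: "0 < real n" using n by simp
  define h where "h = real n powr (- (1 / 2))"
  have h: "h = 1 / sqrt (real n)" "0 < h"
    unfolding h_def powr_minus using n0 by (simp_all add: powr_half_sqrt inverse_eq_divide)
  define E where "E = (\<Sum>k=1..n. \<bar>a k - \<sigma> * b k\<bar>)"
  define D where "D = (\<Sum>k=1..n. w k * \<bar>\<psi> k\<bar> ^ r)"
  have E: "0 \<le> E" by (auto simp: E_def intro: sum_nonneg)
  have L: "0 \<le> L" using w(1,2)[of 1] n by auto
  have dn: "0 < d * real n" using d n0 by simp
  have D: "d * real n \<le> D" "0 < D" using den dn by (auto simp: D_def)
  have "\<bar>s - \<sigma>\<bar> \<le> 2 * L / d * (E / real n) + (2 * \<sigma> * K / d + \<sigma> * sqrt (K / d)) * h"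
  proof (cases "r = 1")
    case True
    have "\<bar>s - \<sigma>\<bar> * (d * real n) \<le> \<bar>s - \<sigma>\<bar> * D" using D by (intro mult_left_mono) auto
    also have "\<dots> = (\<Sum>k=1..n. w k * \<bar>(s - \<sigma>) * \<psi> k\<bar>)"
      by (simp add: D_def True sum_distrib_left abs_mult mult_ac)
    also have "\<dots> \<le> (\<Sum>k=1..n. w k * (\<bar>a k - s * \<psi> k\<bar> + \<bar>a k - \<sigma> * \<psi> k\<bar>))"
      using w(1) by (intro sum_mono mult_left_mono) (auto simp: left_diff_distrib)
    also have "\<dots> = (\<Sum>k=1..n. w k * \<bar>a k - s * \<psi> k\<bar>) + (\<Sum>k=1..n. w k * \<bar>a k - \<sigma> * \<psi> k\<bar>)"
      by (simp add: distrib_left sum.distrib)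
    also have "\<dots> \<le> 2 * (\<Sum>k=1..n. w k * \<bar>a k - \<sigma> * \<psi> k\<bar>)"
      using min[of \<sigma>] True by simp
    also have "(\<Sum>k=1..n. w k * \<bar>a k - \<sigma> * \<psi> k\<bar>) \<le> (\<Sum>k=1..n. L * \<bar>a k - \<sigma> * b k\<bar> + \<sigma> * (w k * \<bar>b k - \<psi> k\<bar>))"
    proof (rule sum_mono)
      fix k assume k: "k \<in> {1..n}"
      have "\<bar>a k - \<sigma> * \<psi> k\<bar> \<le> \<bar>a k - \<sigma> * b k\<bar> + \<bar>\<sigma> * (b k - \<psi> k)\<bar>" by (simp add: right_diff_distrib)
      then have "w k * \<bar>a k - \<sigma> * \<psi> k\<bar> \<le> w k * (\<bar>a k - \<sigma> * b k\<bar> + \<sigma> * \<bar>b k - \<psi> k\<bar>)"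
        using w(1)[OF k] \<sigma> by (intro mult_left_mono) (auto simp: abs_mult)
      also have "\<dots> \<le> L * \<bar>a k - \<sigma> * b k\<bar> + \<sigma> * (w k * \<bar>b k - \<psi> k\<bar>)"
        using w(2)[OF k] by (simp add: distrib_left mult_right_mono)
      finally show "w k * \<bar>a k - \<sigma> * \<psi> k\<bar> \<le> L * \<bar>a k - \<sigma> * b k\<bar> + \<sigma> * (w k * \<bar>b k - \<psi> k\<bar>)" .
    qed
    also have "\<dots> = L * E + \<sigma> * (\<Sum>k=1..n. w k * \<bar>b k - \<psi> k\<bar>)"
      by (simp add: E_def sum.distrib sum_distrib_left)
    also have "\<dots> \<le> L * E + \<sigma> * (K * (real n * h))"
      using num True \<sigma> by (intro add_left_mono mult_left_mono) (auto simp: h)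
    finally have "\<bar>s - \<sigma>\<bar> * (d * real n) \<le> 2 * (L * E + \<sigma> * (K * (real n * h)))" by simp
    then have "\<bar>s - \<sigma>\<bar> \<le> 2 * (L * E + \<sigma> * (K * (real n * h))) / (d * real n)"
      using dn by (simp only: pos_le_divide_eq)
    also have "\<dots> = 2 * L / d * (E / real n) + 2 * \<sigma> * K / d * h"
      using n0 d by (simp add: field_simps)
    also have "\<dots> \<le> 2 * L / d * (E / real n) + (2 * \<sigma> * K / d + \<sigma> * sqrt (K / d)) * h"
      using \<sigma> K d h by (intro add_left_mono mult_right_mono) auto
    finally show ?thesis .
  next
    case False
    then have r2: "r = 2" using r by simp
    have sq: "w k * \<bar>x\<bar> ^ r = w k * x\<^sup>2" for k x by (simp add: r2)
    \<comment> \<open>The objective has derivative \<open>- 2 * P\<close> at \<open>s\<close>.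
      Moving by \<open>P / D\<close>, the exact Newton step, lowers it by
      \<open>P\<^sup>2 / D\<close>, so minimality forces \<open>P = 0\<close>.\<close>
    define P where "P = (\<Sum>k=1..n. w k * \<psi> k * (a k - s * \<psi> k))"
    have "(\<Sum>k=1..n. w k * (a k - s * \<psi> k)\<^sup>2) \<le> (\<Sum>k=1..n. w k * (a k - (s + P / D) * \<psi> k)\<^sup>2)"
      using min[of "s + P / D"] by (simp only: sq)
    also have "\<dots> = (\<Sum>k=1..n. w k * (a k - s * \<psi> k)\<^sup>2 - 2 * (P / D) * (w k * \<psi> k * (a k - s * \<psi> k))
        + (P / D)\<^sup>2 * (w k * (\<psi> k)\<^sup>2))"
      by (intro sum.cong refl) (simp add: power2_eq_square algebra_simps)
    also have "\<dots> = (\<Sum>k=1..n. w k * (a k - s * \<psi> k)\<^sup>2) - 2 * (P / D) * P + (P / D)\<^sup>2 * D"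
      by (simp only: sum.distrib sum_subtractf sum_distrib_left[symmetric] P_def[symmetric])
        (simp add: D_def r2)
    also have "2 * (P / D) * P = 2 * (P\<^sup>2 / D)" by (simp add: power2_eq_square)
    also have "(P / D)\<^sup>2 * D = P\<^sup>2 / D" using D by (simp add: power2_eq_square)
    finally have "P\<^sup>2 / D \<le> 0" by simp
    then have P: "P = 0" using D by (simp add: divide_le_0_iff)
    let ?F = "\<Sum>k=1..n. w k * \<psi> k * (a k - \<sigma> * b k)"
    let ?H = "\<Sum>k=1..n. w k * \<psi> k * (b k - \<psi> k)"
    \<comment> \<open>Splits \<open>a - s * \<psi>\<close> into \<open>(a - \<sigma> * b) + \<sigma>
      * (b - \<psi>) - (s - \<sigma>) * \<psi>\<close>.\<close>
    have "P = ?F + \<sigma> * ?H - (s - \<sigma>) * (\<Sum>k=1..n. w k * (\<psi> k)\<^sup>2)"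
      unfolding P_def sum_distrib_left sum.distrib[symmetric] sum_subtractf[symmetric]
      by (intro sum.cong refl) (simp add: power2_eq_square algebra_simps)
    then have id: "(s - \<sigma>) * D = ?F + \<sigma> * ?H" using P by (simp add: D_def r2)
    have F: "\<bar>?F\<bar> \<le> L * E"
    proof -
      have "\<bar>?F\<bar> \<le> (\<Sum>k=1..n. \<bar>w k * \<psi> k * (a k - \<sigma> * b k)\<bar>)" by (rule sum_abs)
      also have "\<dots> \<le> (\<Sum>k=1..n. L * \<bar>a k - \<sigma> * b k\<bar>)"
      proof (rule sum_mono)
        fix k assume k: "k \<in> {1..n}"
        have "\<bar>w k * \<psi> k * (a k - \<sigma> * b k)\<bar> = w k * \<bar>\<psi> k\<bar> * \<bar>a k - \<sigma> * b k\<bar>"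
          using w(1)[OF k] by (simp add: abs_mult)
        also have "\<dots> \<le> L * \<bar>a k - \<sigma> * b k\<bar>" using w(3)[OF k] by (intro mult_right_mono) auto
        finally show "\<bar>w k * \<psi> k * (a k - \<sigma> * b k)\<bar> \<le> L * \<bar>a k - \<sigma> * b k\<bar>" .
      qed
      finally show ?thesis by (simp add: E_def sum_distrib_left)
    qed
    \<comment> \<open>Cauchy-Schwarz with the weight shared equally between the factors; one of them
      is \<open>D\<close>, and dividing by \<open>D\<close> later gains
      \<open>1 / sqrt D\<close>.\<close>
    have H: "\<bar>?H\<bar> \<le> sqrt D * sqrt K"
    proof -
      have "?H\<^sup>2 = (\<Sum>k=1..n. (sqrt (w k) * \<psi> k) * (sqrt (w k) * (b k - \<psi> k)))\<^sup>2"
      proof (intro arg_cong[where f = "\<lambda>x. x\<^sup>2"] sum.cong refl)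
        fix k assume k: "k \<in> {1..n}"
        have "sqrt (w k) * sqrt (w k) = w k" using w(1)[OF k] by simp
        then show "w k * \<psi> k * (b k - \<psi> k) = (sqrt (w k) * \<psi> k) * (sqrt (w k) * (b k - \<psi> k))"
          by (metis (no_types, opaque_lifting) mult.assoc mult.commute)
      qed
      also have "\<dots> \<le> (\<Sum>k=1..n. (sqrt (w k) * \<psi> k)\<^sup>2) * (\<Sum>k=1..n. (sqrt (w k) * (b k - \<psi> k))\<^sup>2)"
        by (rule Cauchy_Schwarz_ineq_sum)
      also have "(\<Sum>k=1..n. (sqrt (w k) * \<psi> k)\<^sup>2) = D"
        unfolding D_def r2 by (intro sum.cong refl) (use w(1) in \<open>simp add: power_mult_distrib\<close>)
      also have "(\<Sum>k=1..n. (sqrt (w k) * (b k - \<psi> k))\<^sup>2) = (\<Sum>k=1..n. w k * \<bar>b k - \<psi> k\<bar> ^ r)"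
        unfolding r2 by (intro sum.cong refl) (use w(1) in \<open>simp add: power_mult_distrib\<close>)
      also have "D * \<dots> \<le> D * K" using num n0 D by (intro mult_left_mono) (auto simp: r2)
      finally have "sqrt (?H\<^sup>2) \<le> sqrt (D * K)" by (rule real_sqrt_le_mono)
      then show ?thesis by (simp add: real_sqrt_mult)
    qed
    have "\<bar>s - \<sigma>\<bar> * D = \<bar>(s - \<sigma>) * D\<bar>" using D by (simp add: abs_mult)
    also have "\<dots> \<le> \<bar>?F\<bar> + \<sigma> * \<bar>?H\<bar>" 
    proof -
      have "\<bar>\<sigma> * ?H\<bar> = \<sigma> * \<bar>?H\<bar>" using \<sigma> by (simp only: abs_mult abs_of_pos)
      then show ?thesis unfolding id using abs_triangle_ineq[of ?F "\<sigma> * ?H"] by (simp only:)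
    qed
    also have "\<dots> \<le> L * E + \<sigma> * (sqrt D * sqrt K)" using F H \<sigma> by (intro add_mono mult_left_mono) auto
    finally have "\<bar>s - \<sigma>\<bar> \<le> (L * E + \<sigma> * (sqrt D * sqrt K)) / D"
      using D by (simp only: pos_le_divide_eq)
    also have "\<dots> = L * E / D + \<sigma> * (sqrt K / sqrt D)"
    proof -
      have "sqrt D * sqrt K / D = sqrt K / sqrt D"
        using D real_div_sqrt[of D] by (simp add: field_simps)
      moreover have "(L * E + \<sigma> * (sqrt D * sqrt K)) / D = L * E / D + \<sigma> * (sqrt D * sqrt K / D)"
        by (simp add: add_divide_distrib)
      ultimately show ?thesis by (simp only:)
    qed
    also have "\<dots> \<le> L * E / (d * real n) + \<sigma> * (sqrt K / sqrt (d * real n))"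
      using D dn L E K \<sigma> by (intro add_mono mult_left_mono divide_left_mono) auto
    also have "\<dots> = L / d * (E / real n) + \<sigma> * sqrt (K / d) * h"
      using d n0 by (simp add: h real_sqrt_divide real_sqrt_mult)
    also have "\<dots> \<le> 2 * L / d * (E / real n) + (2 * \<sigma> * K / d + \<sigma> * sqrt (K / d)) * h"
      using L E d n0 \<sigma> K h by (intro add_mono mult_right_mono divide_right_mono) auto
    finally show ?thesis .
  qed
  also have "\<dots> \<le> (2 * L / d + 2 * \<sigma> * K / d + \<sigma> * sqrt (K / d)) * (E / real n) +
      (2 * L / d + 2 * \<sigma> * K / d + \<sigma> * sqrt (K / d)) * h"
    using L E d n0 \<sigma> K h by (intro add_mono mult_right_mono) auto
  finally show ?thesis by (simp add: E_def h_def distrib_left)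
qed

context smooth_law
begin

lemma concentrated_scores_sample:
  assumes "prob_space M" "iid_sample M \<mu> n V"
  shows "concentrated_scores M n (\<lambda>k x. \<Psi> (rearrange n (\<lambda>j. V j x) k))"
proof -
  interpret U: uniform_sample M n "\<lambda>i x. \<Psi> (V i x)"
    by (rule uniform_sample_scores[OF assms])
  show ?thesis
    by (rule concentrated_scores_cong[OF U.concentrated_scores_ordstat])
       (simp add: U.ordstat_def rearrange_mono_comp[OF mono_\<Psi>])
qed

text \<open>A positive integral yields a point \<open>x0\<close> with positive integrand whose score
  lies strictly inside the unit interval, as almost all scores do. Continuity spreads this over a
  window on the score scale, where concentration is available.\<close>

lemma positive_window:
  assumes \<omega>: "continuous_on UNIV \<omega>" "\<And>x. 0 \<le> \<omega> x" and pos: "0 < (\<integral>z. \<bar>z\<bar> ^ r * \<omega> z \<partial>\<mu>)"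
  obtains u0 \<delta> d where "0 < d" "0 < \<delta>" "\<delta> < u0" "u0 + \<delta> < 1"
    "\<And>x. \<bar>\<Psi> x - u0\<bar> \<le> 2 * \<delta> \<Longrightarrow> d \<le> \<omega> x * \<bar>x\<bar> ^ r"
proof -
  have "\<exists>x. \<Psi> x \<in> {0<..<1} \<and> \<bar>x\<bar> ^ r * \<omega> x \<noteq> 0"
  proof (rule ccontr)
    assume "\<not> ?thesis"
    then have "\<bar>x\<bar> ^ r * \<omega> x = 0" if "\<Psi> x \<in> {0<..<1}" for x using that by blast
    with AE_\<Psi> have "AE x in \<mu>. \<bar>x\<bar> ^ r * \<omega> x = 0" by (rule eventually_mono)
    then have "(\<integral>z. \<bar>z\<bar> ^ r * \<omega> z \<partial>\<mu>) = 0" by (rule integral_eq_zero_AE)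
    with pos show False by simp
  qed
  then obtain x0 where x0: "\<Psi> x0 \<in> {0<..<1}" "\<bar>x0\<bar> ^ r * \<omega> x0 \<noteq> 0" by blast
  define g where "g u = \<omega> (q u) * \<bar>q u\<bar> ^ r" for u
  have g0: "0 < g (\<Psi> x0)"
  proof -
    have "0 \<le> \<bar>x0\<bar> ^ r * \<omega> x0" using \<omega>(2)[of x0] by simp
    with x0(2) have "0 < \<bar>x0\<bar> ^ r * \<omega> x0" by linarith
    then show ?thesis unfolding g_def q_\<Psi>[OF x0(1)] by (simp only: mult.commute)
  qed
  have iq: "isCont q (\<Psi> x0)" by (rule isCont_q[OF x0(1)])
  have "isCont \<omega> (q (\<Psi> x0))" using \<omega>(1) continuous_on_eq_continuous_at[OF open_UNIV] by blast
  then have "isCont (\<lambda>u. \<omega> (q u)) (\<Psi> x0)" by (rule isCont_o2[OF iq])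
  then have "isCont g (\<Psi> x0)"
    unfolding g_def by (intro isCont_mult isCont_power continuous_rabs iq)
  then have "(g \<longlongrightarrow> g (\<Psi> x0)) (nhds (\<Psi> x0))"
    unfolding isCont_def tendsto_at_iff_tendsto_nhds .
  then have "eventually (\<lambda>u. g (\<Psi> x0) / 2 < g u) (nhds (\<Psi> x0))"
    by (rule order_tendstoD(1)) (use g0 in simp)
  then obtain \<delta>1 where d1: "0 < \<delta>1" "\<And>u. dist u (\<Psi> x0) < \<delta>1 \<Longrightarrow> g (\<Psi> x0) / 2 < g u"
    unfolding eventually_nhds_metric by blast
  \<comment> \<open>Division by 3 fits the closed radius \<open>2 * \<delta>\<close> strictly inside
    \<open>\<delta>1\<close> and the unit interval. The radius is doubled because a grid point
    within \<open>\<delta>\<close> of \<open>u0\<close> may have a score a further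
    \<open>\<delta>\<close> away.\<close>
  define \<delta> where "\<delta> = Min {\<delta>1, \<Psi> x0, 1 - \<Psi> x0} / 3"
  have "0 < 3 * \<delta>" "3 * \<delta> \<le> \<delta>1" "3 * \<delta> \<le> \<Psi> x0" "3 * \<delta> \<le> 1 - \<Psi> x0"
    using d1(1) x0(1) by (simp_all add: \<delta>_def)
  then have \<delta>: "0 < \<delta>" "2 * \<delta> < \<delta>1" "2 * \<delta> < \<Psi> x0" "2 * \<delta> < 1 - \<Psi> x0"
    by linarith+
  show thesis
  proof (rule that[of "g (\<Psi> x0) / 2" \<delta> "\<Psi> x0"])
    fix x assume x: "\<bar>\<Psi> x - \<Psi> x0\<bar> \<le> 2 * \<delta>"
    then have "g (\<Psi> x0) / 2 < g (\<Psi> x)" using \<delta> by (intro d1) (auto simp: dist_real_def)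
    moreover have "q (\<Psi> x) = x" using x \<delta> by (intro q_\<Psi>) auto
    ultimately show "g (\<Psi> x0) / 2 \<le> \<omega> x * \<bar>x\<bar> ^ r" by (simp add: g_def)
  qed (use g0 \<delta> in auto)
qed

text \<open>The mean value point lies between two scores comparable to \<open>u\<close>, so it is
  comparable to \<open>u\<close> as well and the envelope applies to it. The square root is traded
  to the score difference, whose standard deviation it matches.\<close>

lemma weighted_quantile_difference:
  assumes c: "1 < c" and u: "u \<in> {0<..<1}"
    and x: "comparable c u (\<Psi> x)" and y: "comparable c u (\<Psi> y)" and w: "0 \<le> w"
    and env: "\<And>v. comparable c u v \<Longrightarrow> w * (\<eta> v * sqrt (u * (1 - u))) ^ r \<le> g"
  shows "w * \<bar>x - y\<bar> ^ r \<le> g / sqrt (u * (1 - u)) ^ r * \<bar>\<Psi> x - \<Psi> y\<bar> ^ r"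
proof -
  have 01: "\<Psi> x \<in> {0<..<1}" "\<Psi> y \<in> {0<..<1}" using comparable_range c u x y by blast+
  obtain v where v: "min (\<Psi> x) (\<Psi> y) \<le> v" "v \<le> max (\<Psi> x) (\<Psi> y)"
    "\<bar>q (\<Psi> x) - q (\<Psi> y)\<bar> = \<eta> v * \<bar>\<Psi> x - \<Psi> y\<bar>"
    using quantile_mean_value[OF 01] by blast
  have cv: "comparable c u v" using v(1,2) x y by (auto simp: comparable_def min_def max_def split: if_splits)
  have s: "0 < sqrt (u * (1 - u))" using u by simp
  have xy: "\<bar>x - y\<bar> = \<eta> v * \<bar>\<Psi> x - \<Psi> y\<bar>" using v(3) q_\<Psi>[OF 01(1)] q_\<Psi>[OF 01(2)] by simp
  define t where "t = sqrt (u * (1 - u)) ^ r"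
  have t: "t \<noteq> 0" using s unfolding t_def by (intro power_not_zero) linarith
  have "w * \<bar>x - y\<bar> ^ r = w * (\<eta> v * sqrt (u * (1 - u))) ^ r / sqrt (u * (1 - u)) ^ r * \<bar>\<Psi> x - \<Psi> y\<bar> ^ r"
    unfolding xy power_mult_distrib t_def[symmetric] using t by simp
  also have "\<dots> \<le> g / sqrt (u * (1 - u)) ^ r * \<bar>\<Psi> x - \<Psi> y\<bar> ^ r"
    using env[OF cv] s by (intro mult_right_mono divide_right_mono) auto
  finally show ?thesis .
qed

end

lemma (in prob_space) prob_Int_ge:
  assumes "A \<in> events" "B \<in> events" "1 - a \<le> prob A" "1 - b \<le> prob B"
  shows "1 - (a + b) \<le> prob (A \<inter> B)"
proof -
  have "prob (A \<union> B) = prob A + prob B - prob (A \<inter> B)"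
    using assms(1,2) by (rule measure_Un3[OF fmeasurable_eq_sets[THEN equalityD2, THEN subsetD]
      fmeasurable_eq_sets[THEN equalityD2, THEN subsetD]])
  then show ?thesis using assms(3,4) prob_le_1[of "A \<union> B"] by linarith
qed

context smooth_law
begin

text \<open>Intersects four events of probability at least \<open>1 - \<epsilon>\<close>: a Markov
  bound for \<open>W\<close>, comparability of each family of scores, and the lower bound for the
  denominator. \<open>K\<close> is \<open>4 * C / \<epsilon>\<close> because \<open>W\<close> has
  mean at most \<open>4 * C\<close> times \<open>n / sqrt n ^ r\<close>.\<close>

lemma estimator_error_in_probability:
  fixes b \<psi> a :: "nat \<Rightarrow> 'a \<Rightarrow> real"
  assumes M: "prob_space M" and r: "r \<in> {1, 2}" and n: "1 \<le> n" and \<sigma>: "0 < \<sigma>"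
    and b: "concentrated_scores M n (\<lambda>k x. \<Psi> (b k x))"
    and \<psi>: "concentrated_scores M n (\<lambda>k x. \<Psi> (\<psi> k x))"
    and \<omega>: "\<And>x. 0 \<le> \<omega> x" "\<And>x. \<omega> x \<le> L" "\<And>x. \<omega> x * \<bar>x\<bar> \<le> L"
    and \<epsilon>: "0 < \<epsilon>" and c: "16 \<le> c" "64 / c \<le> \<epsilon>"
    and G: "\<And>u. u \<in> {0<..<1} \<Longrightarrow> 0 \<le> G u" "0 < C" "(\<Sum>k=1..n. G (real k / (real n + 1))) \<le> C * real n"
    and env: "\<And>k x v. k \<in> {1..n} \<Longrightarrow> x \<in> space M \<Longrightarrow> comparable c (real k / (real n + 1)) (\<Psi> (\<psi> k x)) \<Longrightarrow>
      comparable c (real k / (real n + 1)) v \<Longrightarrow>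
      \<omega> (\<psi> k x) * (\<eta> v * sqrt (real k / (real n + 1) * (1 - real k / (real n + 1)))) ^ r \<le> G (real k / (real n + 1))"
    and window: "0 < d" "0 < \<delta>" "\<delta> < u0" "u0 + \<delta> < 1"
      "\<And>x. \<bar>\<Psi> x - u0\<bar> \<le> 2 * \<delta> \<Longrightarrow> d \<le> \<omega> x * \<bar>x\<bar> ^ r"
    and large: "1 / \<delta> \<le> real n" "1 / (2 * \<epsilon> * \<delta> ^ 3) \<le> real n"
    and min: "\<And>x t. x \<in> space M \<Longrightarrow> (\<Sum>k=1..n. \<omega> (\<psi> k x) * \<bar>a k x - s x * \<psi> k x\<bar> ^ r)
      \<le> (\<Sum>k=1..n. \<omega> (\<psi> k x) * \<bar>a k x - t * \<psi> k x\<bar> ^ r)"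
  defines "d' \<equiv> d * \<delta> / 2" and "K \<equiv> 4 * C / \<epsilon>"
  shows "\<exists>A\<in>sets M. 1 - 4 * \<epsilon> \<le> measure M A \<and>
    (\<forall>x\<in>A. \<bar>s x - \<sigma>\<bar> \<le> (2 * L / d' + 2 * \<sigma> * K / d' + \<sigma> * sqrt (K / d')) *
      ((\<Sum>k=1..n. \<bar>a k x - \<sigma> * b k x\<bar>) / real n + real n powr (- (1 / 2))))"
proof -
  interpret M: prob_space M by (rule M)
  define u where "u k = real k / (real n + 1)" for k
  define g where "g k = G (u k) / sqrt (u k * (1 - u k)) ^ r" for k
  have u: "u k \<in> {0<..<1}" if "k \<in> {1..n}" for k using that by (auto simp: u_def field_simps)
  have s0: "0 < sqrt (u k * (1 - u k))" if "k \<in> {1..n}" for k using u[OF that] by simp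
  have n0: "0 < real n" using n by simp
  have g0: "0 \<le> g k" if "k \<in> {1..n}" for k
    using G(1)[OF u[OF that]] s0[OF that] unfolding g_def by (intro divide_nonneg_pos zero_less_power)
  define W where "W x = (\<Sum>k=1..n. g k * \<bar>\<Psi> (b k x) - \<Psi> (\<psi> k x)\<bar> ^ r)" for x
  have W: "integrable M W"
    "M.expectation W \<le> 4 * (\<Sum>k=1..n. g k * (sqrt (u k * (1 - u k)) / sqrt (real n)) ^ r)"
    using M.concentrated_scores_weighted_difference[OF b \<psi> r g0] unfolding W_def u_def by simp_all
  have "M.expectation W \<le> 4 * (\<Sum>k=1..n. g k * (sqrt (u k * (1 - u k)) / sqrt (real n)) ^ r)"
    by (rule W(2))
  \<comment> \<open>The normalisation in \<open>g\<close> cancels against the standard deviation of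
    the scores.\<close>
  also have "(\<Sum>k=1..n. g k * (sqrt (u k * (1 - u k)) / sqrt (real n)) ^ r) = (\<Sum>k=1..n. G (u k)) / sqrt (real n) ^ r"
    unfolding sum_divide_distrib
  proof (rule sum.cong)
    fix k assume k: "k \<in> {1..n}"
    define t where "t = sqrt (u k * (1 - u k))"
    have "t \<noteq> 0" using s0[OF k] unfolding t_def by linarith
    then show "g k * (sqrt (u k * (1 - u k)) / sqrt (real n)) ^ r = G (u k) / sqrt (real n) ^ r"
      unfolding g_def t_def[symmetric] by (simp add: power_divide)
  qed simp
  also have "\<dots> \<le> C * real n / sqrt (real n) ^ r"
    using G(3) n0 unfolding u_def by (intro divide_right_mono) auto
  finally have EW: "M.expectation W \<le> 4 * (C * real n / sqrt (real n) ^ r)" by simp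
  have K: "0 < K" using G(2) \<epsilon> by (simp add: K_def)
  define m where "m = real n / sqrt (real n) ^ r"
  have m: "0 < m" using n0 by (simp add: m_def)
  have Km: "0 < K * m" using K m by simp
  have W0: "0 \<le> W x" for x unfolding W_def using g0 by (intro sum_nonneg mult_nonneg_nonneg) auto
  let ?A1 = "{x\<in>space M. W x \<le> K * m}"
  have A1: "?A1 \<in> M.events" "1 - \<epsilon> \<le> M.prob ?A1"
  proof -
    note mk = M.markov_complement[OF W(1) W0 EW Km]
    show "?A1 \<in> M.events" by (rule mk(1))
    have "C * real n / sqrt (real n) ^ r = C * m" by (simp add: m_def)
    then have "4 * (C * real n / sqrt (real n) ^ r) / (K * m) = \<epsilon>"
      using G(2) \<epsilon> m by (simp add: K_def)
    then show "1 - \<epsilon> \<le> M.prob ?A1" using mk(2) by simp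
  qed
  let ?cmp = "\<lambda>T::nat \<Rightarrow> 'a \<Rightarrow> real. {x\<in>space M. \<forall>k\<in>{1..n}. comparable c (u k) (T k x)}"
  let ?A2 = "?cmp (\<lambda>k x. \<Psi> (b k x))" and ?A3 = "?cmp (\<lambda>k x. \<Psi> (\<psi> k x))"
  have A2: "?A2 \<in> M.events" "1 - \<epsilon> \<le> M.prob ?A2"
    using concentrated_scores_comparable_sets[OF b, of c] b c unfolding u_def concentrated_scores_def
    by (blast, fastforce)
  have A3: "?A3 \<in> M.events" "1 - \<epsilon> \<le> M.prob ?A3"
    using concentrated_scores_comparable_sets[OF \<psi>, of c] \<psi> c unfolding u_def concentrated_scores_def
    by (blast, fastforce)
  obtain A4 where A4: "A4 \<in> M.events" "1 - \<epsilon> \<le> M.prob A4"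
    "\<forall>x\<in>A4. d * \<delta> / 2 * real n \<le> (\<Sum>k=1..n. \<omega> (\<psi> k x) * \<bar>\<psi> k x\<bar> ^ r)"
  proof (rule M.concentrated_scores_sum_lower_bound[OF \<psi> window(2-4) \<epsilon> large])
    show "0 \<le> d" using window(1) by simp
    show "0 \<le> \<omega> (\<psi> k x) * \<bar>\<psi> k x\<bar> ^ r" for k x using \<omega>(1) by simp
  qed (use window(5) in auto)
  let ?A = "(?A1 \<inter> ?A2) \<inter> (?A3 \<inter> A4)"
  show ?thesis
  proof (intro bexI conjI ballI)
    show "?A \<in> M.events" using A1 A2 A3 A4 by blast
    have "1 - ((\<epsilon> + \<epsilon>) + (\<epsilon> + \<epsilon>)) \<le> M.prob ?A"
      using A1 A2 A3 A4 by (intro M.prob_Int_ge sets.Int)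
    then show "1 - 4 * \<epsilon> \<le> M.prob ?A" by simp
    fix x assume x: "x \<in> ?A"
    then have xs: "x \<in> space M" by simp
    show "\<bar>s x - \<sigma>\<bar> \<le> (2 * L / d' + 2 * \<sigma> * K / d' + \<sigma> * sqrt (K / d')) *
      ((\<Sum>k=1..n. \<bar>a k x - \<sigma> * b k x\<bar>) / real n + real n powr (- (1 / 2)))"
    proof (rule minimizer_error_bound[OF r n \<sigma>])
      show "0 < d'" using window by (simp add: d'_def)
      show "0 \<le> K" using K by simp
      show "d' * real n \<le> (\<Sum>k=1..n. \<omega> (\<psi> k x) * \<bar>\<psi> k x\<bar> ^ r)" using A4(3) x by (simp add: d'_def)
      have "(\<Sum>k=1..n. \<omega> (\<psi> k x) * \<bar>b k x - \<psi> k x\<bar> ^ r) \<le> W x"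
        unfolding W_def
      proof (rule sum_mono)
        fix k assume k: "k \<in> {1..n}"
        have c1: "comparable c (u k) (\<Psi> (b k x))" "comparable c (u k) (\<Psi> (\<psi> k x))" using x k by auto
        show "\<omega> (\<psi> k x) * \<bar>b k x - \<psi> k x\<bar> ^ r \<le> g k * \<bar>\<Psi> (b k x) - \<Psi> (\<psi> k x)\<bar> ^ r"
          unfolding g_def
        proof (rule weighted_quantile_difference[OF _ u[OF k] c1 \<omega>(1)])
          show "1 < c" using c by simp
          show "\<omega> (\<psi> k x) * (\<eta> v * sqrt (u k * (1 - u k))) ^ r \<le> G (u k)" if "comparable c (u k) v" for v
            using env[OF k xs, folded u_def, OF c1(2) that] .
        qed
      qed
      also have "\<dots> \<le> K * m" using x by simp
      finally show "(\<Sum>k=1..n. \<omega> (\<psi> k x) * \<bar>b k x - \<psi> k x\<bar> ^ r) \<le> K * (real n / sqrt (real n) ^ r)"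
        by (simp only: m_def)
    qed (use \<omega> min[OF xs] in auto)
  qed
qed

end

theorem corollary2p6:
  fixes p \<sigma> :: real and r :: nat
    and \<mu> :: "real measure" and \<Psi> f \<eta> \<omega> \<kappa> :: "real \<Rightarrow> real"
    and M :: "nat \<Rightarrow> 'a measure"
    and X Y Z \<xi> \<psi> :: "nat \<Rightarrow> nat \<Rightarrow> 'a \<Rightarrow> real"
    and S :: "nat \<Rightarrow> 'a \<Rightarrow> real"
  assumes p: "1 \<le> p" and r: "r \<in> {1, 2}" and \<sigma>: "0 < \<sigma>"
    and law: "real_distribution \<mu>" and cdf: "\<Psi> = cdf \<mu>"
    \<comment> \<open>the weight function\<close>
    and \<omega>_nonneg: "\<And>x. 0 \<le> \<omega> x"
    and \<omega>_cont: "continuous_on UNIV \<omega>"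
    and \<omega>_bounded: "bdd_above (range \<omega>)"
    and \<omega>_moment_bounded: "bdd_above (range (\<lambda>x. \<bar>x\<bar> ^ r * \<omega> x))"
    and \<omega>_moment_pos: "0 < (\<integral>z. \<bar>z\<bar> ^ r * \<omega> z \<partial>\<mu>)"
    \<comment> \<open>the sampling model\<close>
    and prob: "\<And>n. 1 \<le> n \<Longrightarrow> prob_space (M n)"
    and Y_meas: "\<And>n k. k \<in> {1..n} \<Longrightarrow> Y n k \<in> borel_measurable (M n)"
    and Z_iid: "\<And>n. 1 \<le> n \<Longrightarrow> iid_sample (M n) \<mu> n (Z n)"
    and X: "\<And>n k x. X n k x = Y n k x + \<sigma> * Z n k x"
    \<comment> \<open>\<open>\<kappa>\<close>\<close>
    and \<kappa>_meas: "\<kappa> \<in> borel_measurable (restrict_space borel {0<..<1})"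
    and \<kappa>_ge: "\<And>u. u \<in> {0<..<1} \<Longrightarrow> 1 \<le> \<kappa> u"
    and \<kappa>_lim: "filterlim (\<lambda>u. min (\<kappa> u) (\<kappa> (1 - u)) / sqrt (ln (ln (1 / u)))) at_top (at_right 0)"
    \<comment> \<open>(i), and \<open>\<eta> = (\<Psi>\<inverse>)' = 1 / (\<Psi>' \<circ> \<Psi>\<inverse>)\<close>\<close>
    and density_cont: "continuous_on UNIV f"
    and density_nonneg: "\<And>x. 0 \<le> f x"
    and density: "\<mu> = density lborel (\<lambda>x. ennreal (f x))"
    and density_pos: "\<And>x. x \<in> interior (measure_support \<mu>) \<Longrightarrow> 0 < f x"
    and \<eta>: "\<And>u. u \<in> {0<..<1} \<Longrightarrow> \<eta> u = 1 / f (quantile \<Psi> u)"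
    and quantile_deriv: "\<And>u. u \<in> {0<..<1} \<Longrightarrow> (quantile \<Psi> has_real_derivative \<eta> u) (at u)"
    \<comment> \<open>(ii)\<close>
    and ii: "compactly_supported (\<lambda>u. \<omega> (quantile \<Psi> u)) \<or> regvar_at_endpoints \<eta>"
    \<comment> \<open>(iii)\<close>
    and iii: "regvar_dominated (\<lambda>u. \<omega> (quantile \<Psi> u) * (\<kappa> u * \<eta> u * sqrt (u * (1 - u))) ^ r)"
    \<comment> \<open>the proxy: deterministic, or random and satisfying (iv)\<close>
    and proxy:
      "deterministic_proxy M \<Psi> \<psi> \<or>
       random_proxy M \<mu> X \<xi> \<psi> \<and>
       (\<forall>n\<ge>1. indep_vecs (M n) n (\<xi> n) (Z n)) \<and>
       (\<exists>\<pi>. (\<forall>u\<in>{0<..<1}. 0 \<le> \<pi> u \<and> \<omega> (quantile \<Psi> u) \<le> \<pi> u) \<and>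
            (compactly_supported \<pi> \<or> regvar_at_endpoints \<pi>) \<and>
            regvar_dominated (\<lambda>u. \<pi> u * (\<kappa> u * \<eta> u * sqrt (u * (1 - u))) ^ r))"
    \<comment> \<open>the estimator\<close>
    and S_meas: "\<And>n. 1 \<le> n \<Longrightarrow> S n \<in> borel_measurable (M n)"
    and S_min: "\<And>n x. 1 \<le> n \<Longrightarrow> x \<in> space (M n) \<Longrightarrow>
      is_arg_min (\<lambda>s. \<Sum>k=1..n. \<omega> (\<psi> n k x) *
          \<bar>rearrange n (\<lambda>j. X n j x) k - s * \<psi> n k x\<bar> ^ r) (\<lambda>_. True) (S n x)"
  shows "bigo_in_prob M (\<lambda>n x. \<bar>S n x - \<sigma>\<bar>)
     (\<lambda>n x. real n powr (- (1 / p)) * lp_norm p n (\<lambda>k. Y n k x) + real n powr (- (1 / 2)))"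
proof -
  interpret smooth_law \<mu> f \<eta>
    by (intro smooth_law.intro law smooth_law_axioms.intro density_cont density density_pos)
      (use cdf \<eta> quantile_deriv in auto)
  have mono\<sigma>: "mono (\<lambda>z. \<sigma> * z)" using \<sigma> by (auto intro!: monoI mult_left_mono)
  obtain B where B: "\<And>x. \<omega> x \<le> B" using \<omega>_bounded by (auto simp: bdd_above_def)
  obtain B' where B': "\<And>x. \<bar>x\<bar> ^ r * \<omega> x \<le> B'" using \<omega>_moment_bounded by (auto simp: bdd_above_def)
  \<comment> \<open>Since \<open>\<bar>x\<bar> \<le> 1 + \<bar>x\<bar> ^ r\<close>, the sum of the
    two bounds also controls \<open>\<omega> x * \<bar>x\<bar>\<close>, the multiplier of the
    \<open>Y\<close> term when \<open>r = 2\<close>.\<close>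
  define L where "L = B + B'"
  have L: "\<omega> x \<le> L" "\<omega> x * \<bar>x\<bar> \<le> L" for x
  proof -
    have "0 \<le> B'" using B'[of 0] \<omega>_nonneg[of 0] by (metis abs_ge_zero mult_nonneg_nonneg order_trans zero_le_power)
    then show "\<omega> x \<le> L" using B[of x] by (simp add: L_def)
    have "\<bar>x\<bar> \<le> 1 + \<bar>x\<bar> ^ r"
    proof (cases "r = 1")
      case False
      then have "r = 2" using r by simp
      then show ?thesis using zero_le_power2[of "\<bar>x\<bar> - 1 / 2"] by (simp add: power2_eq_square algebra_simps)
    qed simp
    then have "\<omega> x * \<bar>x\<bar> \<le> \<omega> x * (1 + \<bar>x\<bar> ^ r)" using \<omega>_nonneg by (intro mult_left_mono)
    also have "\<dots> \<le> L" using B[of x] B'[of x] by (simp add: L_def distrib_left mult.commute)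
    finally show "\<omega> x * \<bar>x\<bar> \<le> L" .
  qed
  obtain u0 \<delta> d where window: "0 < d" "0 < \<delta>" "\<delta> < u0" "u0 + \<delta> < 1"
    "\<And>x. \<bar>\<Psi> x - u0\<bar> \<le> 2 * \<delta> \<Longrightarrow> d \<le> \<omega> x * \<bar>x\<bar> ^ r"
    using positive_window[OF \<omega>_cont \<omega>_nonneg \<omega>_moment_pos] unfolding cdf by metis

  \<comment> \<open>Scores of the ordered noise and of the proxy\<close>
  have scoresZ: "concentrated_scores (M n) n (\<lambda>k x. cdf \<mu> (rearrange n (\<lambda>j. Z n j x) k))" if "1 \<le> n" for n
    using prob[OF that] Z_iid[OF that] by (rule concentrated_scores_sample)
  have u01: "real k / (real n + 1) \<in> {0<..<1}" if "k \<in> {1..n}" for k n :: nat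
    using that by (auto simp: field_simps)

  have scores\<psi>: "concentrated_scores (M n) n (\<lambda>k x. cdf \<mu> (\<psi> n k x))" if n: "1 \<le> n" for n
    using proxy
  proof (elim disjE conjE)
    assume "deterministic_proxy M \<Psi> \<psi>"
    then show ?thesis
      using n u01 by (intro concentrated_scores_cong[OF prob_space.concentrated_scores_grid[OF prob[OF n]]])
        (simp add: deterministic_proxy_def cdf \<Psi>_q)
  next
    assume rp: "random_proxy M \<mu> X \<xi> \<psi>"
    then have "iid_sample (M n) \<mu> n (\<xi> n)" using n by (simp add: random_proxy_def)
    then show ?thesis
      using rp n by (intro concentrated_scores_cong[OF concentrated_scores_sample[OF prob[OF n]]])
        (auto simp: random_proxy_def)
  qed

  \<comment> \<open>Envelope of the weighted quantile slopes, for a given factor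
    \<open>c\<close>\<close>
  have envelope: "\<exists>G C. 0 < C \<and> (\<forall>u\<in>{0<..<1}. 0 \<le> G u) \<and>
      (\<forall>n\<ge>1. (\<Sum>k=1..n. G (real k / (real n + 1))) \<le> C * real n) \<and>
      (\<forall>n\<ge>1. \<forall>k\<in>{1..n}. \<forall>x\<in>space (M n). \<forall>v. comparable c (real k / (real n + 1)) (cdf \<mu> (\<psi> n k x)) \<longrightarrow>
        comparable c (real k / (real n + 1)) v \<longrightarrow>
        \<omega> (\<psi> n k x) * (\<eta> v * sqrt (real k / (real n + 1) * (1 - real k / (real n + 1)))) ^ r
          \<le> G (real k / (real n + 1)))" (is "\<exists>G C. ?P G C")
    if c: "1 < c" for c
  proof -
    have q\<psi>: "q (cdf \<mu> (\<psi> n k x)) = \<psi> n k x"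
      if "k \<in> {1..n}" "comparable c (real k / (real n + 1)) (cdf \<mu> (\<psi> n k x))" for n k x
      by (rule q_\<Psi>) (rule comparable_range[OF that(2) c u01[OF that(1)]])
    show ?thesis
    proof (cases "compactly_supported (\<lambda>u. \<omega> (q u))")
      case True
      obtain C where C: "0 < C" "\<And>u v v'. u \<in> {0<..<1} \<Longrightarrow> comparable c u v \<Longrightarrow> comparable c u v' \<Longrightarrow>
          \<omega> (q v) * (\<eta> v' * sqrt (u * (1 - u))) ^ r \<le> C"
        using weight_envelope_compact[OF \<omega>_nonneg B c True, of r] by metis
      have "?P (\<lambda>_. C) C"
      proof (intro conjI allI impI ballI C(1))
        fix n k x v assume k: "1 \<le> n" "k \<in> {1..n}" "x \<in> space (M n)"
          and v: "comparable c (real k / (real n + 1)) (cdf \<mu> (\<psi> n k x))" "comparable c (real k / (real n + 1)) v"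
        show "\<omega> (\<psi> n k x) * (\<eta> v * sqrt (real k / (real n + 1) * (1 - real k / (real n + 1)))) ^ r \<le> C"
          using C(2)[OF u01[OF k(2)] v] q\<psi>[OF k(2) v(1)] by simp
      qed (use C(1) in auto)
      then show ?thesis by - (rule exI[of _ "\<lambda>_. C"], rule exI[of _ C])
    next
      case False
      then have rv: "regvar_at_endpoints \<eta>" using ii by (auto simp: cdf)
      from proxy consider (det) "deterministic_proxy M \<Psi> \<psi>"
        | (rnd) \<pi> where "\<forall>u\<in>{0<..<1}. 0 \<le> \<pi> u \<and> \<omega> (quantile \<Psi> u) \<le> \<pi> u"
            "compactly_supported \<pi> \<or> regvar_at_endpoints \<pi>"
            "regvar_dominated (\<lambda>u. \<pi> u * (\<kappa> u * \<eta> u * sqrt (u * (1 - u))) ^ r)"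
        by blast
      then show ?thesis
      proof cases
        \<comment> \<open>The proxy score is the grid point itself, so the weight is already
          evaluated where (iii) dominates it.\<close>
        case det
        obtain G C where G: "0 < C" "\<And>u. u \<in> {0<..<1} \<Longrightarrow> 0 \<le> G u"
          "\<And>n. 1 \<le> n \<Longrightarrow> (\<Sum>k=1..n. G (real k / (real n + 1))) \<le> C * real n"
          "\<And>u v v'. u \<in> {0<..<1} \<Longrightarrow> v = u \<and> u \<in> {0<..<1} \<Longrightarrow> comparable c u v' \<Longrightarrow>
            \<omega> (q v) * (\<eta> v' * sqrt (u * (1 - u))) ^ r \<le> G u"
        proof (rule weight_envelope_regvar[where R = "\<lambda>u v. v = u \<and> u \<in> {0<..<1}" and \<delta>R = 1 and CR = 1
              and \<pi> = "\<lambda>u. \<omega> (q u)", OF \<omega>_nonneg B c \<kappa>_ge rv])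
          show "regvar_dominated (\<lambda>u. \<omega> (q u) * (\<kappa> u * \<eta> u * sqrt (u * (1 - u))) ^ r)"
            using iii by (simp only: cdf)
          show "comparable c u v" if "v = u \<and> u \<in> {0<..<1}" for u v
            using that comparable_refl[OF c] by blast
        qed (use \<omega>_nonneg in auto)
        have "?P G C"
        proof (intro conjI allI impI ballI G(1,2,3))
          fix n k x v assume k: "1 \<le> n" "k \<in> {1..n}" "x \<in> space (M n)"
            and v: "comparable c (real k / (real n + 1)) v"
          have "\<psi> n k x = q (real k / (real n + 1))"
            using det k by (simp add: deterministic_proxy_def cdf)
          then show "\<omega> (\<psi> n k x) * (\<eta> v * sqrt (real k / (real n + 1) * (1 - real k / (real n + 1)))) ^ r
              \<le> G (real k / (real n + 1))"
            using G(4)[OF u01[OF k(2)] _ v] u01[OF k(2)] by simp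
        qed
        then show ?thesis by - (rule exI[of _ G], rule exI[of _ C])
      next
        \<comment> \<open>The weight sits at a random score but has to be dominated at the grid
          point. Its composition with the quantile function need not vary regularly, so the majorant
          \<open>\<pi>\<close> is carried from \<open>v\<close> to \<open>u\<close> instead.\<close>
        case rnd
        have \<pi>': "0 \<le> \<pi> u" "\<omega> (q u) \<le> \<pi> u" if "u \<in> {0<..<1}" for u
          using rnd(1) that unfolding cdf by blast+
        \<comment> \<open>A compactly supported majorant would put the weight into the case already
          settled.\<close>
        have "\<not> compactly_supported \<pi>"
        proof
          assume "compactly_supported \<pi>"
          then obtain S where S: "compact S" "S \<subseteq> {0<..<1}" "\<forall>u\<in>{0<..<1}. \<pi> u \<noteq> 0 \<longrightarrow> u \<in> S"
            unfolding compactly_supported_def by blast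
          have "u \<in> S" if "u \<in> {0<..<1}" "\<omega> (q u) \<noteq> 0" for u
          proof (rule S(3)[rule_format, OF that(1)])
            show "\<pi> u \<noteq> 0" using \<pi>'(2)[OF that(1)] \<omega>_nonneg[of "q u"] that(2) by linarith
          qed
          then have "compactly_supported (\<lambda>u. \<omega> (q u))"
            unfolding compactly_supported_def using S(1,2) by blast
          then show False using False by blast
        qed
        then have rv\<pi>: "regvar_at_endpoints \<pi>" using rnd(2) by blast
        obtain C\<pi> \<delta>\<pi> where C\<pi>: "0 < C\<pi>" "0 < \<delta>\<pi>"
          "\<And>u v. u \<in> {0<..<1} \<Longrightarrow> u < \<delta>\<pi> \<or> 1 - \<delta>\<pi> < u \<Longrightarrow> comparable c u v \<Longrightarrow> \<pi> v \<le> C\<pi> * \<pi> u"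
          using regvar_at_endpoints_comparable[OF rv\<pi> c] by metis
        obtain G C where G: "0 < C" "\<And>u. u \<in> {0<..<1} \<Longrightarrow> 0 \<le> G u"
          "\<And>n. 1 \<le> n \<Longrightarrow> (\<Sum>k=1..n. G (real k / (real n + 1))) \<le> C * real n"
          "\<And>u v v'. u \<in> {0<..<1} \<Longrightarrow> comparable c u v \<Longrightarrow> comparable c u v' \<Longrightarrow>
            \<omega> (q v) * (\<eta> v' * sqrt (u * (1 - u))) ^ r \<le> G u"
        proof (rule weight_envelope_regvar[where R = "comparable c" and \<delta>R = \<delta>\<pi> and CR = C\<pi>
              and \<pi> = \<pi>, OF \<omega>_nonneg B c \<kappa>_ge rv _ rnd(3)])
          show "\<omega> (q v) \<le> C\<pi> * \<pi> u"
            if "u \<in> {0<..<1}" "u < \<delta>\<pi> \<or> 1 - \<delta>\<pi> < u" "comparable c u v" for u v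
            using \<pi>'(2)[OF comparable_range[OF that(3) c that(1)]] C\<pi>(3)[OF that] by linarith
        qed (use \<pi>' C\<pi> in auto)
        have "?P G C"
        proof (intro conjI allI impI ballI G(1,2,3))
          fix n k x v assume k: "1 \<le> n" "k \<in> {1..n}" "x \<in> space (M n)"
            and v: "comparable c (real k / (real n + 1)) (cdf \<mu> (\<psi> n k x))" "comparable c (real k / (real n + 1)) v"
          show "\<omega> (\<psi> n k x) * (\<eta> v * sqrt (real k / (real n + 1) * (1 - real k / (real n + 1)))) ^ r
              \<le> G (real k / (real n + 1))"
            using G(4)[OF u01[OF k(2)] v] q\<psi>[OF k(2) v(1)] by simp
        qed
        then show ?thesis by - (rule exI[of _ G], rule exI[of _ C])
      qed
    qed
  qed

  \<comment> \<open>Assembly of the bound in probability\<close>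
  define \<beta> where "\<beta> n x = real n powr (- (1 / p)) * lp_norm p n (\<lambda>k. Y n k x) + real n powr (- (1 / 2))" for n x
  have "bigo_in_prob M (\<lambda>n x. \<bar>S n x - \<sigma>\<bar>) \<beta>"
  proof (rule bigo_in_probI[OF prob])
    fix n :: nat assume n: "1 \<le> n"
    have [measurable]: "S n \<in> borel_measurable (M n)" using S_meas n by blast
    have [measurable]: "Y n k \<in> borel_measurable (M n)" if "k \<in> {1..n}" for k using Y_meas that by blast
    show "(\<lambda>x. \<bar>S n x - \<sigma>\<bar> / \<beta> n x) \<in> borel_measurable (M n)"
      unfolding \<beta>_def lp_norm_def by measurable
  next
    fix \<epsilon>' :: real assume e': "0 < \<epsilon>'"
    \<comment> \<open>Four events share the failure probability; \<open>c\<close> is then the least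
      factor for which the comparability estimate guarantees failure at most
      \<open>\<epsilon>\<close>.\<close>
    define \<epsilon> where "\<epsilon> = \<epsilon>' / 4"
    have \<epsilon>: "0 < \<epsilon>" using e' by (simp add: \<epsilon>_def)
    define c where "c = max 16 (64 / \<epsilon>)"
    have c: "16 \<le> c" "64 / c \<le> \<epsilon>"
    proof -
      show "16 \<le> c" by (simp add: c_def)
      then show "64 / c \<le> \<epsilon>"
        using \<epsilon> max.cobounded2[of "64 / \<epsilon>" 16] by (simp add: c_def[symmetric] field_simps)
    qed
    obtain G C where GC: "0 < C" "\<forall>u\<in>{0<..<1}. 0 \<le> G u"
      "\<forall>n\<ge>1. (\<Sum>k=1..n. G (real k / (real n + 1))) \<le> C * real n"
      "\<forall>n\<ge>1. \<forall>k\<in>{1..n}. \<forall>x\<in>space (M n). \<forall>v. comparable c (real k / (real n + 1)) (cdf \<mu> (\<psi> n k x)) \<longrightarrow>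
        comparable c (real k / (real n + 1)) v \<longrightarrow>
        \<omega> (\<psi> n k x) * (\<eta> v * sqrt (real k / (real n + 1) * (1 - real k / (real n + 1)))) ^ r
          \<le> G (real k / (real n + 1))"
      using envelope[of c] c by auto
    define Q where "Q = 2 * L / (d * \<delta> / 2) + 2 * \<sigma> * (4 * C / \<epsilon>) / (d * \<delta> / 2)
      + \<sigma> * sqrt ((4 * C / \<epsilon>) / (d * \<delta> / 2))"
    have L0: "0 \<le> L" using L(1)[of 0] \<omega>_nonneg[of 0] by linarith
    have Q: "0 \<le> Q" using L0 window \<sigma> \<epsilon> GC(1) unfolding Q_def by (intro add_nonneg_nonneg) auto
    define N where "N = nat \<lceil>max (1 / \<delta>) (1 / (2 * \<epsilon> * \<delta> ^ 3))\<rceil>"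
    have "\<exists>A\<in>sets (M n). 1 - \<epsilon>' \<le> measure (M n) A \<and> (\<forall>x\<in>A. \<bar>\<bar>S n x - \<sigma>\<bar> / \<beta> n x\<bar> \<le> Q)"
      if nN: "N \<le> n" and n: "1 \<le> n" for n
    proof -
      have "max (1 / \<delta>) (1 / (2 * \<epsilon> * \<delta> ^ 3)) \<le> real N" unfolding N_def by (rule real_nat_ceiling_ge)
      then have large: "1 / \<delta> \<le> real n" "1 / (2 * \<epsilon> * \<delta> ^ 3) \<le> real n" using nN by auto
      have env: "\<omega> (\<psi> n k x) * (\<eta> v * sqrt (real k / (real n + 1) * (1 - real k / (real n + 1)))) ^ r
          \<le> G (real k / (real n + 1))"
        if "k \<in> {1..n}" "x \<in> space (M n)" "comparable c (real k / (real n + 1)) (cdf \<mu> (\<psi> n k x))"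
          "comparable c (real k / (real n + 1)) v" for k x v
        using GC(4) n that by blast
      have min: "(\<Sum>k=1..n. \<omega> (\<psi> n k x) * \<bar>rearrange n (\<lambda>j. X n j x) k - S n x * \<psi> n k x\<bar> ^ r)
          \<le> (\<Sum>k=1..n. \<omega> (\<psi> n k x) * \<bar>rearrange n (\<lambda>j. X n j x) k - t * \<psi> n k x\<bar> ^ r)"
        if "x \<in> space (M n)" for x t
        using S_min[OF n that] unfolding is_arg_min_def by (meson not_le)
      obtain A where A: "A \<in> sets (M n)" "1 - 4 * \<epsilon> \<le> measure (M n) A"
        "\<And>x. x \<in> A \<Longrightarrow> \<bar>S n x - \<sigma>\<bar> \<le> Q *
          ((\<Sum>k=1..n. \<bar>rearrange n (\<lambda>j. X n j x) k - \<sigma> * rearrange n (\<lambda>j. Z n j x) k\<bar>) / real n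
            + real n powr (- (1 / 2)))"
        using estimator_error_in_probability[OF prob[OF n] r n \<sigma> scoresZ[OF n] scores\<psi>[OF n] \<omega>_nonneg L \<epsilon> c
          _ GC(1) GC(3)[rule_format, OF n] env window[unfolded cdf] large min] GC(2)
        unfolding Q_def by blast
      have "\<bar>\<bar>S n x - \<sigma>\<bar> / \<beta> n x\<bar> \<le> Q" if x: "x \<in> A" for x
      proof -
        \<comment> \<open>As \<open>\<sigma> > 0\<close>, ordering commutes with scaling, so the
          contraction compares \<open>X\<close> with \<open>\<sigma> * Z\<close>, and their
          difference is \<open>Y\<close>.\<close>
        have "(\<Sum>k=1..n. \<bar>rearrange n (\<lambda>j. X n j x) k - \<sigma> * rearrange n (\<lambda>j. Z n j x) k\<bar>)
            = (\<Sum>k=1..n. \<bar>rearrange n (\<lambda>j. X n j x) k - rearrange n (\<lambda>j. \<sigma> * Z n j x) k\<bar>)"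
          using rearrange_mono_comp[OF mono\<sigma>] by (intro sum.cong) auto
        also have "\<dots> \<le> (\<Sum>k=1..n. \<bar>X n k x - \<sigma> * Z n k x\<bar>)" by (rule rearrange_L1_contraction)
        also have "\<dots> = (\<Sum>k=1..n. \<bar>Y n k x\<bar>)" by (simp add: X)
        finally have "(\<Sum>k=1..n. \<bar>rearrange n (\<lambda>j. X n j x) k - \<sigma> * rearrange n (\<lambda>j. Z n j x) k\<bar>) / real n
            \<le> (\<Sum>k=1..n. \<bar>Y n k x\<bar>) / real n" by (simp add: divide_right_mono)
        also have "\<dots> \<le> real n powr (- (1 / p)) * lp_norm p n (\<lambda>k. Y n k x)"
          by (rule mean_le_lp_norm[OF p n])
        finally have "Q * ((\<Sum>k=1..n. \<bar>rearrange n (\<lambda>j. X n j x) k - \<sigma> * rearrange n (\<lambda>j. Z n j x) k\<bar>) / real n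
            + real n powr (- (1 / 2))) \<le> Q * \<beta> n x"
          using Q unfolding \<beta>_def by (intro mult_left_mono add_right_mono)
        with A(3)[OF x] have "\<bar>S n x - \<sigma>\<bar> \<le> Q * \<beta> n x" by linarith
        moreover have "0 < \<beta> n x"
          unfolding \<beta>_def lp_norm_def using n by (intro add_nonneg_pos) auto
        ultimately show ?thesis by (simp add: pos_divide_le_eq)
      qed
      then show ?thesis using A(1,2) by (intro bexI[of _ A]) (auto simp: \<epsilon>_def)
    qed
    then show "\<exists>C N. \<forall>n\<ge>N. 1 \<le> n \<longrightarrow> (\<exists>A\<in>sets (M n). 1 - \<epsilon>' \<le> measure (M n) A \<and>
        (\<forall>x\<in>A. \<bar>\<bar>S n x - \<sigma>\<bar> / \<beta> n x\<bar> \<le> C))" by blast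
  qed
  then show ?thesis unfolding \<beta>_def .
qed

end
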